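(* Let $1<p<\infty$ and let $\Lambda$ be a countable set. For each $t\in[0,1]$ let $\psi_t:\Lambda\to B(l^p)$, $\varphi_t:\Lambda\to B(l^p)$ and $\rho_t:\Lambda\to B(l^p\oplus l^p)$ be maps such that (1) $\rho_0(a)=\psi_0(a)\oplus\varphi_0(a)$ for all $a\in\Lambda$; (2) $\rho_t(a)-\psi_t(a)\oplus\varphi_t(a)$ is compact for all $t\in[0,1]$, $a\in\Lambda$; (3) for each $a\in\Lambda$, $t\mapsto\pi(\psi_t(a))$ is continuous from $[0,1]$ to $B(l^p)/K(l^p)$; (4) $\sup_{t\in[0,1]}\|\rho_t(a)\|<\infty$ for every $a\in\Lambda$. Then there exist dyadic numbers $v(1),v(2),\ldots$ in $[0,1]$ such that $\bigoplus_{k\ge1}\rho_{v(k)}$ is $16$-similar modulo compact operators to $\psi_1\oplus\big(\bigoplus_{k\ge1}\rho_{v(k)}\big)$. Moreover, if $p=2$, the implementing operator can be taken unitary (unitary equivalence modulo compact operators).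
   Context: $\pi:B(l^p)\to B(l^p)/K(l^p)$ is the quotient map. Direct sums are $l^p$-direct sums; $(\bigoplus_k\rho_{v(k)})(a)=\bigoplus_k\rho_{v(k)}(a)$, which is bounded by (4). Maps $\rho_1:\Lambda\to B(\mathcal{Y}_1)$, $\rho_2:\Lambda\to B(\mathcal{Y}_2)$ are $\lambda$-similar modulo compact operators if there is an invertible $S:\mathcal{Y}_1\to\mathcal{Y}_2$ with $\|S\|\|S^{-1}\|\le\lambda$ and $\rho_2(a)-S\rho_1(a)S^{-1}$ compact for all $a\in\Lambda$. *)

theory Defs
  imports "HOL-Analysis.Analysis"
begin

text \<open>l^p spaces over a (countable) index type, with complex scalars.
  l^p = lp over nat; l^p (+) l^p = lp over nat + nat; l^p-direct sums of l^p-spaces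
  are lp over the disjoint union (product with nat) of the index types.\<close>

definition lp :: "real \<Rightarrow> ('i \<Rightarrow> complex) set" where
  "lp p = {x. (\<lambda>i. norm (x i) powr p) summable_on UNIV}"

definition lp_norm :: "real \<Rightarrow> ('i \<Rightarrow> complex) \<Rightarrow> real" where
  "lp_norm p x = (infsum (\<lambda>i. norm (x i) powr p) UNIV) powr (1 / p)"

definition lin_on :: "real \<Rightarrow> (('i \<Rightarrow> complex) \<Rightarrow> ('j \<Rightarrow> complex)) \<Rightarrow> bool" where
  "lin_on p T = (\<forall>x\<in>lp p. \<forall>y\<in>lp p. \<forall>c::complex.
      T (\<lambda>i. x i + y i) = (\<lambda>j. T x j + T y j) \<and> T (\<lambda>i. c * x i) = (\<lambda>j. c * T x j))"

text \<open>Bounded linear operators lp(I) -> lp(J) (only their action on lp matters).\<close>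
definition bounded_op :: "real \<Rightarrow> (('i \<Rightarrow> complex) \<Rightarrow> ('j \<Rightarrow> complex)) \<Rightarrow> bool" where
  "bounded_op p T = (lin_on p T \<and> (\<forall>x\<in>lp p. T x \<in> lp p) \<and>
      (\<exists>C. \<forall>x\<in>lp p. lp_norm p (T x) \<le> C * lp_norm p x))"

definition op_norm :: "real \<Rightarrow> (('i \<Rightarrow> complex) \<Rightarrow> ('j \<Rightarrow> complex)) \<Rightarrow> real" where
  "op_norm p T = Sup ((\<lambda>x. lp_norm p (T x)) ` {x \<in> lp p. lp_norm p x \<le> 1})"

text \<open>Compact operators: bounded, and the image of the unit ball is relatively compact
  (every sequence in the unit ball has a subsequence whose image is Cauchy; lp is complete).\<close>
definition compact_op :: "real \<Rightarrow> (('i \<Rightarrow> complex) \<Rightarrow> ('j \<Rightarrow> complex)) \<Rightarrow> bool" where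
  "compact_op p T = (bounded_op p T \<and>
     (\<forall>xs. (\<forall>n. xs n \<in> lp p \<and> lp_norm p (xs n) \<le> 1) \<longrightarrow>
        (\<exists>r :: nat \<Rightarrow> nat. strict_mono r \<and> (\<forall>e::real>0. \<exists>N. \<forall>m\<ge>N. \<forall>n\<ge>N.
              lp_norm p (\<lambda>j. T (xs (r m)) j - T (xs (r n)) j) < e))))"

text \<open>Norm in the Calkin algebra: ||pi(T)|| = inf over compact K of ||T - K||.\<close>
definition ess_norm :: "real \<Rightarrow> (('i \<Rightarrow> complex) \<Rightarrow> ('i \<Rightarrow> complex)) \<Rightarrow> real" where
  "ess_norm p T = Inf ((\<lambda>K. op_norm p (\<lambda>x i. T x i - K x i)) ` {K. compact_op p K})"

definition op_dsum ::
  "(('i \<Rightarrow> complex) \<Rightarrow> ('i \<Rightarrow> complex)) \<Rightarrow> (('j \<Rightarrow> complex) \<Rightarrow> ('j \<Rightarrow> complex))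
    \<Rightarrow> (('i + 'j) \<Rightarrow> complex) \<Rightarrow> (('i + 'j) \<Rightarrow> complex)" where
  "op_dsum A B = (\<lambda>x z. case z of Inl i \<Rightarrow> A (\<lambda>i'. x (Inl i')) i
                                 | Inr j \<Rightarrow> B (\<lambda>j'. x (Inr j')) j)"

definition op_bigdsum ::
  "(nat \<Rightarrow> ('i \<Rightarrow> complex) \<Rightarrow> ('i \<Rightarrow> complex)) \<Rightarrow> ((nat \<times> 'i) \<Rightarrow> complex) \<Rightarrow> ((nat \<times> 'i) \<Rightarrow> complex)" where
  "op_bigdsum F = (\<lambda>x (k, i). F k (\<lambda>i'. x (k, i')) i)"

definition similar_mod_compact ::
  "real \<Rightarrow> real \<Rightarrow> 'a set \<Rightarrow> ('a \<Rightarrow> ('i \<Rightarrow> complex) \<Rightarrow> ('i \<Rightarrow> complex))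
     \<Rightarrow> ('a \<Rightarrow> ('j \<Rightarrow> complex) \<Rightarrow> ('j \<Rightarrow> complex)) \<Rightarrow> bool" where
  "similar_mod_compact p lam \<Lambda> R1 R2 =
     (\<exists>(S :: ('i \<Rightarrow> complex) \<Rightarrow> ('j \<Rightarrow> complex)) Sinv.
        bounded_op p S \<and> bounded_op p Sinv \<and>
        (\<forall>x\<in>lp p. Sinv (S x) = x) \<and> (\<forall>y\<in>lp p. S (Sinv y) = y) \<and>
        op_norm p S * op_norm p Sinv \<le> lam \<and>
        (\<forall>a\<in>\<Lambda>. compact_op p (\<lambda>y j. R2 a y j - S (R1 a (Sinv y)) j)))"

text \<open>Unitary equivalence modulo compact operators (for p = 2): implementing operator is a
  surjective isometry (= unitary).\<close>
definition unitarily_equiv_mod_compact ::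
  "real \<Rightarrow> 'a set \<Rightarrow> ('a \<Rightarrow> ('i \<Rightarrow> complex) \<Rightarrow> ('i \<Rightarrow> complex))
     \<Rightarrow> ('a \<Rightarrow> ('j \<Rightarrow> complex) \<Rightarrow> ('j \<Rightarrow> complex)) \<Rightarrow> bool" where
  "unitarily_equiv_mod_compact p \<Lambda> R1 R2 =
     (\<exists>(S :: ('i \<Rightarrow> complex) \<Rightarrow> ('j \<Rightarrow> complex)) Sinv.
        bounded_op p S \<and> bounded_op p Sinv \<and>
        (\<forall>x\<in>lp p. Sinv (S x) = x) \<and> (\<forall>y\<in>lp p. S (Sinv y) = y) \<and>
        (\<forall>x\<in>lp p. lp_norm p (S x) = lp_norm p x) \<and>
        (\<forall>a\<in>\<Lambda>. compact_op p (\<lambda>y j. R2 a y j - S (R1 a (Sinv y)) j)))"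

definition dyadic :: "real \<Rightarrow> bool" where
  "dyadic x = (\<exists>m n :: nat. x = real m / 2 ^ n)"

end

theory Submission
  imports Defs
begin

text \<open>
  Let the slots of the direct sum be indexed by \<open>k\<close>, with infinitely many \<open>k\<close> such that \<open>v k = 0\<close> and
  with every dyadic number among the \<open>v k\<close>. Since \<open>\<rho>\<^sub>0 = \<psi>\<^sub>0 \<oplus> \<phi>\<^sub>0\<close> exactly, a permutation of
  coordinates identifies \<open>\<psi>\<^sub>1 \<oplus> (\<Oplus>\<^sub>k \<rho>\<^bsub>v k\<^esub>)\<close> with \<open>\<Oplus>\<^sub>k \<rho>\<^bsub>v k\<^esub>\<close> in which one copy of \<open>\<psi>\<^sub>0\<close> has been
  replaced by \<open>\<psi>\<^sub>1\<close>. It remains to undo this replacement modulo compact operators, by an operator that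
  acts only on the \<open>\<psi>\<close>-summands and is diagonal in the coordinate \<open>i\<close> of \<open>l\<^sup>p\<close>.

  Over coordinates \<open>i\<close> in the \<open>m\<close>-th range the operator is a permutation of finitely many slots that
  pushes \<open>\<psi>\<^sub>1\<close> down the chain \<open>1 \<rightarrow> 1 - 2\<^sup>-\<^sup>l \<rightarrow> \<dots> \<rightarrow> 0\<close>, where \<open>l\<close> grows with \<open>m\<close>; it moves each slot to
  one with a nearby parameter, so by continuity it intertwines up to \<open>2\<^sup>-\<^sup>m\<close> modulo compact operators.
  Refining the chain amounts to composing with a cyclic shift inside each gap. This shift is a product of
  two involutions \<open>\<tau>\<close>, and \<open>1\<close> is joined to \<open>\<tau>\<close> by the path \<open>(1 - g) + g \<tau>\<close> with \<open>|1 - 2 g| = 1\<close>, which has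
  norm at most \<open>2\<close> on \<open>l\<^sup>p\<close>, as has its inverse, and is unitary for \<open>p = 2\<close>. Letting \<open>g\<close> vary slowly with
  \<open>i\<close>, along blocks with respect to which the finitely many operators involved are almost tridiagonal,
  makes the commutators small. The errors are summable over \<open>m\<close>, hence the total error is compact.
\<close>

section \<open>Operators on \<open>l\<^sup>p\<close>\<close>

text \<open>The permutations involve ever more slots, so each passage between them needs bounds
  independent of their number. An involution \<open>\<tau>\<close> has only the eigenvalues 1 and
  -1, and \<open>(1 - g) + g \<tau>\<close> combines just two isometries; its eigenvalues are 1 and
  \<open>1 - 2 g\<close>. On the straight segment it would be singular at \<open>g = 1/2\<close>.
  The half circle avoids this point, and the inverse is the same expression with \<open>g\<close>
  conjugated. For a long cycle no such short formula is at hand. Both involutions stay inside the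
  gaps, since the permutation reached halfway must intertwine as well as those at the ends.

  The other obstacle is to make \<open>h\<close> almost commute with given operators at a cost that
  does not grow with the number of its steps. A jump of \<open>h\<close> is felt essentially between
  two adjacent blocks, and contributions with disjoint inputs and outputs combine like a maximum.
  That operators are almost tridiagonal requires compact operators to be small far out both in range
  and in domain; the latter fails for p = 1.

  Countability of the index set allows stage \<open>m\<close> to treat only finitely many
  elements.\<close>

lemma powr_convex_nonneg:
  fixes p s t u v :: real
  assumes "1 \<le> p" "0 \<le> s" "0 \<le> t" "s + t = 1" "0 \<le> u" "0 \<le> v"
  shows "(s * u + t * v) powr p \<le> s * u powr p + t * v powr p"
proof -
  have small: "r powr p \<le> r" if "0 \<le> r" "r \<le> 1" for r :: real
    using powr_mono'[of 1 p r] that assms(1) by (cases "r = 0") auto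
  \<comment> \<open>On the open half line this is convexity of the power; when \<open>u\<close> or
    \<open>v\<close> vanishes it reduces to \<open>s powr p \<le> s\<close> for \<open>s\<close> in
    the unit interval.\<close>
  show ?thesis
  proof (cases "u = 0 \<or> v = 0")
    case True
    have "s powr p \<le> s" "t powr p \<le> t"
      using assms by (auto intro!: small)
    then have "s powr p * u powr p \<le> s * u powr p" "t powr p * v powr p \<le> t * v powr p"
      by (auto intro: mult_right_mono)
    then show ?thesis
      using True assms by (auto simp: powr_mult)
  next
    case False
    then show ?thesis
      using assms convex_onD[OF powr_convex[OF assms(1)], of t u v]
      by (auto simp: eq_diff_eq[symmetric])
  qed
qed

locale lp_exponent =
  fixes p :: real
  assumes p_gt1: "1 < p"
begin

lemma p_pos: "0 < p" and p_ge1: "1 \<le> p"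
  using p_gt1 by auto

lemma lp_norm_nonneg [simp]: "0 \<le> lp_norm p x"
  by (simp add: lp_norm_def)

lemma lp_norm_powr: "lp_norm p x powr p = infsum (\<lambda>i. norm (x i) powr p) UNIV"
  using p_pos by (simp add: lp_norm_def powr_powr infsum_nonneg)

text \<open>All terms are nonnegative, so finite partial sums decide membership and bound the norm
  at once; most later estimates are estimates of finite sums for this reason.\<close>

lemma lp_boundI:
  assumes "0 \<le> C" "\<And>F. finite F \<Longrightarrow> (\<Sum>i\<in>F. norm (x i) powr p) \<le> C powr p"
  shows "x \<in> lp p" "lp_norm p x \<le> C"
proof -
  have s: "(\<lambda>i. norm (x i) powr p) summable_on UNIV"
    by (rule nonneg_bdd_above_summable_on) (auto intro!: bdd_aboveI2 assms)
  then show "x \<in> lp p"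
    by (simp add: lp_def)
  have "lp_norm p x powr p \<le> C powr p"
    unfolding lp_norm_powr using s assms by (intro infsum_le_finite_sums) auto
  then show "lp_norm p x \<le> C"
    using p_pos assms(1) by (metis lp_norm_nonneg not_le powr_less_mono2)
qed

lemma lp_finite_sum_le:
  assumes "x \<in> lp p" "finite F"
  shows "(\<Sum>i\<in>F. norm (x i) powr p) \<le> lp_norm p x powr p"
  unfolding lp_norm_powr using assms
  by (intro finite_sum_le_infsum) (auto simp: lp_def)

lemma lp_component_le:
  assumes "x \<in> lp p" shows "norm (x i) \<le> lp_norm p x"
proof -
  have "norm (x i) powr p \<le> lp_norm p x powr p"
    using lp_finite_sum_le[OF assms, of "{i}"] by simp
  then show ?thesis
    using p_pos by (metis lp_norm_nonneg norm_ge_zero not_le powr_less_mono2)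
qed

lemma lp_norm_zero_iff: "x \<in> lp p \<Longrightarrow> lp_norm p x = 0 \<longleftrightarrow> x = (\<lambda>_. 0)"
  using lp_component_le[of x] by (auto simp: lp_norm_def fun_eq_iff)

lemma lp_zero [simp]: "(\<lambda>_. 0) \<in> lp p" and lp_norm_zero [simp]: "lp_norm p (\<lambda>_. 0) = 0"
  by (auto simp: lp_def lp_norm_def)

text \<open>With a and b the norms of \<open>x\<close> and \<open>y\<close>, the sum is a + b times
  a convex combination of the normalised vectors, so convexity of the p-th power in each coordinate
  takes the place of Hoelder's inequality.\<close>

lemma lp_minkowski:
  assumes x: "x \<in> lp p" and y: "y \<in> lp p"
  shows "(\<lambda>i. x i + y i) \<in> lp p" "lp_norm p (\<lambda>i. x i + y i) \<le> lp_norm p x + lp_norm p y"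
proof -
  let ?a = "lp_norm p x" and ?b = "lp_norm p y"
  have "(\<lambda>i. x i + y i) \<in> lp p \<and> lp_norm p (\<lambda>i. x i + y i) \<le> ?a + ?b"
  proof (cases "?a = 0 \<or> ?b = 0")
    case True
    then show ?thesis
      using x y by (auto simp: lp_norm_zero_iff)
  next
    case False
    then have ab: "0 < ?a" "0 < ?b"
      by (auto simp: order_less_le)
    have fin: "(\<Sum>i\<in>F. norm (x i + y i) powr p) \<le> (?a + ?b) powr p" if "finite F" for F
    proof -
      let ?s = "?a / (?a + ?b)" and ?t = "?b / (?a + ?b)"
      have pt: "norm (x i + y i) powr p \<le> (?a + ?b) powr p *
           (?s * (norm (x i) powr p / ?a powr p) + ?t * (norm (y i) powr p / ?b powr p))" for i
      proof -
        have eq: "(?a + ?b) * (?s * (norm (x i) / ?a) + ?t * (norm (y i) / ?b)) = norm (x i) + norm (y i)"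
          using ab by (simp add: distrib_left)
        have "norm (x i + y i) powr p \<le> (norm (x i) + norm (y i)) powr p"
          using p_pos by (intro powr_mono2) (auto intro: norm_triangle_ineq)
        also have "\<dots> = (?a + ?b) powr p * (?s * (norm (x i) / ?a) + ?t * (norm (y i) / ?b)) powr p"
          unfolding eq[symmetric] using ab by (subst powr_mult) auto
        also have "\<dots> \<le> (?a + ?b) powr p * (?s * (norm (x i) / ?a) powr p + ?t * (norm (y i) / ?b) powr p)"
          using ab p_ge1 by (intro mult_left_mono powr_convex_nonneg) (auto simp: add_divide_distrib[symmetric])
        finally show ?thesis
          using ab by (simp add: powr_divide)
      qed
      have "(\<Sum>i\<in>F. norm (x i + y i) powr p) \<le> (\<Sum>i\<in>F. (?a + ?b) powr p *
           (?s * (norm (x i) powr p / ?a powr p) + ?t * (norm (y i) powr p / ?b powr p)))"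
        by (intro sum_mono pt)
      also have "\<dots> = (?a + ?b) powr p * (?s * ((\<Sum>i\<in>F. norm (x i) powr p) / ?a powr p)
           + ?t * ((\<Sum>i\<in>F. norm (y i) powr p) / ?b powr p))"
        by (simp only: sum_distrib_left[symmetric] sum.distrib sum_divide_distrib[symmetric])
      also have "\<dots> \<le> (?a + ?b) powr p * (?s * 1 + ?t * 1)"
        using lp_finite_sum_le[OF x that] lp_finite_sum_le[OF y that] ab
        by (intro mult_left_mono add_mono) auto
      also have "\<dots> = (?a + ?b) powr p"
        using ab by (simp add: add_divide_distrib[symmetric])
      finally show ?thesis .
    qed
    show ?thesis
      using lp_boundI[OF _ fin] by simp
  qed
  then show "(\<lambda>i. x i + y i) \<in> lp p" "lp_norm p (\<lambda>i. x i + y i) \<le> ?a + ?b"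
    by auto
qed

lemma lp_scale:
  assumes x: "x \<in> lp p"
  shows "(\<lambda>i. c * x i) \<in> lp p" "lp_norm p (\<lambda>i. c * x i) = norm c * lp_norm p x"
proof -
  have le: "(\<lambda>i. c * x i) \<in> lp p \<and> lp_norm p (\<lambda>i. c * x i) \<le> norm c * lp_norm p x"
    if x: "x \<in> lp p" for c and x :: "'a \<Rightarrow> complex"
  proof -
    have "(\<Sum>i\<in>F. norm (c * x i) powr p) \<le> (norm c * lp_norm p x) powr p" if "finite F" for F
      using lp_finite_sum_le[OF x that]
      by (simp add: norm_mult powr_mult sum_distrib_left[symmetric] mult_left_mono)
    then show ?thesis
      using lp_boundI[of "norm c * lp_norm p x" "\<lambda>i. c * x i"] by auto
  qed
  show cx: "(\<lambda>i. c * x i) \<in> lp p"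
    using le[OF x] by blast
  show "lp_norm p (\<lambda>i. c * x i) = norm c * lp_norm p x"
  proof (cases "c = 0")
    case False
    have "lp_norm p x \<le> norm (1 / c) * lp_norm p (\<lambda>i. c * x i)"
      using le[OF cx, of "1 / c"] False by simp
    then have "norm c * lp_norm p x \<le> lp_norm p (\<lambda>i. c * x i)"
      using False by (simp add: norm_divide field_simps)
    with le[OF x, of c] show ?thesis
      by auto
  qed auto
qed

lemma lp_diff:
  assumes "x \<in> lp p" "y \<in> lp p"
  shows "(\<lambda>i. x i - y i) \<in> lp p" "lp_norm p (\<lambda>i. x i - y i) \<le> lp_norm p x + lp_norm p y"
  using lp_minkowski[OF assms(1) lp_scale(1)[OF assms(2), of "-1"]] lp_scale(2)[OF assms(2), of "-1"]
  by auto

lemma lp_norm_diff_triangle: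
  assumes "x \<in> lp p" "y \<in> lp p" "z \<in> lp p"
  shows "lp_norm p (\<lambda>i. x i - z i) \<le> lp_norm p (\<lambda>i. x i - y i) + lp_norm p (\<lambda>i. y i - z i)"
  using lp_minkowski(2)[OF lp_diff(1)[OF assms(1,2)] lp_diff(1)[OF assms(2,3)]] by simp

lemma lp_norm_diff_commute: "lp_norm p (\<lambda>i. x i - y i) = lp_norm p (\<lambda>i. y i - x i)"
  unfolding lp_norm_def by (simp add: norm_minus_commute)

lemma lp_dominated:
  assumes "x \<in> lp p" "\<And>i. norm (y i) \<le> norm (x i)"
  shows "y \<in> lp p" "lp_norm p y \<le> lp_norm p x"
proof -
  have "(\<Sum>i\<in>F. norm (y i) powr p) \<le> lp_norm p x powr p" if "finite F" for F
    using p_pos assms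
    by (intro order_trans[OF sum_mono lp_finite_sum_le[OF assms(1) that]] powr_mono2) auto
  then show "y \<in> lp p" "lp_norm p y \<le> lp_norm p x"
    using lp_boundI[of "lp_norm p x" y] by auto
qed

lemma lp_tail:
  assumes "x \<in> lp p" "0 < e"
  shows "\<exists>F. finite F \<and> (\<forall>A. A \<inter> F = {} \<longrightarrow> lp_norm p (\<lambda>i. if i \<in> A then x i else 0) < e)"
proof -
  let ?f = "\<lambda>i. norm (x i) powr p"
  \<comment> \<open>Finite sums yield only a non-strict bound; working with e/2 makes the final one
    strict.\<close>
  have e: "0 < (e/2) powr p" and hs: "(?f has_sum infsum ?f UNIV) UNIV"
    using assms by (auto simp: lp_def)
  obtain F where F: "finite F" "dist (sum ?f F) (infsum ?f UNIV) \<le> (e/2) powr p"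
    using has_sum_finite_approximation[OF hs e] by blast
  have "lp_norm p (\<lambda>i. if i \<in> A then x i else 0) < e" if "A \<inter> F = {}" for A
  proof -
    have "(\<Sum>i\<in>G. norm (if i \<in> A then x i else 0) powr p) \<le> (e/2) powr p" if "finite G" for G
    proof -
      have "(\<Sum>i\<in>G. norm (if i \<in> A then x i else 0) powr p) = sum ?f (G \<inter> A)"
        using that p_pos by (intro sum.mono_neutral_cong_right) auto
      moreover have "sum ?f (G \<inter> A) + sum ?f F = sum ?f (G \<inter> A \<union> F)"
        using that F \<open>A \<inter> F = {}\<close> by (intro sum.union_disjoint[symmetric]) auto
      moreover have "\<dots> \<le> infsum ?f UNIV"
        using lp_finite_sum_le[OF assms(1), of "G \<inter> A \<union> F"] that F by (simp add: lp_norm_powr)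
      moreover have "infsum ?f UNIV \<le> sum ?f F + (e/2) powr p"
        using F(2) by (auto simp: dist_real_def)
      ultimately show ?thesis
        by linarith
    qed
    then show ?thesis
      using lp_boundI(2)[of "e/2" "\<lambda>i. if i \<in> A then x i else 0"] assms(2) by fastforce
  qed
  with F(1) show ?thesis
    by blast
qed

text \<open>Explicit constants are carried along instead of \<open>op_norm\<close>: they add and
  multiply under sums and composites, while a supremum of reals says something only after
  boundedness is known.\<close>

definition bounded_by :: "real \<Rightarrow> (('i \<Rightarrow> complex) \<Rightarrow> ('j \<Rightarrow> complex)) \<Rightarrow> bool" where
  "bounded_by C T \<longleftrightarrow> lin_on p T \<and> (\<forall>x\<in>lp p. T x \<in> lp p \<and> lp_norm p (T x) \<le> C * lp_norm p x)"

lemma bounded_byD: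
  assumes "bounded_by C T" "x \<in> lp p"
  shows "T x \<in> lp p" "lp_norm p (T x) \<le> C * lp_norm p x"
  using assms by (auto simp: bounded_by_def)

lemma
  assumes "bounded_by C T"
  shows bounded_by_add: "\<lbrakk>x \<in> lp p; y \<in> lp p\<rbrakk> \<Longrightarrow> T (\<lambda>i. x i + y i) = (\<lambda>j. T x j + T y j)"
    and bounded_by_scale: "x \<in> lp p \<Longrightarrow> T (\<lambda>i. c * x i) = (\<lambda>j. c * T x j)"
  using assms by (auto simp: bounded_by_def lin_on_def)

lemma bounded_by_diff:
  assumes "bounded_by C T" "x \<in> lp p" "y \<in> lp p"
  shows "T (\<lambda>i. x i - y i) = (\<lambda>j. T x j - T y j)"
  using bounded_by_add[OF assms(1,2) lp_scale(1)[OF assms(3), of "-1"]]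
    bounded_by_scale[OF assms(1,3), of "-1"] by simp

lemma bounded_by_mono: "bounded_by C T \<Longrightarrow> C \<le> D \<Longrightarrow> bounded_by D T"
  unfolding bounded_by_def by (meson lp_norm_nonneg mult_right_mono order_trans)

lemma bounded_opD:
  assumes "bounded_op p T"
  obtains C where "0 \<le> C" "bounded_by C T"
proof -
  obtain C where "bounded_by C T"
    using assms by (auto simp: bounded_op_def bounded_by_def)
  then have "bounded_by (max 0 C) T"
    by (rule bounded_by_mono) auto
  then show ?thesis
    using that[of "max 0 C"] by auto
qed

lemma bounded_byI_op: "bounded_by C T \<Longrightarrow> bounded_op p T"
  by (auto simp: bounded_op_def bounded_by_def)

lemma bounded_opD_lp: "bounded_op p T \<Longrightarrow> x \<in> lp p \<Longrightarrow> T x \<in> lp p"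
  by (auto simp: bounded_op_def)

lemma bounded_by_cong:
  assumes "bounded_by C T" "\<And>x. x \<in> lp p \<Longrightarrow> T x = T' x"
  shows "bounded_by C T'"
  using assms by (auto simp: bounded_by_def lin_on_def lp_minkowski lp_scale)

lemma op_norm_le:
  assumes "bounded_by C T" "0 \<le> C"
  shows "op_norm p T \<le> C"
  unfolding op_norm_def
proof (rule cSup_least)
  show "(\<lambda>x. lp_norm p (T x)) ` {x \<in> lp p. lp_norm p x \<le> 1} \<noteq> {}"
    using lp_zero by fastforce
  fix r assume "r \<in> (\<lambda>x. lp_norm p (T x)) ` {x \<in> lp p. lp_norm p x \<le> 1}"
  then obtain x where x: "x \<in> lp p" "lp_norm p x \<le> 1" "r = lp_norm p (T x)"
    by auto
  show "r \<le> C"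
    using bounded_byD(2)[OF assms(1) x(1)] mult_left_le[OF x(2) assms(2)] x(3) by simp
qed

lemma op_norm_upper:
  assumes "bounded_op p T" "x \<in> lp p" "lp_norm p x \<le> 1"
  shows "lp_norm p (T x) \<le> op_norm p T"
  unfolding op_norm_def
proof (rule cSup_upper)
  obtain C where C: "0 \<le> C" "bounded_by C T"
    using assms(1) by (rule bounded_opD)
  show "bdd_above ((\<lambda>x. lp_norm p (T x)) ` {x \<in> lp p. lp_norm p x \<le> 1})"
  proof (rule bdd_aboveI2)
    fix x :: "'a \<Rightarrow> complex" assume x: "x \<in> {x \<in> lp p. lp_norm p x \<le> 1}"
    show "lp_norm p (T x) \<le> C"
      using bounded_byD(2)[OF C(2), of x] mult_left_le[of "lp_norm p x" C] C(1) x by simp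
  qed
qed (use assms in auto)

lemma op_norm_nonneg: "bounded_op p T \<Longrightarrow> 0 \<le> op_norm p T"
  using order_trans[OF lp_norm_nonneg op_norm_upper[of T "\<lambda>_. 0"]] by simp

lemma bounded_by_op_norm:
  assumes "bounded_op p T"
  shows "bounded_by (op_norm p T) T"
proof -
  obtain C where C: "bounded_by C T"
    using assms by (rule bounded_opD)
  have "lp_norm p (T x) \<le> op_norm p T * lp_norm p x" if x: "x \<in> lp p" for x
  proof (cases "lp_norm p x = 0")
    case True
    then show ?thesis
      using bounded_byD(2)[OF C x] by simp
  next
    case False
    define c where "c = complex_of_real (1 / lp_norm p x)"
    have c: "norm c = 1 / lp_norm p x"
      by (simp add: c_def norm_divide)
    have "lp_norm p (T (\<lambda>i. c * x i)) \<le> op_norm p T"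
      using False by (intro op_norm_upper[OF assms]) (auto simp: lp_scale[OF x] c)
    also have "T (\<lambda>i. c * x i) = (\<lambda>j. c * T x j)"
      by (rule bounded_by_scale[OF C x])
    finally have "norm c * lp_norm p (T x) \<le> op_norm p T"
      by (simp only: lp_scale[OF bounded_byD(1)[OF C x]])
    moreover have "0 < lp_norm p x"
      using False by (simp add: order_less_le)
    ultimately show ?thesis
      by (simp add: c field_simps)
  qed
  then show ?thesis
    using C by (auto simp: bounded_by_def)
qed

lemma bounded_by_sum2:
  fixes T T' :: "('i \<Rightarrow> complex) \<Rightarrow> ('j \<Rightarrow> complex)"
  assumes "bounded_by C T" "bounded_by D T'"
  shows "bounded_by (C + D) (\<lambda>x j. T x j + T' x j)"
  unfolding bounded_by_def lin_on_def
proof (intro conjI ballI allI)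
  fix x :: "'i \<Rightarrow> complex" assume x: "x \<in> lp p"
  note Tx = bounded_byD[OF assms(1) x] bounded_byD[OF assms(2) x]
  show "(\<lambda>j. T x j + T' x j) \<in> lp p"
    using lp_minkowski(1) Tx by blast
  show "lp_norm p (\<lambda>j. T x j + T' x j) \<le> (C + D) * lp_norm p x"
    using lp_minkowski(2)[OF Tx(1,3)] Tx(2,4) by (simp add: distrib_right)
qed (auto simp: bounded_by_add[OF assms(1)] bounded_by_add[OF assms(2)]
      bounded_by_scale[OF assms(1)] bounded_by_scale[OF assms(2)] algebra_simps)

lemma bounded_by_scaled:
  assumes "bounded_by C T"
  shows "bounded_by (norm c * C) (\<lambda>x j. c * T x j)"
  using bounded_byD[OF assms] bounded_by_add[OF assms] bounded_by_scale[OF assms]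
  by (auto simp: bounded_by_def lin_on_def lp_scale distrib_left mult.assoc mult_left_mono fun_eq_iff)

lemma bounded_by_diff2:
  assumes "bounded_by C T" "bounded_by D T'"
  shows "bounded_by (C + D) (\<lambda>x j. T x j - T' x j)"
  using bounded_by_sum2[OF assms(1) bounded_by_scaled[OF assms(2), of "-1"]] by simp

lemma bounded_by_comp:
  fixes T :: "('i \<Rightarrow> complex) \<Rightarrow> ('j \<Rightarrow> complex)" and T' :: "('k \<Rightarrow> complex) \<Rightarrow> ('i \<Rightarrow> complex)"
  assumes "bounded_by C T" "bounded_by D T'" "0 \<le> C"
  shows "bounded_by (C * D) (\<lambda>x. T (T' x))"
  unfolding bounded_by_def lin_on_def
proof (intro conjI ballI allI)
  fix x :: "'k \<Rightarrow> complex" assume x: "x \<in> lp p"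
  note Tx = bounded_byD[OF assms(2) x]
  show "T (T' x) \<in> lp p"
    using bounded_byD(1)[OF assms(1)] Tx by blast
  have "lp_norm p (T (T' x)) \<le> C * lp_norm p (T' x)"
    using bounded_byD(2)[OF assms(1)] Tx by blast
  also have "\<dots> \<le> C * (D * lp_norm p x)"
    using Tx assms(3) by (intro mult_left_mono) auto
  finally show "lp_norm p (T (T' x)) \<le> C * D * lp_norm p x"
    by simp
qed (simp_all add: bounded_by_add[OF assms(1)] bounded_by_add[OF assms(2)]
      bounded_by_scale[OF assms(1)] bounded_by_scale[OF assms(2)] bounded_byD[OF assms(2)])

lemma bounded_op_comp:
  assumes "bounded_op p T" "bounded_op p T'"
  shows "bounded_op p (\<lambda>x. T (T' x))"
  using assms by (elim bounded_opD) (rule bounded_byI_op[OF bounded_by_comp])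

lemma bounded_op_add:
  assumes "bounded_op p T" "bounded_op p T'"
  shows "bounded_op p (\<lambda>x j. T x j + T' x j)"
  using assms by (elim bounded_opD) (rule bounded_byI_op[OF bounded_by_sum2])

lemma bounded_op_diff:
  assumes "bounded_op p T" "bounded_op p T'"
  shows "bounded_op p (\<lambda>x j. T x j - T' x j)"
  using assms by (elim bounded_opD) (rule bounded_byI_op[OF bounded_by_diff2])

lemma bounded_op_cong:
  assumes "bounded_op p T" "\<And>x. x \<in> lp p \<Longrightarrow> T x = T' x"
  shows "bounded_op p T'"
  using assms(1) by (elim bounded_opD) (rule bounded_byI_op[OF bounded_by_cong[OF _ assms(2)]])

lemma bounded_by_zero: "bounded_by 0 (\<lambda>x j. 0)"
  by (auto simp: bounded_by_def lin_on_def)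

section \<open>Weighted composition operators\<close>

definition wcomp :: "('j \<Rightarrow> complex) \<Rightarrow> ('j \<Rightarrow> 'i) \<Rightarrow> ('i \<Rightarrow> complex) \<Rightarrow> 'j \<Rightarrow> complex" where
  "wcomp w f x = (\<lambda>j. w j * x (f j))"

text \<open>Where the weight does not vanish, each coordinate of the argument is read at most once.
  Injectivity is asked only there, so that partial inverses such as \<open>projl\<close> may take
  arbitrary values elsewhere.\<close>

lemma bounded_by_wcomp:
  assumes w: "\<And>j. norm (w j) \<le> B" and B: "0 \<le> B" and inj: "inj_on f {j. w j \<noteq> 0}"
  shows "bounded_by B (wcomp w f)"
  unfolding bounded_by_def
proof (intro conjI ballI)
  show "lin_on p (wcomp w f)"
    by (auto simp: lin_on_def wcomp_def algebra_simps)
  fix x :: "'b \<Rightarrow> complex" assume x: "x \<in> lp p"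
  have "(\<Sum>j\<in>F. norm (w j * x (f j)) powr p) \<le> (B * lp_norm p x) powr p" if F: "finite F" for F
  proof -
    let ?G = "F \<inter> {j. w j \<noteq> 0}"
    have "(\<Sum>j\<in>F. norm (w j * x (f j)) powr p) = (\<Sum>j\<in>?G. norm (w j * x (f j)) powr p)"
      using F p_pos by (intro sum.mono_neutral_right) auto
    also have "\<dots> \<le> (\<Sum>j\<in>?G. B powr p * norm (x (f j)) powr p)"
      using w p_pos by (intro sum_mono) (auto simp: norm_mult powr_mult intro!: mult_right_mono powr_mono2)
    also have "\<dots> = B powr p * (\<Sum>i\<in>f ` ?G. norm (x i) powr p)"
      using inj by (subst sum.reindex) (auto simp: sum_distrib_left inj_on_def)
    also have "\<dots> \<le> B powr p * lp_norm p x powr p"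
      using F x by (intro mult_left_mono lp_finite_sum_le) auto
    finally show ?thesis
      using B by (simp add: powr_mult)
  qed
  then show "wcomp w f x \<in> lp p" "lp_norm p (wcomp w f x) \<le> B * lp_norm p x"
    unfolding wcomp_def using B lp_boundI[of "B * lp_norm p x" "\<lambda>j. w j * x (f j)"] by auto
qed

lemma bounded_by_section:
  assumes "inj_on f A"
  shows "bounded_by 1 (\<lambda>x j. if j \<in> A then x (f j) else 0)"
proof -
  have "bounded_by 1 (wcomp (\<lambda>j. if j \<in> A then 1 else 0) f)"
    using assms by (intro bounded_by_wcomp) (auto intro: inj_on_subset)
  moreover have "wcomp (\<lambda>j. if j \<in> A then 1 else 0) f = (\<lambda>x j. if j \<in> A then x (f j) else 0)"
    by (auto simp: wcomp_def fun_eq_iff)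
  ultimately show ?thesis
    by simp
qed

lemma bounded_by_reindex: "inj f \<Longrightarrow> bounded_by 1 (\<lambda>x j. x (f j))"
  using bounded_by_section[of f UNIV] by simp

lemma bounded_by_restrict: "bounded_by 1 (\<lambda>x j. if j \<in> A then x j else 0)"
  using bounded_by_section[of "\<lambda>j. j" A] by simp

section \<open>Compact operators\<close>

definition lp_dist :: "('i \<Rightarrow> complex) \<Rightarrow> ('i \<Rightarrow> complex) \<Rightarrow> real" where
  "lp_dist x y = lp_norm p (\<lambda>i. x i - y i)"

lemma Metric_space_lp: "Metric_space (lp p) lp_dist"
proof
  show "lp_dist x y = lp_dist y x" for x y :: "'a \<Rightarrow> complex"
    unfolding lp_dist_def by (rule lp_norm_diff_commute)
  show "lp_dist x y = 0 \<longleftrightarrow> x = y" if "x \<in> lp p" "y \<in> lp p" for x y :: "'a \<Rightarrow> complex"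
    using lp_norm_zero_iff[OF lp_diff(1)[OF that]] by (auto simp: lp_dist_def fun_eq_iff)
  show "lp_dist x z \<le> lp_dist x y + lp_dist y z" if "x \<in> lp p" "y \<in> lp p" "z \<in> lp p"
    for x y z :: "'a \<Rightarrow> complex"
    using lp_norm_diff_triangle[OF that] by (simp add: lp_dist_def)
qed (simp add: lp_dist_def)

definition lp_Cauchy :: "(nat \<Rightarrow> 'i \<Rightarrow> complex) \<Rightarrow> bool" where
  "lp_Cauchy ys \<longleftrightarrow> (\<forall>e>0. \<exists>N. \<forall>m\<ge>N. \<forall>n\<ge>N. lp_norm p (\<lambda>j. ys m j - ys n j) < e)"

lemma compact_op_iff:
  "compact_op p T \<longleftrightarrow> bounded_op p T \<and> (\<forall>xs. (\<forall>n. xs n \<in> lp p \<and> lp_norm p (xs n) \<le> 1) \<longrightarrow>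
     (\<exists>r :: nat \<Rightarrow> nat. strict_mono r \<and> lp_Cauchy (\<lambda>n. T (xs (r n)))))"
  by (simp add: compact_op_def lp_Cauchy_def)

lemma lp_CauchyD:
  assumes "lp_Cauchy ys" "e > 0"
  obtains N where "\<And>m n. m \<ge> N \<Longrightarrow> n \<ge> N \<Longrightarrow> lp_norm p (\<lambda>j. ys m j - ys n j) < e"
  using assms unfolding lp_Cauchy_def by meson

text \<open>In a metric space total boundedness means that every sequence has a Cauchy subsequence;
  this is applied to the image of the unit ball. The centres of a finite net lie in that image and
  are pulled back to vectors of the ball. Nets suit limits of operators, subsequences suit
  sums.\<close>

lemma compact_op_iff_net:
  fixes T :: "('i \<Rightarrow> complex) \<Rightarrow> ('j \<Rightarrow> complex)"
  shows "compact_op p T \<longleftrightarrow> bounded_op p T \<and>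
     (\<forall>e>0. \<exists>X. finite X \<and> X \<subseteq> {x \<in> lp p. lp_norm p x \<le> 1} \<and>
        (\<forall>x\<in>lp p. lp_norm p x \<le> 1 \<longrightarrow> (\<exists>y\<in>X. lp_norm p (\<lambda>j. T x j - T y j) < e)))"
proof (cases "bounded_op p T")
  case True
  interpret M: Metric_space "lp p :: ('j \<Rightarrow> complex) set" lp_dist
    by (rule Metric_space_lp)
  define B where "B = {x :: 'i \<Rightarrow> complex. x \<in> lp p \<and> lp_norm p x \<le> 1}"
  have TB: "T x \<in> lp p" if "x \<in> B" for x
    using that bounded_opD_lp[OF True] by (auto simp: B_def)
  then have TBs: "T ` B \<subseteq> lp p"
    by blast
  have e1: "compact_op p T \<longleftrightarrow> (\<forall>xs :: nat \<Rightarrow> 'i \<Rightarrow> complex. range xs \<subseteq> B \<longrightarrow> (\<exists>r :: nat \<Rightarrow> nat. strict_mono r \<and> M.MCauchy ((T \<circ> xs) \<circ> r)))"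
  proof -
    have cauchy: "M.MCauchy ((T \<circ> xs) \<circ> r) \<longleftrightarrow> lp_Cauchy (\<lambda>n. T (xs (r n)))" if "range xs \<subseteq> B" for xs and r :: "nat \<Rightarrow> nat"
    proof -
      have "range ((T \<circ> xs) \<circ> r) \<subseteq> lp p"
        using that TB by auto
      then show ?thesis
        by (simp add: M.MCauchy_def lp_dist_def lp_Cauchy_def)
    qed
    have rng: "range xs \<subseteq> B \<longleftrightarrow> (\<forall>n. xs n \<in> lp p \<and> lp_norm p (xs n) \<le> 1)" for xs :: "nat \<Rightarrow> 'i \<Rightarrow> complex"
      by (auto simp: B_def)
    have f1: "compact_op p T \<longleftrightarrow> (\<forall>xs :: nat \<Rightarrow> 'i \<Rightarrow> complex. range xs \<subseteq> B \<longrightarrow> (\<exists>r :: nat \<Rightarrow> nat. strict_mono r \<and> lp_Cauchy (\<lambda>n. T (xs (r n)))))"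
      using True unfolding compact_op_iff rng by blast
    have f2: "(\<forall>xs :: nat \<Rightarrow> 'i \<Rightarrow> complex. range xs \<subseteq> B \<longrightarrow> (\<exists>r :: nat \<Rightarrow> nat. strict_mono r \<and> lp_Cauchy (\<lambda>n. T (xs (r n))))) \<longleftrightarrow> (\<forall>xs :: nat \<Rightarrow> 'i \<Rightarrow> complex. range xs \<subseteq> B \<longrightarrow> (\<exists>r :: nat \<Rightarrow> nat. strict_mono r \<and> M.MCauchy ((T \<circ> xs) \<circ> r)))"
    proof (intro iffI allI impI)
      fix xs :: "nat \<Rightarrow> 'i \<Rightarrow> complex"
      assume *: "\<forall>xs :: nat \<Rightarrow> 'i \<Rightarrow> complex. range xs \<subseteq> B \<longrightarrow> (\<exists>r :: nat \<Rightarrow> nat. strict_mono r \<and> lp_Cauchy (\<lambda>n. T (xs (r n))))" and xs: "range xs \<subseteq> B"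
      then obtain r :: "nat \<Rightarrow> nat" where "strict_mono r" "lp_Cauchy (\<lambda>n. T (xs (r n)))"
        by blast
      then show "\<exists>r :: nat \<Rightarrow> nat. strict_mono r \<and> M.MCauchy ((T \<circ> xs) \<circ> r)"
        using cauchy[OF xs] by blast
    next
      fix xs :: "nat \<Rightarrow> 'i \<Rightarrow> complex"
      assume *: "\<forall>xs :: nat \<Rightarrow> 'i \<Rightarrow> complex. range xs \<subseteq> B \<longrightarrow> (\<exists>r :: nat \<Rightarrow> nat. strict_mono r \<and> M.MCauchy ((T \<circ> xs) \<circ> r))" and xs: "range xs \<subseteq> B"
      then obtain r :: "nat \<Rightarrow> nat" where "strict_mono r" "M.MCauchy ((T \<circ> xs) \<circ> r)"
        by blast
      then show "\<exists>r :: nat \<Rightarrow> nat. strict_mono r \<and> lp_Cauchy (\<lambda>n. T (xs (r n)))"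
        using cauchy[OF xs] by blast
    qed
    show ?thesis
      by (rule trans[OF f1 f2])
  qed
  have e2: "(\<forall>xs :: nat \<Rightarrow> 'i \<Rightarrow> complex. range xs \<subseteq> B \<longrightarrow> (\<exists>r :: nat \<Rightarrow> nat. strict_mono r \<and> M.MCauchy ((T \<circ> xs) \<circ> r))) \<longleftrightarrow> (\<forall>ys :: nat \<Rightarrow> 'j \<Rightarrow> complex. range ys \<subseteq> T ` B \<longrightarrow> (\<exists>r :: nat \<Rightarrow> nat. strict_mono r \<and> M.MCauchy (ys \<circ> r)))"
  proof (intro iffI allI impI)
    fix ys :: "nat \<Rightarrow> 'j \<Rightarrow> complex"
    assume *: "\<forall>xs :: nat \<Rightarrow> 'i \<Rightarrow> complex. range xs \<subseteq> B \<longrightarrow> (\<exists>r :: nat \<Rightarrow> nat. strict_mono r \<and> M.MCauchy ((T \<circ> xs) \<circ> r))" "range ys \<subseteq> T ` B"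
    have "\<exists>x\<in>B. ys n = T x" for n
      using *(2) by blast
    then obtain xs where "\<forall>n. xs n \<in> B \<and> ys n = T (xs n)"
      by metis
    then have xs: "range xs \<subseteq> B" "ys = T \<circ> xs"
      by auto
    show "\<exists>r :: nat \<Rightarrow> nat. strict_mono r \<and> M.MCauchy (ys \<circ> r)"
      unfolding xs(2) using *(1) xs(1) by blast
  next
    fix xs :: "nat \<Rightarrow> 'i \<Rightarrow> complex"
    assume *: "\<forall>ys :: nat \<Rightarrow> 'j \<Rightarrow> complex. range ys \<subseteq> T ` B \<longrightarrow> (\<exists>r :: nat \<Rightarrow> nat. strict_mono r \<and> M.MCauchy (ys \<circ> r))" "range xs \<subseteq> B"
    have "range (T \<circ> xs) \<subseteq> T ` B"
      using *(2) by auto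
    with *(1) show "\<exists>r :: nat \<Rightarrow> nat. strict_mono r \<and> M.MCauchy ((T \<circ> xs) \<circ> r)"
      by blast
  qed
  have e3: "(\<forall>ys :: nat \<Rightarrow> 'j \<Rightarrow> complex. range ys \<subseteq> T ` B \<longrightarrow> (\<exists>r :: nat \<Rightarrow> nat. strict_mono r \<and> M.MCauchy (ys \<circ> r))) \<longleftrightarrow> M.mtotally_bounded (T ` B)"
    by (simp only: M.mtotally_bounded_sequentially TBs simp_thms)
  have e4: "M.mtotally_bounded (T ` B) \<longleftrightarrow> (\<forall>e>0. \<exists>X. finite X \<and> X \<subseteq> B \<and> (\<forall>x\<in>B. \<exists>y\<in>X. lp_norm p (\<lambda>j. T x j - T y j) < e))"
    (is "?L \<longleftrightarrow> ?R")
  proof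
    assume L: ?L
    show ?R
    proof (intro allI impI)
      fix e :: real assume "e > 0"
      then obtain K where K: "finite K" "K \<subseteq> T ` B" "T ` B \<subseteq> (\<Union>x\<in>K. M.mball x e)"
        using L[unfolded M.mtotally_bounded_def, rule_format, of e] by auto
      obtain X where X: "X \<subseteq> B" "finite X" "K = T ` X"
        using finite_subset_image[OF K(1,2)] by auto
      have "\<exists>y\<in>X. lp_norm p (\<lambda>j. T x j - T y j) < e" if "x \<in> B" for x
      proof -
        have "T x \<in> (\<Union>x\<in>K. M.mball x e)"
          using that K(3) by blast
        then obtain y where "y \<in> X" "T x \<in> M.mball (T y) e"
          unfolding X(3) by blast
        then have "lp_dist (T x) (T y) < e"
          by (simp add: M.in_mball M.commute)
        with \<open>y \<in> X\<close> show ?thesis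
          by (auto simp: lp_dist_def)
      qed
      with X(1,2) show "\<exists>X. finite X \<and> X \<subseteq> B \<and> (\<forall>x\<in>B. \<exists>y\<in>X. lp_norm p (\<lambda>j. T x j - T y j) < e)"
        by (intro exI[of _ X] conjI ballI) auto
    qed
  next
    assume R: ?R
    show ?L
      unfolding M.mtotally_bounded_def
    proof (intro allI impI)
      fix e :: real assume "e > 0"
      then obtain X where X: "finite X" "X \<subseteq> B" "\<forall>x\<in>B. \<exists>y\<in>X. lp_norm p (\<lambda>j. T x j - T y j) < e"
        using R[rule_format, of e] by auto
      have "T ` B \<subseteq> (\<Union>x\<in>T ` X. M.mball x e)"
      proof
        fix z assume "z \<in> T ` B"
        then obtain x where x: "x \<in> B" "z = T x"
          by blast
        then obtain y where y: "y \<in> X" "lp_dist (T x) (T y) < e"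
          using X(3) by (auto simp: lp_dist_def)
        then have "z \<in> M.mball (T y) e"
          using x X(2) TB by (auto simp: M.in_mball M.commute)
        with y(1) show "z \<in> (\<Union>x\<in>T ` X. M.mball x e)"
          by blast
      qed
      with X show "\<exists>K. finite K \<and> K \<subseteq> T ` B \<and> T ` B \<subseteq> (\<Union>x\<in>K. M.mball x e)"
        by (intro exI[of _ "T ` X"] conjI finite_imageI image_mono) auto
    qed
  qed
  show ?thesis
    unfolding trans[OF e1 trans[OF e2 trans[OF e3 e4]]] using True by (simp add: B_def Ball_def imp_conjL)
qed (auto simp: compact_op_def)

lemma compact_op_bounded: "compact_op p T \<Longrightarrow> bounded_op p T"
  by (simp add: compact_op_def)

lemma compact_op_subsequence:
  assumes "compact_op p T" "\<And>n. xs n \<in> lp p" "\<And>n. lp_norm p (xs n) \<le> 1"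
  obtains r :: "nat \<Rightarrow> nat" where "strict_mono r" "lp_Cauchy (\<lambda>n. T (xs (r n)))"
  using assms unfolding compact_op_iff by blast

lemma compact_op_cong:
  assumes "compact_op p T" "\<And>x. x \<in> lp p \<Longrightarrow> T x = T' x"
  shows "compact_op p T'"
proof -
  have "bounded_op p T'"
    using assms bounded_op_cong compact_op_bounded by blast
  then show ?thesis
    using assms unfolding compact_op_def by simp
qed

lemma compact_op_zero: "compact_op p (\<lambda>x j. 0)"
  unfolding compact_op_def
  using bounded_byI_op[OF bounded_by_zero] strict_mono_id by auto

lemma compact_op_comp_left:
  assumes T: "bounded_op p T" and K: "compact_op p K"
  shows "compact_op p (\<lambda>x. T (K x))"
proof -
  obtain C where C: "0 \<le> C" "bounded_by C T"
    using T by (rule bounded_opD)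
  have Kb: "bounded_op p K"
    using K by (rule compact_op_bounded)
  have "\<exists>X. finite X \<and> X \<subseteq> {x \<in> lp p. lp_norm p x \<le> 1} \<and>
      (\<forall>x\<in>lp p. lp_norm p x \<le> 1 \<longrightarrow> (\<exists>y\<in>X. lp_norm p (\<lambda>j. T (K x) j - T (K y) j) < e))" if "e > 0" for e
  proof -
    have "e / (C + 1) > 0"
      using that C by auto
    then obtain X where X: "finite X" "X \<subseteq> {x \<in> lp p. lp_norm p x \<le> 1}"
      "\<forall>x\<in>lp p. lp_norm p x \<le> 1 \<longrightarrow> (\<exists>y\<in>X. lp_norm p (\<lambda>j. K x j - K y j) < e / (C + 1))"
      using K unfolding compact_op_iff_net by blast
    have "\<exists>y\<in>X. lp_norm p (\<lambda>j. T (K x) j - T (K y) j) < e" if x: "x \<in> lp p" "lp_norm p x \<le> 1" for x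
    proof -
      obtain y where y: "y \<in> X" "lp_norm p (\<lambda>j. K x j - K y j) < e / (C + 1)"
        using X x by blast
      have K2: "K x \<in> lp p" "K y \<in> lp p"
        using x y X bounded_opD_lp[OF Kb] by auto
      have "lp_norm p (\<lambda>j. T (K x) j - T (K y) j) \<le> C * lp_norm p (\<lambda>j. K x j - K y j)"
        using bounded_by_diff[OF C(2) K2] bounded_byD(2)[OF C(2) lp_diff(1)[OF K2]] by simp
      also have "\<dots> \<le> (C + 1) * lp_norm p (\<lambda>j. K x j - K y j)"
        by (intro mult_right_mono) auto
      also have "\<dots> < e"
        using y C by (simp add: field_simps)
      finally show ?thesis
        using y by blast
    qed
    with X(1,2) show ?thesis
      by (intro exI[of _ X]) blast
  qed
  then show ?thesis
    using bounded_op_comp[OF T Kb] by (simp add: compact_op_iff_net)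
qed

lemma compact_op_add:
  assumes S: "compact_op p S" and T: "compact_op p T"
  shows "compact_op p (\<lambda>x j. S x j + T x j)"
proof -
  have Sb: "bounded_op p S" and Tb: "bounded_op p T"
    using compact_op_bounded[OF S] compact_op_bounded[OF T] .
  have "\<exists>r :: nat \<Rightarrow> nat. strict_mono r \<and> lp_Cauchy (\<lambda>n j. S (xs (r n)) j + T (xs (r n)) j)"
    if xs: "\<forall>n. xs n \<in> lp p \<and> lp_norm p (xs n) \<le> 1" for xs
  proof -
    obtain r :: "nat \<Rightarrow> nat" where r: "strict_mono r" "lp_Cauchy (\<lambda>n. S (xs (r n)))"
      using compact_op_subsequence[OF S, of xs] xs by blast
    obtain s :: "nat \<Rightarrow> nat" where s: "strict_mono s" "lp_Cauchy (\<lambda>n. T (xs (r (s n))))"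
      using compact_op_subsequence[OF T, of "\<lambda>n. xs (r n)"] xs by blast
    have "\<exists>N. \<forall>m\<ge>N. \<forall>n\<ge>N. lp_norm p (\<lambda>j. (S (xs (r (s m))) j + T (xs (r (s m))) j)
        - (S (xs (r (s n))) j + T (xs (r (s n))) j)) < e" if "e > 0" for e
    proof -
      have e: "e/2 > 0"
        using that by simp
      obtain N1 where N1: "\<And>m n. m \<ge> N1 \<Longrightarrow> n \<ge> N1 \<Longrightarrow> lp_norm p (\<lambda>j. S (xs (r m)) j - S (xs (r n)) j) < e/2"
        using lp_CauchyD[OF r(2) e] by blast
      obtain N2 where N2: "\<And>m n. m \<ge> N2 \<Longrightarrow> n \<ge> N2 \<Longrightarrow>
          lp_norm p (\<lambda>j. T (xs (r (s m))) j - T (xs (r (s n))) j) < e/2"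
        using lp_CauchyD[OF s(2) e] by blast
      have "lp_norm p (\<lambda>j. (S (xs (r (s m))) j + T (xs (r (s m))) j)
          - (S (xs (r (s n))) j + T (xs (r (s n))) j)) < e" if "m \<ge> max N1 N2" "n \<ge> max N1 N2" for m n
      proof -
        let ?a = "\<lambda>j. S (xs (r (s m))) j - S (xs (r (s n))) j"
        let ?b = "\<lambda>j. T (xs (r (s m))) j - T (xs (r (s n))) j"
        have ab: "?a \<in> lp p" "?b \<in> lp p"
          using xs bounded_opD_lp[OF Sb] bounded_opD_lp[OF Tb] by (simp_all add: lp_diff)
        have "s m \<ge> N1" "s n \<ge> N1"
          using that seq_suble[OF s(1), of m] seq_suble[OF s(1), of n] by auto
        then have "lp_norm p ?a < e/2" "lp_norm p ?b < e/2"
          using N1[of "s m" "s n"] N2[of m n] that by simp_all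
        with lp_minkowski(2)[OF ab] have "lp_norm p (\<lambda>j. ?a j + ?b j) < e"
          by linarith
        moreover have "(\<lambda>j. ?a j + ?b j) =
            (\<lambda>j. (S (xs (r (s m))) j + T (xs (r (s m))) j) - (S (xs (r (s n))) j + T (xs (r (s n))) j))"
          by (simp add: algebra_simps)
        ultimately show ?thesis
          by simp
      qed
      then show ?thesis
        by blast
    qed
    then have "lp_Cauchy (\<lambda>n j. S (xs ((r \<circ> s) n)) j + T (xs ((r \<circ> s) n)) j)"
      by (simp add: lp_Cauchy_def)
    moreover have "strict_mono (r \<circ> s)"
      using r(1) s(1) by (rule strict_mono_o)
    ultimately show ?thesis
      by blast
  qed
  then show ?thesis
    using bounded_op_add[OF Sb Tb] by (simp add: compact_op_iff)
qed

lemma compact_op_scale: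
  assumes "compact_op p T"
  shows "compact_op p (\<lambda>x j. c * T x j)"
proof -
  have "bounded_by (norm c) (\<lambda>x j. c * x j)"
    by (auto simp: bounded_by_def lin_on_def lp_scale algebra_simps)
  from compact_op_comp_left[OF bounded_byI_op[OF this] assms] show ?thesis .
qed

lemma compact_op_diff:
  assumes "compact_op p S" "compact_op p T"
  shows "compact_op p (\<lambda>x j. S x j - T x j)"
  using compact_op_add[OF assms(1) compact_op_scale[OF assms(2), of "-1"]] by simp

text \<open>Scaling \<open>T\<close> brings the images of unit vectors into the unit ball, and the
  factor is removed afterwards; \<open>C + 1\<close> keeps the factor finite when
  \<open>C = 0\<close>.\<close>

lemma compact_op_comp_right:
  assumes K: "compact_op p K" and T: "bounded_op p T"
  shows "compact_op p (\<lambda>x. K (T x))"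
proof -
  obtain C where C: "0 \<le> C" "bounded_by C T"
    using T by (rule bounded_opD)
  have C1: "bounded_by (C + 1) T"
    using C by (auto intro: bounded_by_mono)
  define c where "c = complex_of_real (1 / (C + 1))"
  have c: "norm c = 1 / (C + 1)"
    using C(1) unfolding c_def by (simp only: norm_of_real) simp
  then have c0: "c \<noteq> 0"
    using C(1) by auto
  have Kb: "bounded_op p K"
    using K by (rule compact_op_bounded)
  obtain D where D: "bounded_by D K"
    using Kb by (rule bounded_opD)
  define T' where "T' = (\<lambda>x j. c * T x j)"
  have T': "bounded_by 1 T'"
    using bounded_by_scaled[OF C1, of c] c C by (simp add: T'_def)
  have "compact_op p (\<lambda>x. K (T' x))"
    unfolding compact_op_iff
  proof (intro conjI allI impI)
    show "bounded_op p (\<lambda>x. K (T' x))"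
      using bounded_op_comp[OF Kb bounded_byI_op[OF T']] .
    fix xs :: "nat \<Rightarrow> 'c \<Rightarrow> complex" assume xs: "\<forall>n. xs n \<in> lp p \<and> lp_norm p (xs n) \<le> 1"
    have "T' (xs n) \<in> lp p" "lp_norm p (T' (xs n)) \<le> 1" for n
      using xs bounded_byD[OF T', of "xs n"] by (auto intro: order_trans)
    then show "\<exists>r. strict_mono r \<and> lp_Cauchy (\<lambda>n. K (T' (xs (r n))))"
      using compact_op_subsequence[OF K, of "\<lambda>n. T' (xs n)"] by blast
  qed
  then have "compact_op p (\<lambda>x j. (1 / c) * K (T' x) j)"
    by (rule compact_op_scale)
  then show ?thesis
    by (rule compact_op_cong) (simp add: T'_def bounded_by_scale[OF D] bounded_byD[OF C(2)] c0)
qed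

text \<open>An e/3 argument with a finite net for an approximant. The approximation is stated vector
  by vector because the approximants are later found in that form.\<close>

lemma compact_op_closed:
  assumes T: "bounded_op p T"
    and approx: "\<And>e. e > 0 \<Longrightarrow> \<exists>K. compact_op p K \<and> (\<forall>x\<in>lp p. lp_norm p (\<lambda>j. T x j - K x j) \<le> e * lp_norm p x)"
  shows "compact_op p T"
proof -
  have "\<exists>X. finite X \<and> X \<subseteq> {x \<in> lp p. lp_norm p x \<le> 1} \<and>
      (\<forall>x\<in>lp p. lp_norm p x \<le> 1 \<longrightarrow> (\<exists>y\<in>X. lp_norm p (\<lambda>j. T x j - T y j) < e))" if "e > 0" for e
  proof -
    obtain K where K: "compact_op p K" "\<And>x. x \<in> lp p \<Longrightarrow> lp_norm p (\<lambda>j. T x j - K x j) \<le> e/3 * lp_norm p x"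
      using approx[of "e/3"] \<open>e > 0\<close> by auto
    have K1: "lp_norm p (\<lambda>j. T x j - K x j) \<le> e/3" if "x \<in> lp p" "lp_norm p x \<le> 1" for x
      using order_trans[OF K(2)[OF that(1)] mult_left_le[OF that(2), of "e/3"]] \<open>e > 0\<close> by simp
    have e3: "e/3 > 0"
      using \<open>e > 0\<close> by simp
    obtain X where X: "finite X" "X \<subseteq> {x \<in> lp p. lp_norm p x \<le> 1}"
      "\<forall>x\<in>lp p. lp_norm p x \<le> 1 \<longrightarrow> (\<exists>y\<in>X. lp_norm p (\<lambda>j. K x j - K y j) < e/3)"
      using K(1) e3 unfolding compact_op_iff_net by blast
    have "\<exists>y\<in>X. lp_norm p (\<lambda>j. T x j - T y j) < e" if x: "x \<in> lp p" "lp_norm p x \<le> 1" for x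
    proof -
      obtain y where y: "y \<in> X" "lp_norm p (\<lambda>j. K x j - K y j) < e/3"
        using X x by blast
      then have yb: "y \<in> lp p" "lp_norm p y \<le> 1"
        using X by auto
      have l: "T x \<in> lp p" "T y \<in> lp p" "K x \<in> lp p" "K y \<in> lp p"
        using x yb bounded_opD_lp[OF T] bounded_opD_lp[OF compact_op_bounded[OF K(1)]] by auto
      have "lp_norm p (\<lambda>j. T x j - T y j) \<le> lp_norm p (\<lambda>j. T x j - K x j)
          + (lp_norm p (\<lambda>j. K x j - K y j) + lp_norm p (\<lambda>j. K y j - T y j))"
        using lp_norm_diff_triangle[OF l(1,3,2)] lp_norm_diff_triangle[OF l(3,4,2)] by linarith
      moreover have "lp_norm p (\<lambda>j. K y j - T y j) \<le> e/3"
        using K1[OF yb] by (subst lp_norm_diff_commute)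
      ultimately have "lp_norm p (\<lambda>j. T x j - T y j) < e"
        using K1[OF x] y(2) by linarith
      with y(1) show ?thesis
        by blast
    qed
    with X(1,2) show ?thesis
      by (intro exI[of _ X]) blast
  qed
  then show ?thesis
    using T by (simp add: compact_op_iff_net)
qed

section \<open>Truncations, and compact operators far out\<close>

lemma compact_op_restrict_finite:
  assumes "finite F"
  shows "compact_op p (\<lambda>x j. if j \<in> F then x j else 0)"
  using assms
proof induction
  case empty
  show ?case
    using compact_op_zero by simp
next
  case (insert a F)
  have b: "bounded_op p (\<lambda>x j. if j \<in> {a} then x j else 0)"
    by (rule bounded_byI_op[OF bounded_by_restrict])
  have "compact_op p (\<lambda>x j. if j \<in> {a} then x j else 0)"
    unfolding compact_op_iff
  proof (intro conjI b allI impI)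
    fix xs :: "nat \<Rightarrow> 'a \<Rightarrow> complex"
    assume xs: "\<forall>n. xs n \<in> lp p \<and> lp_norm p (xs n) \<le> 1"
    then have "bounded (range (\<lambda>n. xs n a))"
      using lp_component_le by (intro boundedI[of _ 1]) (force intro: order_trans)
    then obtain l r where r: "strict_mono r" "((\<lambda>n. xs n a) \<circ> r) \<longlonglongrightarrow> l"
      using bounded_imp_convergent_subsequence by blast
    then have "Cauchy ((\<lambda>n. xs n a) \<circ> r)"
      by (auto intro: LIMSEQ_imp_Cauchy)
    moreover have "lp_norm p (\<lambda>j. (if j \<in> {a} then xs (r m) j else 0) - (if j \<in> {a} then xs (r n) j else 0))
        \<le> norm (xs (r m) a - xs (r n) a)" for m n
    proof (rule lp_boundI(2))
      fix G :: "'a set" assume "finite G"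
      have "(\<Sum>j\<in>G. norm ((if j \<in> {a} then xs (r m) j else 0) - (if j \<in> {a} then xs (r n) j else 0)) powr p)
         = (\<Sum>j\<in>G \<inter> {a}. norm (xs (r m) j - xs (r n) j) powr p)"
        using \<open>finite G\<close> by (intro sum.mono_neutral_cong_right) auto
      also have "\<dots> \<le> (\<Sum>j\<in>{a}. norm (xs (r m) j - xs (r n) j) powr p)"
        by (intro sum_mono2) auto
      finally show "(\<Sum>j\<in>G. norm ((if j \<in> {a} then xs (r m) j else 0) - (if j \<in> {a} then xs (r n) j else 0)) powr p)
         \<le> norm (xs (r m) a - xs (r n) a) powr p"
        by simp
    qed auto
    ultimately have "lp_Cauchy (\<lambda>n j. if j \<in> {a} then xs (r n) j else 0)"
      unfolding lp_Cauchy_def Cauchy_def dist_norm comp_def by (meson order_le_less_trans)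
    with r(1) show "\<exists>r. strict_mono r \<and> lp_Cauchy (\<lambda>n j. if j \<in> {a} then xs (r n) j else 0)"
      by blast
  qed
  from compact_op_add[OF this insert.IH] show ?case
    using insert.hyps by (rule_tac back_subst[where P = "compact_op p"]) (auto simp: fun_eq_iff)
qed

text \<open>The finitely many net vectors of the image have a common finite set that carries all but
  e/2 of each, and the image of every unit vector lies within e/2 of one of them.\<close>

lemma compact_op_small_range:
  assumes K: "compact_op p K" and e: "e > 0"
  shows "\<exists>F. finite F \<and> (\<forall>A. A \<inter> F = {} \<longrightarrow> (\<forall>x\<in>lp p.
      lp_norm p (\<lambda>j. if j \<in> A then K x j else 0) \<le> e * lp_norm p x))"
proof -
  have Kb: "bounded_op p K"
    using K by (rule compact_op_bounded)
  have e2: "e/2 > 0"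
    using e by simp
  obtain X where X: "finite X" "X \<subseteq> {x \<in> lp p. lp_norm p x \<le> 1}"
    "\<forall>x\<in>lp p. lp_norm p x \<le> 1 \<longrightarrow> (\<exists>y\<in>X. lp_norm p (\<lambda>j. K x j - K y j) < e/2)"
    using K e2 unfolding compact_op_iff_net by blast
  have "\<forall>y\<in>X. \<exists>F. finite F \<and> (\<forall>A. A \<inter> F = {} \<longrightarrow> lp_norm p (\<lambda>j. if j \<in> A then K y j else 0) < e/2)"
    using X e bounded_opD_lp[OF Kb] by (intro ballI lp_tail) auto
  then obtain F where F: "\<And>y. y \<in> X \<Longrightarrow> finite (F y)"
    "\<And>y A. y \<in> X \<Longrightarrow> A \<inter> F y = {} \<Longrightarrow> lp_norm p (\<lambda>j. if j \<in> A then K y j else 0) < e/2"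
    by metis
  let ?F = "\<Union>y\<in>X. F y"
  have "lp_norm p (\<lambda>j. if j \<in> A then K x j else 0) \<le> e * lp_norm p x" if A: "A \<inter> ?F = {}" and x: "x \<in> lp p" for A x
  proof -
    have op: "bounded_op p (\<lambda>x j. if j \<in> A then K x j else 0)"
      using bounded_op_comp[OF bounded_byI_op[OF bounded_by_restrict] Kb] .
    \<comment> \<open>Passing through the operator norm extends the estimate from the unit ball to
      all vectors by homogeneity.\<close>
    have "op_norm p (\<lambda>x j. if j \<in> A then K x j else 0) \<le> e"
      unfolding op_norm_def
    proof (rule cSup_least)
      show "(\<lambda>x. lp_norm p (\<lambda>j. if j \<in> A then K x j else 0)) ` {x \<in> lp p. lp_norm p x \<le> 1} \<noteq> {}"
        using lp_zero by fastforce
      fix r assume "r \<in> (\<lambda>x. lp_norm p (\<lambda>j. if j \<in> A then K x j else 0)) ` {x \<in> lp p. lp_norm p x \<le> 1}"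
      then obtain x where x: "x \<in> lp p" "lp_norm p x \<le> 1" "r = lp_norm p (\<lambda>j. if j \<in> A then K x j else 0)"
        by auto
      then obtain y where y: "y \<in> X" "lp_norm p (\<lambda>j. K x j - K y j) < e/2"
        using X by blast
      have l: "K x \<in> lp p" "K y \<in> lp p"
        using x y X bounded_opD_lp[OF Kb] by auto
      have "r = lp_norm p (\<lambda>j. (if j \<in> A then K x j - K y j else 0) + (if j \<in> A then K y j else 0))"
        unfolding x(3) by (rule arg_cong[where f = "lp_norm p"]) auto
      also have "\<dots> \<le> lp_norm p (\<lambda>j. if j \<in> A then K x j - K y j else 0) + lp_norm p (\<lambda>j. if j \<in> A then K y j else 0)"
        using bounded_byD(1)[OF bounded_by_restrict] lp_diff l by (intro lp_minkowski(2)) auto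
      also have "\<dots> \<le> e/2 + e/2"
      proof (rule add_mono)
        show "lp_norm p (\<lambda>j. if j \<in> A then K x j - K y j else 0) \<le> e/2"
          using bounded_byD(2)[OF bounded_by_restrict lp_diff(1)[OF l], of A] y(2) by simp
        show "lp_norm p (\<lambda>j. if j \<in> A then K y j else 0) \<le> e/2"
          using F(2)[OF y(1), of A] A y(1) by (intro less_imp_le) blast
      qed
      finally show "r \<le> e"
        by simp
    qed
    then show ?thesis
      using bounded_byD(2)[OF bounded_by_mono[OF bounded_by_op_norm[OF op]] x] by blast
  qed
  moreover have "finite ?F"
    using X F by auto
  ultimately show ?thesis
    by blast
qed

section \<open>Vectors with disjoint supports\<close>

lemma powr_le_imp_le: "a powr p \<le> b powr p \<Longrightarrow> 0 \<le> b \<Longrightarrow> a \<le> b"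
  using powr_less_mono2[of p b a] p_pos by (meson not_le)

lemma lp_sum:
  assumes "finite I" "\<And>k. k \<in> I \<Longrightarrow> u k \<in> lp p"
  shows "(\<lambda>i. \<Sum>k\<in>I. u k i) \<in> lp p \<and> lp_norm p (\<lambda>i. \<Sum>k\<in>I. u k i) \<le> (\<Sum>k\<in>I. lp_norm p (u k))"
  using assms
proof induction
  case (insert k I)
  then have "u k \<in> lp p" "(\<lambda>i. \<Sum>k\<in>I. u k i) \<in> lp p" "lp_norm p (\<lambda>i. \<Sum>k\<in>I. u k i) \<le> (\<Sum>k\<in>I. lp_norm p (u k))"
    by auto
  with lp_minkowski[of "u k" "\<lambda>i. \<Sum>k\<in>I. u k i"] insert.hyps show ?case
    by simp
qed simp

lemma bounded_by_sum:
  assumes "bounded_by C T" "finite I" "\<And>k. k \<in> I \<Longrightarrow> u k \<in> lp p"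
  shows "T (\<lambda>i. \<Sum>k\<in>I. c k * u k i) = (\<lambda>j. \<Sum>k\<in>I. c k * T (u k) j)"
  using assms(2,3)
proof induction
  case empty
  show ?case
    using bounded_by_scale[OF assms(1) lp_zero, of 0] by simp
next
  case (insert k I)
  have "(\<lambda>i. \<Sum>k\<in>I. c k * u k i) \<in> lp p"
    using lp_sum[of I "\<lambda>k i. c k * u k i"] insert by (auto simp: lp_scale)
  then have "T (\<lambda>i. c k * u k i + (\<Sum>k\<in>I. c k * u k i)) = (\<lambda>j. c k * T (u k) j + T (\<lambda>i. \<Sum>k\<in>I. c k * u k i) j)"
    using insert.prems by (simp add: bounded_by_add[OF assms(1)] bounded_by_scale[OF assms(1)] lp_scale)
  then show ?case
    using insert by simp
qed

lemma lp_norm_disjoint: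
  assumes "x \<in> lp p" "y \<in> lp p" "\<And>i. x i = 0 \<or> y i = 0"
  shows "lp_norm p (\<lambda>i. x i + y i) powr p = lp_norm p x powr p + lp_norm p y powr p"
proof -
  have "norm (x i + y i) powr p = norm (x i) powr p + norm (y i) powr p" for i
    using assms(3)[of i] p_pos by auto
  then show ?thesis
    using assms unfolding lp_norm_powr by (simp add: infsum_add lp_def)
qed

lemma lp_norm_disjoint_sum:
  assumes "finite I" "\<And>k. k \<in> I \<Longrightarrow> u k \<in> lp p"
    and "\<And>k l i. k \<in> I \<Longrightarrow> l \<in> I \<Longrightarrow> k \<noteq> l \<Longrightarrow> u k i = 0 \<or> u l i = 0"
  shows "lp_norm p (\<lambda>i. \<Sum>k\<in>I. u k i) powr p = (\<Sum>k\<in>I. lp_norm p (u k) powr p)"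
  using assms
proof induction
  case (insert k I)
  have "u k i = 0 \<or> (\<Sum>k\<in>I. u k i) = 0" for i
  proof (cases "u k i = 0")
    case False
    then have "u l i = 0" if "l \<in> I" for l
      using insert.prems(2)[of k l i] insert.hyps that by auto
    then show ?thesis
      by simp
  qed simp
  then have "lp_norm p (\<lambda>i. u k i + (\<Sum>k\<in>I. u k i)) powr p =
      lp_norm p (u k) powr p + lp_norm p (\<lambda>i. \<Sum>k\<in>I. u k i) powr p"
    using insert lp_sum[of I u] by (intro lp_norm_disjoint) auto
  then show ?case
    using insert by simp
qed (use p_pos in simp)

definition restr :: "'i set \<Rightarrow> ('i \<Rightarrow> complex) \<Rightarrow> 'i \<Rightarrow> complex" where
  "restr A x = (\<lambda>i. if i \<in> A then x i else 0)"

lemma bounded_by_restr: "bounded_by 1 (restr A)"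
  unfolding restr_def by (rule bounded_by_restrict)

lemma restr_lp [simp]: "x \<in> lp p \<Longrightarrow> restr A x \<in> lp p"
  and lp_norm_restr_le: "x \<in> lp p \<Longrightarrow> lp_norm p (restr A x) \<le> lp_norm p x"
  using bounded_byD[OF bounded_by_restr] by fastforce+

lemma sum_lp_norm_restr_le:
  assumes "finite I" "disjoint_family_on S I" "x \<in> lp p"
  shows "(\<Sum>k\<in>I. lp_norm p (restr (S k) x) powr p) \<le> lp_norm p x powr p"
proof -
  have "(\<Sum>k\<in>I. lp_norm p (restr (S k) x) powr p) = lp_norm p (\<lambda>i. \<Sum>k\<in>I. restr (S k) x i) powr p"
    using assms by (intro lp_norm_disjoint_sum[symmetric] restr_lp) (auto simp: restr_def disjoint_family_on_def)
  also have "(\<lambda>i. \<Sum>k\<in>I. restr (S k) x i) = restr (\<Union>k\<in>I. S k) x"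
  proof
    fix i show "(\<Sum>k\<in>I. restr (S k) x i) = restr (\<Union>k\<in>I. S k) x i"
    proof (cases "\<exists>k\<in>I. i \<in> S k")
      case True
      then obtain k where k: "k \<in> I" "i \<in> S k"
        by blast
      have "(\<Sum>k\<in>I. restr (S k) x i) = (\<Sum>k\<in>{k}. restr (S k) x i)"
        using k assms(1,2) by (intro sum.mono_neutral_right) (auto simp: restr_def disjoint_family_on_def)
      then show ?thesis
        using k by (auto simp: restr_def)
    qed (auto simp: restr_def)
  qed
  also have "lp_norm p \<dots> powr p \<le> lp_norm p x powr p"
    using p_pos assms(3) by (intro powr_mono2 lp_norm_restr_le) auto
  finally show ?thesis .
qed

text \<open>Inputs and outputs are both disjoint, so p-th powers add on either side and the bound
  does not grow with the number of blocks. This is what makes slow variation pay: many small jumps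
  together cost no more than one of them.\<close>

lemma block_sum_bound:
  assumes I: "finite I" "disjoint_family_on S I" "disjoint_family_on S' I"
    and T: "bounded_by C T" "0 \<le> C" and d: "\<And>k. k \<in> I \<Longrightarrow> norm (d k) \<le> \<delta>" "0 \<le> \<delta>" and x: "x \<in> lp p"
  shows "lp_norm p (\<lambda>j. \<Sum>k\<in>I. d k * restr (S k) (T (restr (S' k) x)) j) \<le> \<delta> * C * lp_norm p x"
proof -
  let ?u = "\<lambda>k j. d k * restr (S k) (T (restr (S' k) x)) j"
  have l: "restr (S k) (T (restr (S' k) x)) \<in> lp p" for k
    using x bounded_byD[OF T(1)] by simp
  have "lp_norm p (\<lambda>j. \<Sum>k\<in>I. ?u k j) powr p = (\<Sum>k\<in>I. lp_norm p (?u k) powr p)"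
    using I l by (intro lp_norm_disjoint_sum) (auto simp: lp_scale restr_def disjoint_family_on_def)
  also have "\<dots> \<le> (\<Sum>k\<in>I. (\<delta> * C) powr p * lp_norm p (restr (S' k) x) powr p)"
  proof (intro sum_mono)
    fix k assume k: "k \<in> I"
    have "lp_norm p (?u k) = norm (d k) * lp_norm p (restr (S k) (T (restr (S' k) x)))"
      by (simp add: lp_scale l)
    also have "\<dots> \<le> \<delta> * (C * lp_norm p (restr (S' k) x))"
    proof (intro mult_mono d(1)[OF k] d(2))
      show "lp_norm p (restr (S k) (T (restr (S' k) x))) \<le> C * lp_norm p (restr (S' k) x)"
        using x bounded_byD[OF T(1), of "restr (S' k) x"] lp_norm_restr_le[of "T (restr (S' k) x)" "S k"] by simp
    qed auto
    finally show "lp_norm p (?u k) powr p \<le> (\<delta> * C) powr p * lp_norm p (restr (S' k) x) powr p"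
      using p_pos T d by (simp add: powr_mult[symmetric] powr_mono2 mult.assoc)
  qed
  also have "\<dots> \<le> (\<delta> * C) powr p * lp_norm p x powr p"
    using I x by (simp add: sum_distrib_left[symmetric] mult_left_mono sum_lp_norm_restr_le)
  also have "\<dots> = (\<delta> * C * lp_norm p x) powr p"
    using T d by (simp add: powr_mult)
  finally show ?thesis
    using T(2) d(2) by (rule_tac powr_le_imp_le) auto
qed

text \<open>Witnesses of a failure can be normalised and cut down to finite support, as the
  inductive choice of disjointly supported ones requires.\<close>

lemma compact_op_small_domain_aux:
  assumes K: "bounded_by D K" "0 \<le> D" and e: "e > 0"
    and big: "\<And>F. finite F \<Longrightarrow> \<exists>A x. A \<inter> F = {} \<and> x \<in> lp p \<and> lp_norm p (K (restr A x)) > e * lp_norm p x"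
    and F: "finite F"
  shows "\<exists>y G. finite G \<and> G \<inter> F = {} \<and> y \<in> lp p \<and> (\<forall>i. i \<notin> G \<longrightarrow> y i = 0) \<and> lp_norm p y \<le> 1 \<and> lp_norm p (K y) > e"
proof -
  obtain A x where A: "A \<inter> F = {}" and x: "x \<in> lp p" and gt: "lp_norm p (K (restr A x)) > e * lp_norm p x"
    using big[OF F] by blast
  have "lp_norm p x \<noteq> 0"
    using gt bounded_byD(2)[OF K(1) restr_lp[OF x], of A] mult_left_mono[OF lp_norm_restr_le[OF x, of A] K(2)] by auto
  then have xpos: "lp_norm p x > 0"
    by (simp add: order_less_le)
  \<comment> \<open>The part to be cut off has an image of norm at most \<open>D * \<eta>\<close>,
    which is less than the excess over \<open>e * lp_norm p x\<close>; so the truncated vector is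
    still a witness.\<close>
  define \<eta> where "\<eta> = (lp_norm p (K (restr A x)) - e * lp_norm p x) / (D + 1)"
  have \<eta>: "\<eta> > 0"
    using gt K(2) by (simp add: \<eta>_def)
  obtain G where G: "finite G" "\<And>B. B \<inter> G = {} \<Longrightarrow> lp_norm p (restr B x) < \<eta>"
    using lp_tail[OF x \<eta>] unfolding restr_def by blast
  let ?y = "restr (A \<inter> G) x" and ?z = "restr (A - G) x"
  have "lp_norm p (K ?z) \<le> D * \<eta>"
    using order_trans[OF bounded_byD(2)[OF K(1) restr_lp[OF x], of "A - G"]
        mult_left_mono[OF less_imp_le[OF G(2)[of "A - G"]] K(2)]] by blast
  also have "\<dots> < (D + 1) * \<eta>"
    using \<eta> by simp
  also have "\<dots> = lp_norm p (K (restr A x)) - e * lp_norm p x"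
    using K(2) by (simp add: \<eta>_def)
  finally have z: "lp_norm p (K ?z) < lp_norm p (K (restr A x)) - e * lp_norm p x" .
  have "restr A x = (\<lambda>i. ?y i + ?z i)"
    by (auto simp: restr_def)
  then have "K (restr A x) = (\<lambda>j. K ?y j + K ?z j)"
    using bounded_by_add[OF K(1) restr_lp[OF x] restr_lp[OF x]] by metis
  then have "lp_norm p (K (restr A x)) \<le> lp_norm p (K ?y) + lp_norm p (K ?z)"
    using lp_minkowski(2)[OF bounded_byD(1)[OF K(1) restr_lp[OF x]] bounded_byD(1)[OF K(1) restr_lp[OF x]]] by simp
  with z have y: "lp_norm p (K ?y) > e * lp_norm p x"
    by linarith
  define c where "c = complex_of_real (1 / lp_norm p x)"
  have c: "norm c = 1 / lp_norm p x"
    unfolding c_def norm_of_real by simp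
  have "lp_norm p (\<lambda>i. c * ?y i) \<le> 1"
    using xpos lp_norm_restr_le[OF x, of "A \<inter> G"] by (simp add: lp_scale x c)
  moreover have "lp_norm p (K (\<lambda>i. c * ?y i)) > e"
    using xpos y by (simp add: bounded_by_scale[OF K(1)] lp_scale bounded_byD[OF K(1)] x c field_simps)
  moreover have "(\<lambda>i. c * ?y i) \<in> lp p"
    by (simp add: lp_scale x)
  ultimately show ?thesis
    using G(1) A by (intro exI[of _ "\<lambda>i. c * ?y i"] exI[of _ "A \<inter> G"]) (auto simp: restr_def)
qed

text \<open>Vectors that witness a failure can be chosen with disjoint supports; the sum of \<open>M\<close> of them
  has norm at most \<open>M powr (1/p)\<close>, while along a subsequence on which their images nearly agree the
  image of the sum has norm proportional to \<open>M\<close>. This is where \<open>p > 1\<close> enters.\<close>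

lemma compact_op_small_domain:
  assumes K: "compact_op p K" and e: "e > 0"
  shows "\<exists>F. finite F \<and> (\<forall>A. A \<inter> F = {} \<longrightarrow> (\<forall>x\<in>lp p. lp_norm p (K (restr A x)) \<le> e * lp_norm p x))"
proof (rule ccontr)
  assume neg: "\<not> ?thesis"
  obtain D where D: "0 \<le> D" "bounded_by D K"
    using compact_op_bounded[OF K] by (rule bounded_opD)
  have big: "\<exists>A x. A \<inter> F = {} \<and> x \<in> lp p \<and> lp_norm p (K (restr A x)) > e * lp_norm p x" if "finite F" for F
  proof (rule ccontr)
    assume "\<not> ?thesis"
    then have "\<forall>A. A \<inter> F = {} \<longrightarrow> (\<forall>x\<in>lp p. lp_norm p (K (restr A x)) \<le> e * lp_norm p x)"
      by (auto simp: not_less)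
    with that have "finite F \<and> (\<forall>A. A \<inter> F = {} \<longrightarrow> (\<forall>x\<in>lp p. lp_norm p (K (restr A x)) \<le> e * lp_norm p x))"
      by simp
    then show False
      by (rule notE[OF neg, OF exI])
  qed
  define good where "good F y G \<longleftrightarrow> finite G \<and> G \<inter> F = {} \<and> y \<in> lp p \<and> (\<forall>i. i \<notin> G \<longrightarrow> y i = 0) \<and> lp_norm p y \<le> 1 \<and> lp_norm p (K y) > e"
    for F G y
  have "\<exists>y G. good F y G" if "finite F" for F
    unfolding good_def by (rule compact_op_small_domain_aux[OF D(2,1) e big that])
  then obtain Y G where "\<And>F. finite F \<Longrightarrow> good F (Y F) (G F)"
    by metis
  then have YG: "finite (G F) \<and> G F \<inter> F = {} \<and> Y F \<in> lp p \<and>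
      (\<forall>i. i \<notin> G F \<longrightarrow> Y F i = 0) \<and> lp_norm p (Y F) \<le> 1 \<and> lp_norm p (K (Y F)) > e" if "finite F" for F
    using that unfolding good_def by simp
  \<comment> \<open>\<open>Fs n\<close> is the union of the supports chosen so far, so each new
    witness lives off all earlier ones.\<close>
  define Fs where "Fs = rec_nat {} (\<lambda>_ F. F \<union> G F)"
  have Fs: "Fs 0 = {}" "Fs (Suc n) = Fs n \<union> G (Fs n)" for n
    by (auto simp: Fs_def)
  have finF: "finite (Fs n)" for n
    by (induction n) (auto simp: Fs YG)
  have monoF: "m \<le> n \<Longrightarrow> Fs m \<subseteq> Fs n" for m n
    by (rule lift_Suc_mono_le) (auto simp: Fs)
  define ys where "ys n = Y (Fs n)" for n
  have ys: "ys n \<in> lp p" "lp_norm p (ys n) \<le> 1" "lp_norm p (K (ys n)) > e" for n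
    using YG[OF finF[of n]] by (auto simp: ys_def)
  have lt: "ys m i = 0 \<or> ys n i = 0" if "m < n" for m n i
  proof -
    have "G (Fs m) \<subseteq> Fs n"
      using monoF[of "Suc m" n] that by (auto simp: Fs)
    then show ?thesis
      using YG[OF finF[of n]] YG[OF finF[of m]] unfolding ys_def by blast
  qed
  have disj: "ys m i = 0 \<or> ys n i = 0" if "m \<noteq> n" for m n i
    using lt[of m n i] lt[of n m i] that by (cases m n rule: linorder_cases) auto
  obtain r :: "nat \<Rightarrow> nat" where r: "strict_mono r" "lp_Cauchy (\<lambda>n. K (ys (r n)))"
    using compact_op_subsequence[OF K, of ys] ys by blast
  have e2: "e/2 > 0"
    using e by simp
  obtain N where N: "\<And>m n. m \<ge> N \<Longrightarrow> n \<ge> N \<Longrightarrow> lp_norm p (\<lambda>j. K (ys (r m)) j - K (ys (r n)) j) < e/2"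
    using lp_CauchyD[OF r(2) e2] by blast
  define z where "z k = ys (r (N + k))" for k
  have zl: "z k \<in> lp p" "K (z k) \<in> lp p" for k
    using ys bounded_byD[OF D(2)] by (auto simp: z_def)
  have zdisj: "z k i = 0 \<or> z l i = 0" if "k \<noteq> l" for k l i
    unfolding z_def using that r(1) by (intro disj) (auto simp: strict_mono_eq)
  have bound: "real M * (e/2) \<le> D * real M powr (1/p)" for M
  proof -
    let ?s = "\<lambda>i. \<Sum>k<M. 1 * z k i"
    have s: "?s \<in> lp p"
      using lp_sum[of "{..<M}" z] zl by simp
    have "lp_norm p ?s powr p = (\<Sum>k<M. lp_norm p (z k) powr p)"
      using lp_norm_disjoint_sum[of "{..<M}" z] zl zdisj by simp
    also have "\<dots> \<le> (\<Sum>k<M. 1)"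
      using ys p_pos by (intro sum_mono) (auto simp: z_def powr_le1)
    finally have "lp_norm p ?s powr p \<le> real M"
      by simp
    then have "(lp_norm p ?s powr p) powr (1/p) \<le> real M powr (1/p)"
      using p_pos by (intro powr_mono2) auto
    then have ns: "lp_norm p ?s \<le> real M powr (1/p)"
      using p_pos by (simp add: powr_powr)
    have Ks: "K ?s = (\<lambda>j. \<Sum>k<M. 1 * K (z k) j)"
      using bounded_by_sum[OF D(2), of "{..<M}" z "\<lambda>_. 1"] zl by simp
    have Mz: "lp_norm p (\<lambda>j. of_nat M * K (z 0) j) = real M * lp_norm p (K (z 0))"
      by (subst lp_scale(2)) (auto simp: zl)
    have "(\<lambda>j. of_nat M * K (z 0) j) = (\<lambda>j. K ?s j + (\<Sum>k<M. (K (z 0) j - K (z k) j)))"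
      unfolding Ks by (simp add: sum_subtractf)
    then have "real M * lp_norm p (K (z 0)) = lp_norm p (\<lambda>j. K ?s j + (\<Sum>k<M. (K (z 0) j - K (z k) j)))"
      using Mz by simp
    also have "\<dots> \<le> lp_norm p (K ?s) + lp_norm p (\<lambda>j. \<Sum>k<M. (K (z 0) j - K (z k) j))"
      using s zl lp_sum[of "{..<M}" "\<lambda>k j. K (z 0) j - K (z k) j"]
      by (intro lp_minkowski(2)) (auto simp: bounded_byD[OF D(2)] lp_diff)
    also have "lp_norm p (\<lambda>j. \<Sum>k<M. (K (z 0) j - K (z k) j)) \<le> (\<Sum>k<M. lp_norm p (\<lambda>j. K (z 0) j - K (z k) j))"
      using lp_sum[of "{..<M}" "\<lambda>k j. K (z 0) j - K (z k) j"] zl by (simp add: lp_diff)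
    also have "\<dots> \<le> (\<Sum>k<M. e/2)"
      using N by (intro sum_mono) (auto simp: z_def less_imp_le)
    finally have "real M * lp_norm p (K (z 0)) \<le> lp_norm p (K ?s) + real M * (e/2)"
      by simp
    moreover have "lp_norm p (K ?s) \<le> D * real M powr (1/p)"
      using bounded_byD(2)[OF D(2) s] mult_left_mono[OF ns D(1)] by linarith
    moreover have "real M * e \<le> real M * lp_norm p (K (z 0))"
      using ys(3) by (intro mult_left_mono) (auto simp: z_def less_imp_le)
    ultimately show ?thesis
      by linarith
  qed
  define q where "q = 1 - 1/p"
  have q: "q > 0"
    using p_gt1 by (simp add: q_def)
  obtain M :: nat where M: "real M > (2 * D / e + 1) powr (1/q)"
    using reals_Archimedean2 by blast
  then have Mpos: "real M > 0"
    by (meson le_less_trans powr_ge_zero)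
  have "((2 * D / e + 1) powr (1/q)) powr q < real M powr q"
    using M q by (intro powr_less_mono2) auto
  moreover have "2 * D / e + 1 > 0"
    using D e by (simp add: add_nonneg_pos)
  ultimately have "2 * D / e + 1 < real M powr q"
    using q by (simp add: powr_powr)
  then have "2 * D / e < real M powr q"
    by simp
  then have "D < real M powr q * (e/2)"
    using e by (simp add: field_simps)
  then have "D * real M powr (1/p) < real M powr q * (e/2) * real M powr (1/p)"
    using Mpos by (intro mult_strict_right_mono) auto
  also have "\<dots> = (real M powr q * real M powr (1/p)) * (e/2)"
    by simp
  also have "real M powr q * real M powr (1/p) = real M"
    using Mpos by (simp add: powr_add[symmetric] q_def)
  finally show False
    using bound[of M] by simp
qed

text \<open>Different slots have disjoint supports, so p-th powers add up and a common bound for the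
  summands bounds the direct sum.\<close>

lemma bounded_by_bigdsum:
  fixes F :: "nat \<Rightarrow> ('i \<Rightarrow> complex) \<Rightarrow> 'i \<Rightarrow> complex"
  assumes F: "\<And>k. bounded_by C (F k)" and C: "0 \<le> C"
  shows "bounded_by C (op_bigdsum F)"
  unfolding bounded_by_def
proof (intro conjI ballI)
  have sl: "(\<lambda>i. x (k, i)) \<in> lp p" if "x \<in> lp p" for x :: "nat \<times> 'i \<Rightarrow> complex" and k
    using bounded_byD(1)[OF bounded_by_reindex[of "\<lambda>i. (k, i)"] that] by (auto simp: inj_on_def)
  show "lin_on p (op_bigdsum F)"
    unfolding lin_on_def op_bigdsum_def
    by (auto simp: fun_eq_iff bounded_by_add[OF F] bounded_by_scale[OF F] sl)
  fix x :: "nat \<times> 'i \<Rightarrow> complex" assume x: "x \<in> lp p"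
  have fin: "(\<Sum>z\<in>Z. norm (op_bigdsum F x z) powr p) \<le> (C * lp_norm p x) powr p" if "finite Z" for Z
  proof -
    \<comment> \<open>Enlarging \<open>Z\<close> to a rectangle turns the sum into an iterated one,
      slot by slot.\<close>
    let ?A = "fst ` Z" and ?B = "snd ` Z"
    have "(\<Sum>z\<in>Z. norm (op_bigdsum F x z) powr p) \<le> (\<Sum>z\<in>?A \<times> ?B. norm (op_bigdsum F x z) powr p)"
      using that by (intro sum_mono2) (auto intro: rev_image_eqI)
    also have "\<dots> = (\<Sum>k\<in>?A. \<Sum>i\<in>?B. norm (F k (\<lambda>i. x (k, i)) i) powr p)"
      by (simp add: sum.cartesian_product op_bigdsum_def case_prod_beta)
    also have "\<dots> \<le> (\<Sum>k\<in>?A. C powr p * lp_norm p (\<lambda>i. x (k, i)) powr p)"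
    proof (intro sum_mono)
      fix k
      have "(\<Sum>i\<in>?B. norm (F k (\<lambda>i. x (k, i)) i) powr p) \<le> lp_norm p (F k (\<lambda>i. x (k, i))) powr p"
        using that bounded_byD(1)[OF F sl[OF x]] by (intro lp_finite_sum_le) auto
      also have "\<dots> \<le> (C * lp_norm p (\<lambda>i. x (k, i))) powr p"
        using p_pos bounded_byD(2)[OF F sl[OF x]] by (intro powr_mono2) auto
      finally show "(\<Sum>i\<in>?B. norm (F k (\<lambda>i. x (k, i)) i) powr p) \<le> C powr p * lp_norm p (\<lambda>i. x (k, i)) powr p"
        using C by (simp add: powr_mult)
    qed
    also have "\<dots> \<le> (\<Sum>k\<in>?A. C powr p * lp_norm p (restr ({k} \<times> UNIV) x) powr p)"
    proof (intro sum_mono mult_left_mono powr_mono2)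
      fix k
      show "lp_norm p (\<lambda>i. x (k, i)) \<le> lp_norm p (restr ({k} \<times> UNIV) x)"
        using bounded_byD(2)[OF bounded_by_reindex[of "\<lambda>i. (k, i)"] restr_lp[OF x, of "{k} \<times> UNIV"]]
        by (simp add: inj_on_def restr_def)
    qed (use p_pos in auto)
    also have "\<dots> = C powr p * (\<Sum>k\<in>?A. lp_norm p (restr ({k} \<times> UNIV) x) powr p)"
      by (simp add: sum_distrib_left)
    also have "\<dots> \<le> C powr p * lp_norm p x powr p"
      using that x by (intro mult_left_mono sum_lp_norm_restr_le) (auto simp: disjoint_family_on_def)
    finally show ?thesis
      using C by (simp add: powr_mult mult_left_mono)
  qed
  show "op_bigdsum F x \<in> lp p" "lp_norm p (op_bigdsum F x) \<le> C * lp_norm p x"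
    using lp_boundI[OF _ fin] C by auto
qed

text \<open>A strict bound on the infimum is realised by some compact operator, although the infimum
  itself need not be attained. The norm of the quotient is used only through such witnesses.\<close>

lemma ess_norm_lessD:
  assumes T: "bounded_op p T" and less: "ess_norm p T < e"
  shows "\<exists>K. compact_op p K \<and> bounded_by e (\<lambda>x i. T x i - K x i)"
proof -
  have "(\<lambda>K. op_norm p (\<lambda>x i. T x i - K x i)) ` {K. compact_op p K} \<noteq> {}"
    using compact_op_zero by auto
  from cInf_lessD[OF this less[unfolded ess_norm_def]]
  obtain K where K: "compact_op p K" "op_norm p (\<lambda>x i. T x i - K x i) < e"
    by auto
  then have "bounded_by e (\<lambda>x i. T x i - K x i)"
    using bounded_by_mono[OF bounded_by_op_norm[OF bounded_op_diff[OF T compact_op_bounded[OF K(1)]]]] by simp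
  with K(1) show ?thesis
    by blast
qed

end

section \<open>Quasicentral diagonal operators\<close>

lemma norm_cis_diff_le: "norm (cis a - cis b) \<le> \<bar>a - b\<bar>"
proof -
  have "cis a - cis b = cis b * (cis (a - b) - 1)"
    by (simp add: cis_mult right_diff_distrib)
  then have "norm (cis a - cis b) = norm (exp (\<i> * of_real (a - b)) - 1)"
    by (simp add: norm_mult cis_conv_exp del: of_real_diff)
  also have "\<dots> = 2 * \<bar>sin ((a - b) / 2)\<bar>"
    by (rule dist_exp_i_1)
  also have "\<dots> \<le> 2 * \<bar>(a - b) / 2\<bar>"
    by (intro mult_left_mono abs_sin_x_le_abs_x) auto
  finally show ?thesis
    by simp
qed

context lp_exponent begin

text \<open>Composed on either side with the finite-rank truncation below \<open>N\<close>, the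
  operator \<open>T\<close> becomes compact. Truncating the input gives small output far out;
  truncating the output gives a small response to input far out, which rests on
  \<open>compact_op_small_domain\<close> and thus on \<open>p > 1\<close>.\<close>

lemma almost_block_tridiagonal:
  fixes \<T> :: "((nat \<Rightarrow> complex) \<Rightarrow> (nat \<Rightarrow> complex)) set"
  assumes fin: "finite \<T>" and T: "\<And>T. T \<in> \<T> \<Longrightarrow> bounded_op p T" and e: "e > 0"
  shows "\<exists>N'\<ge>N. \<forall>T\<in>\<T>. \<forall>x\<in>lp p. lp_norm p (restr {N'..} (T (restr {..<N} x))) \<le> e * lp_norm p x \<and>
            lp_norm p (restr {..<N} (T (restr {N'..} x))) \<le> e * lp_norm p x"
proof -
  have "\<exists>b. \<forall>N'\<ge>b. \<forall>x\<in>lp p. lp_norm p (restr {N'..} (T (restr {..<N} x))) \<le> e * lp_norm p x \<and>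
            lp_norm p (restr {..<N} (T (restr {N'..} x))) \<le> e * lp_norm p x" if TT: "T \<in> \<T>" for T
  proof -
    have P: "compact_op p (restr {..<N})"
      unfolding restr_def by (rule compact_op_restrict_finite) simp
    obtain F1 where F1: "finite F1" "\<And>A x. A \<inter> F1 = {} \<Longrightarrow> x \<in> lp p \<Longrightarrow>
        lp_norm p (restr A (T (restr {..<N} x))) \<le> e * lp_norm p x"
      using compact_op_small_range[OF compact_op_comp_left[OF T[OF TT] P] e] unfolding restr_def by auto
    obtain F2 where F2: "finite F2" "\<And>A x. A \<inter> F2 = {} \<Longrightarrow> x \<in> lp p \<Longrightarrow>
        lp_norm p (restr {..<N} (T (restr A x))) \<le> e * lp_norm p x"
      using compact_op_small_domain[OF compact_op_comp_right[OF P T[OF TT]] e] by auto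
    obtain b where b: "F1 \<union> F2 \<subseteq> {..<b}"
      using finite_nat_bounded[of "F1 \<union> F2"] F1(1) F2(1) by auto
    have "{N'..} \<inter> F1 = {}" "{N'..} \<inter> F2 = {}" if "N' \<ge> b" for N'
      using b that by fastforce+
    then show ?thesis
      using F1(2) F2(2) by (intro exI[of _ b]) simp
  qed
  then obtain b where b: "\<And>T N' x. T \<in> \<T> \<Longrightarrow> N' \<ge> b T \<Longrightarrow> x \<in> lp p \<Longrightarrow>
      lp_norm p (restr {N'..} (T (restr {..<N} x))) \<le> e * lp_norm p x \<and>
      lp_norm p (restr {..<N} (T (restr {N'..} x))) \<le> e * lp_norm p x"
    by metis
  have "b T \<le> N + (\<Sum>T\<in>\<T>. b T)" if "T \<in> \<T>" for T
    using member_le_sum[of T \<T> b] that fin by auto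
  then show ?thesis
    using b by (intro exI[of _ "N + (\<Sum>T\<in>\<T>. b T)"]) auto
qed

text \<open>With Q the restriction to \<open>{b..}\<close> and P = 1 - Q, the commutator is TQ - QT
  = PTQ - QTP. Splitting P at \<open>a\<close> and Q at \<open>c\<close> isolates the two terms
  between the adjacent blocks \<open>{a..<b}\<close> and \<open>{b..<c}\<close>; the other four skip
  a whole block.\<close>

lemma lin_splitting:
  assumes T: "bounded_by C T" and x: "x \<in> lp p" and ab: "a \<le> b" "b \<le> (c::nat)"
  shows "T (restr {b..} x) i - restr {b..} (T x) i =
     restr {a..<b} (T (restr {b..<c} x)) i - restr {b..<c} (T (restr {a..<b} x)) i
     + ((restr {..<a} (T (restr {b..<c} x)) i + restr {..<b} (T (restr {c..} x)) i)
     - (restr {c..} (T (restr {a..<b} x)) i + restr {b..} (T (restr {..<a} x)) i))"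
proof -
  have Q: "T (restr {b..} x) = (\<lambda>i. T (restr {b..<c} x) i + T (restr {c..} x) i)"
  proof -
    have "restr {b..} x = (\<lambda>i. restr {b..<c} x i + restr {c..} x i)"
      using ab by (auto simp: restr_def)
    then show ?thesis
      using bounded_by_add[OF T restr_lp[OF x] restr_lp[OF x]] by simp
  qed
  have P: "T (restr {..<b} x) = (\<lambda>i. T (restr {..<a} x) i + T (restr {a..<b} x) i)"
  proof -
    have "restr {..<b} x = (\<lambda>i. restr {..<a} x i + restr {a..<b} x i)"
      using ab by (auto simp: restr_def)
    then show ?thesis
      using bounded_by_add[OF T restr_lp[OF x] restr_lp[OF x]] by simp
  qed
  have "T x = (\<lambda>i. T (restr {..<b} x) i + T (restr {b..} x) i)"
  proof -
    have "x = (\<lambda>i. restr {..<b} x i + restr {b..} x i)"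
      by (auto simp: restr_def)
    then show ?thesis
      using bounded_by_add[OF T restr_lp[OF x] restr_lp[OF x], of "{..<b}" "{b..}"] by simp
  qed
  then have "T x i = T (restr {..<a} x) i + T (restr {a..<b} x) i + T (restr {b..<c} x) i + T (restr {c..} x) i"
    unfolding P Q by simp
  then show ?thesis
    unfolding Q using ab by (auto simp: restr_def[of _ "T _"] restr_def[of _ "\<lambda>i. T _ i"])
qed

lemma disjoint_consecutive:
  fixes a :: "nat \<Rightarrow> nat"
  assumes "mono a"
  shows "disjoint_family_on (\<lambda>l. {a l..<a (Suc l)}) I" 
proof -
  have "{a k..<a (Suc k)} \<inter> {a l..<a (Suc l)} = {}" if "k < l" for k l
    using monoD[OF assms, of "Suc k" l] that by auto
  then show ?thesis
    unfolding disjoint_family_on_def by (metis inf_commute linorder_neqE_nat)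
qed

text \<open>\<open>h\<close> is a combination of the indicators of \<open>{a (Suc l)..}\<close> with
  coefficients \<open>d l\<close>, and the commutator is linear in \<open>h\<close>. The
  adjacent-block terms of all jumps have disjoint inputs and outputs, so they cost
  \<open>\<delta> * C\<close> once for each direction. The four remainders of each jump are merely
  added up, which is harmless as long as \<open>n * \<delta>\<close> stays bounded.\<close>

lemma quasicentral_commutator:
  fixes a :: "nat \<Rightarrow> nat" and d :: "nat \<Rightarrow> complex"
  assumes T: "bounded_by C T" "0 \<le> C" and x: "x \<in> lp p" and a: "mono a"
    and e: "\<And>l y. y \<in> lp p \<Longrightarrow> lp_norm p (restr {a (Suc l)..} (T (restr {..<a l} y))) \<le> \<eta> * lp_norm p y"
      "\<And>l y. y \<in> lp p \<Longrightarrow> lp_norm p (restr {..<a l} (T (restr {a (Suc l)..} y))) \<le> \<eta> * lp_norm p y"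
    and \<eta>: "0 \<le> \<eta>" and d: "\<And>l. norm (d l) \<le> \<delta>" "0 \<le> \<delta>"
    and h: "\<And>i. h i = (\<Sum>l<n. if a (Suc l) \<le> i then d l else 0)"
  shows "lp_norm p (\<lambda>i. T (\<lambda>j. h j * x j) i - h i * T x i) \<le> (2 * \<delta> * C + 4 * n * \<delta> * \<eta>) * lp_norm p x"
proof -
  have le: "a l \<le> a (Suc l)" for l
    using a by (simp add: monoD)
  have Tl: "T y \<in> lp p" if "y \<in> lp p" for y
    using bounded_byD(1)[OF T(1) that] .
  define u where "u l = restr {..<a l} (T (restr {a (Suc l)..<a (Suc (Suc l))} x))" for l
  define v where "v l = restr {..<a (Suc l)} (T (restr {a (Suc (Suc l))..} x))" for l
  define w where "w l = restr {a (Suc (Suc l))..} (T (restr {a l..<a (Suc l)} x))" for l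
  define z where "z l = restr {a (Suc l)..} (T (restr {..<a l} x))" for l
  define A where "A i = (\<Sum>l<n. d l * restr {a l..<a (Suc l)} (T (restr {a (Suc l)..<a (Suc (Suc l))} x)) i)" for i
  define B where "B i = (\<Sum>l<n. d l * restr {a (Suc l)..<a (Suc (Suc l))} (T (restr {a l..<a (Suc l)} x)) i)" for i
  define R where "R i = (\<Sum>l<n. d l * ((u l i + v l i) - (w l i + z l i)))" for i
  have "(\<lambda>j. h j * x j) = (\<lambda>j. \<Sum>l<n. d l * restr {a (Suc l)..} x j)"
    unfolding h by (auto simp: restr_def sum_distrib_right if_distrib if_distribR intro!: sum.cong)
  then have "T (\<lambda>j. h j * x j) = (\<lambda>i. \<Sum>l<n. d l * T (restr {a (Suc l)..} x) i)"
    using bounded_by_sum[OF T(1), of "{..<n}" "\<lambda>l. restr {a (Suc l)..} x" d] x by simp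
  moreover have "h i * T x i = (\<Sum>l<n. d l * restr {a (Suc l)..} (T x) i)" for i
    unfolding h by (auto simp: restr_def sum_distrib_right if_distrib if_distribR intro!: sum.cong)
  ultimately have "T (\<lambda>j. h j * x j) i - h i * T x i
      = (\<Sum>l<n. d l * (T (restr {a (Suc l)..} x) i - restr {a (Suc l)..} (T x) i))" for i
    by (simp add: right_diff_distrib sum_subtractf)
  then have eq: "(\<lambda>i. T (\<lambda>j. h j * x j) i - h i * T x i) = (\<lambda>i. (A i - B i) + R i)"
    unfolding lin_splitting[OF T(1) x le le] A_def B_def R_def u_def v_def w_def z_def
    by (simp add: distrib_left right_diff_distrib sum_subtractf sum.distrib)
  have le2: "lp_norm p (restr S (T (restr S' y))) \<le> \<eta> * lp_norm p x"
    if "y \<in> lp p" "lp_norm p y \<le> lp_norm p x" "lp_norm p (restr S (T (restr S' y))) \<le> \<eta> * lp_norm p y" for S S' y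
    using that(3) mult_left_mono[OF that(2) \<eta>] by linarith
  have uvwz: "u l \<in> lp p" "v l \<in> lp p" "w l \<in> lp p" "z l \<in> lp p" for l
    using x Tl by (auto simp: u_def v_def w_def z_def)
  have nu: "lp_norm p (u l) \<le> \<eta> * lp_norm p x" for l
  proof -
    have "restr {a (Suc l)..} (restr {a (Suc l)..<a (Suc (Suc l))} x) = restr {a (Suc l)..<a (Suc (Suc l))} x"
      by (auto simp: restr_def)
    then show ?thesis
      unfolding u_def using le2[of "restr {a (Suc l)..<a (Suc (Suc l))} x" "{..<a l}" "{a (Suc l)..}"]
        e(2)[of "restr {a (Suc l)..<a (Suc (Suc l))} x" l] x by (simp add: lp_norm_restr_le)
  qed
  have nw: "lp_norm p (w l) \<le> \<eta> * lp_norm p x" for l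
  proof -
    have "restr {..<a (Suc l)} (restr {a l..<a (Suc l)} x) = restr {a l..<a (Suc l)} x"
      by (auto simp: restr_def)
    then show ?thesis
      unfolding w_def using le2[of "restr {a l..<a (Suc l)} x" "{a (Suc (Suc l))..}" "{..<a (Suc l)}"]
        e(1)[of "restr {a l..<a (Suc l)} x" "Suc l"] x by (simp add: lp_norm_restr_le)
  qed
  have nv: "lp_norm p (v l) \<le> \<eta> * lp_norm p x" and nz: "lp_norm p (z l) \<le> \<eta> * lp_norm p x" for l
    using e(1)[OF x, of l] e(2)[OF x, of "Suc l"] by (auto simp: v_def z_def)
  have r: "(\<lambda>i. (u l i + v l i) - (w l i + z l i)) \<in> lp p"
    "lp_norm p (\<lambda>i. (u l i + v l i) - (w l i + z l i)) \<le> 4 * \<eta> * lp_norm p x" for l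
  proof -
    have uv: "(\<lambda>i. u l i + v l i) \<in> lp p" and wz: "(\<lambda>i. w l i + z l i) \<in> lp p"
      using uvwz by (auto intro: lp_minkowski)
    show "(\<lambda>i. (u l i + v l i) - (w l i + z l i)) \<in> lp p"
      using lp_diff(1)[OF uv wz] .
    show "lp_norm p (\<lambda>i. (u l i + v l i) - (w l i + z l i)) \<le> 4 * \<eta> * lp_norm p x"
      using lp_diff(2)[OF uv wz] lp_minkowski(2)[OF uvwz(1,2), of l l] lp_minkowski(2)[OF uvwz(3,4), of l l]
        nu[of l] nv[of l] nw[of l] nz[of l] by linarith
  qed
  have disj: "disjoint_family_on (\<lambda>l. {a l..<a (Suc l)}) {..<n}"
    "disjoint_family_on (\<lambda>l. {a (Suc l)..<a (Suc (Suc l))}) {..<n}"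
    using disjoint_consecutive[OF a] disjoint_consecutive[of "\<lambda>l. a (Suc l)"] a by (auto simp: mono_def)
  have lp_block: "(\<lambda>i. \<Sum>l<n. d l * restr (S l) (T (restr (S' l) x)) i) \<in> lp p" for S S'
    using lp_sum[of "{..<n}" "\<lambda>l i. d l * restr (S l) (T (restr (S' l) x)) i"] x Tl by (simp add: lp_scale)
  have AB: "A \<in> lp p" "B \<in> lp p"
    unfolding A_def[abs_def] B_def[abs_def] by (rule lp_block)+
  have nA: "lp_norm p A \<le> \<delta> * C * lp_norm p x" and nB: "lp_norm p B \<le> \<delta> * C * lp_norm p x"
    unfolding A_def[abs_def] B_def[abs_def]
    by (rule block_sum_bound; (rule T d x disj | simp))+
  have Rl: "R \<in> lp p" "lp_norm p R \<le> (\<Sum>l<n. lp_norm p (\<lambda>i. d l * ((u l i + v l i) - (w l i + z l i))))"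
    unfolding R_def[abs_def] using lp_sum[of "{..<n}" "\<lambda>l i. d l * ((u l i + v l i) - (w l i + z l i))"] r(1)
    by (auto simp: lp_scale)
  have "(\<Sum>l<n. lp_norm p (\<lambda>i. d l * ((u l i + v l i) - (w l i + z l i)))) \<le> (\<Sum>l<n. \<delta> * (4 * \<eta> * lp_norm p x))"
    using r d by (intro sum_mono) (simp add: lp_scale mult_mono)
  then have nR: "lp_norm p R \<le> 4 * n * \<delta> * \<eta> * lp_norm p x"
    using Rl(2) by (simp add: mult.assoc mult.left_commute)
  show ?thesis
    unfolding eq using lp_minkowski(2)[OF lp_diff(1)[OF AB] Rl(1)] lp_diff(2)[OF AB] nA nB nR
    by (simp add: distrib_right)
qed

text \<open>The values of \<open>h\<close> run slowly along the half circle \<open>(1 - cis t) / 2\<close>, \<open>0 \<le> t \<le> pi\<close>, along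
  blocks with respect to which all operators are nearly tridiagonal.\<close>

lemma quasicentral_diagonal:
  fixes \<T> :: "((nat \<Rightarrow> complex) \<Rightarrow> (nat \<Rightarrow> complex)) set"
  assumes fin: "finite \<T>" and T: "\<And>T. T \<in> \<T> \<Longrightarrow> bounded_op p T" and e: "e > 0"
  shows "\<exists>h N'. N \<le> N' \<and> (\<forall>i<N. h i = 0) \<and> (\<forall>i\<ge>N'. h i = 1) \<and> (\<forall>i. norm (1 - 2 * h i) = 1) \<and>
     (\<forall>T\<in>\<T>. \<forall>x\<in>lp p. lp_norm p (\<lambda>i. T (\<lambda>j. h j * x j) i - h i * T x i) \<le> e * lp_norm p x)"
proof -
  define C where "C = (\<Sum>T\<in>\<T>. op_norm p T)"
  have Cb: "bounded_by C T" if "T \<in> \<T>" for T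
    unfolding C_def using fin that T
    by (intro bounded_by_mono[OF bounded_by_op_norm] member_le_sum) (auto simp: op_norm_nonneg)
  have C0: "0 \<le> C"
    unfolding C_def using T by (intro sum_nonneg op_norm_nonneg) auto
  \<comment> \<open>Each jump will have size at most \<open>2 / n\<close>, because pi < 4. Then
    \<open>2 * (2 / n) * C\<close> is at most e/2 by the choice of \<open>n\<close>, and
    \<open>4 * n * (2 / n) * \<eta>\<close> equals e/2 for \<open>\<eta> = e / 16\<close>, whatever
    \<open>n\<close> is.\<close>
  obtain n :: nat where n: "real n > 8 * C / e"
    using reals_Archimedean2 by blast
  have n0: "real n > 0"
    using n C0 e by (meson divide_nonneg_pos le_less_trans mult_nonneg_nonneg zero_le_numeral)
  define \<eta> where "\<eta> = e / 16"
  have \<eta>: "\<eta> > 0"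
    using e by (simp add: \<eta>_def)
  obtain g where g: "\<And>N. N \<le> g N" "\<And>N T x. T \<in> \<T> \<Longrightarrow> x \<in> lp p \<Longrightarrow>
      lp_norm p (restr {g N..} (T (restr {..<N} x))) \<le> \<eta> * lp_norm p x \<and>
      lp_norm p (restr {..<N} (T (restr {g N..} x))) \<le> \<eta> * lp_norm p x"
    using almost_block_tridiagonal[OF fin T \<eta>] by metis
  define a where "a = rec_nat N (\<lambda>_ m. g m)"
  have a: "a 0 = N" "a (Suc k) = g (a k)" for k
    by (auto simp: a_def)
  have mono: "mono a"
    by (rule incseq_SucI) (simp add: a g)
  define c where "c k = (1 - cis (pi * real k / real n)) / 2" for k :: nat
  define h where "h i = (\<Sum>l<n. if a (Suc l) \<le> i then c (Suc l) - c l else 0)" for i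
  have c0: "c 0 = 0" and cn: "c n = 1"
    using n0 by (auto simp: c_def)
  have cd: "norm (c (Suc l) - c l) \<le> 2 / real n" for l
  proof -
    have "norm (c (Suc l) - c l) = norm (cis (pi * real l / real n) - cis (pi * real (Suc l) / real n)) / 2"
      by (simp add: c_def diff_divide_distrib[symmetric] norm_divide)
    also have "\<dots> \<le> \<bar>pi * real l / real n - pi * real (Suc l) / real n\<bar> / 2"
      by (intro divide_right_mono norm_cis_diff_le) auto
    also have "pi * real l / real n - pi * real (Suc l) / real n = - (pi / real n)"
      using n0 by (simp add: field_simps)
    also have "\<bar>- (pi / real n)\<bar> / 2 \<le> 2 / real n"
      using pi_less_4 n0 by (simp add: field_simps)
    finally show ?thesis .
  qed
  \<comment> \<open>By monotonicity the indices \<open>l\<close> with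
    \<open>a (Suc l) \<le> i\<close> form an initial segment, so the sum telescopes to a single
    value of \<open>c\<close> and stays on the circle.\<close>
  have val: "\<exists>j\<le>m. (\<Sum>l<m. if a (Suc l) \<le> i then c (Suc l) - c l else 0) = c j \<and> (a m \<le> i \<longrightarrow> j = m)" for i m
  proof (induction m)
    case (Suc m)
    then obtain j where j: "j \<le> m" "(\<Sum>l<m. if a (Suc l) \<le> i then c (Suc l) - c l else 0) = c j" "a m \<le> i \<longrightarrow> j = m"
      by blast
    have "a m \<le> a (Suc m)"
      using mono by (simp add: monoD)
    then show ?case
      using j by (cases "a (Suc m) \<le> i") (auto intro: exI[of _ "Suc m"] exI[of _ j])
  qed (auto simp: c0)
  have h0: "h i = 0" if "i < N" for i
  proof -
    have "\<not> a (Suc l) \<le> i" for l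
      using that monoD[OF mono, of 0 "Suc l"] a(1) by simp
    then show ?thesis
      by (simp add: h_def)
  qed
  have h1: "h i = 1" if "i \<ge> a n" for i
    using val[of n i] that cn by (auto simp: h_def)
  have hz: "norm (1 - 2 * h i) = 1" for i
  proof -
    obtain j where "h i = c j"
      using val[of n i] by (auto simp: h_def)
    then have "1 - 2 * h i = cis (pi * real j / real n)"
      unfolding c_def by (simp add: field_simps)
    then show ?thesis
      by simp
  qed
  have "lp_norm p (\<lambda>i. T (\<lambda>j. h j * x j) i - h i * T x i) \<le> e * lp_norm p x" if TT: "T \<in> \<T>" and x: "x \<in> lp p" for T x
  proof -
    have "lp_norm p (\<lambda>i. T (\<lambda>j. h j * x j) i - h i * T x i)
        \<le> (2 * (2 / real n) * C + 4 * real n * (2 / real n) * \<eta>) * lp_norm p x"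
      using g(2)[OF TT] cd \<eta> by (intro quasicentral_commutator[OF Cb[OF TT] C0 x mono, where d = "\<lambda>l. c (Suc l) - c l"])
        (auto simp: a h_def)
    also have "\<dots> \<le> e * lp_norm p x"
    proof (rule mult_right_mono)
      have 1: "2 * (2 / real n) * C \<le> e / 2"
        using n n0 e by (simp add: field_simps)
      have 2: "4 * real n * (2 / real n) * \<eta> \<le> e / 2"
        using n0 by (simp add: \<eta>_def)
      show "2 * (2 / real n) * C + 4 * real n * (2 / real n) * \<eta> \<le> e"
        using add_mono[OF 1 2] by (simp only: field_sum_of_halves)
    qed simp
    finally show ?thesis .
  qed
  moreover have "N \<le> a n"
    using monoD[OF mono, of 0 n] a(1) by simp
  ultimately show ?thesis
    using h0 h1 hz by (intro exI[of _ h] exI[of _ "a n"]) simp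
qed

section \<open>A path from the identity to an involution\<close>

definition mix :: "('c \<Rightarrow> complex) \<Rightarrow> ('c \<Rightarrow> 'c) \<Rightarrow> ('c \<Rightarrow> complex) \<Rightarrow> 'c \<Rightarrow> complex" where
  "mix g \<tau> x = (\<lambda>c. (1 - g c) * x c + g c * x (\<tau> c))"

lemma norm_half_circle_le:
  fixes g :: complex
  assumes "norm (1 - 2 * g) = 1"
  shows "norm g \<le> 1" "norm (1 - g) \<le> 1"
proof -
  have "norm (2 * g) \<le> norm (1 :: complex) + norm (1 - 2 * g)" for g :: complex
    using norm_triangle_ineq4[of 1 "1 - 2 * g"] by simp
  from this[of g] show "norm g \<le> 1"
    using assms by (simp add: norm_mult)
  have "norm (2 * (1 - g)) \<le> norm (1 :: complex) + norm (1 - 2 * g)"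
    using norm_triangle_ineq[of 1 "1 - 2 * g"] by (simp add: algebra_simps)
  then have "2 * norm (1 - g) \<le> 2"
    unfolding norm_mult assms by simp
  then show "norm (1 - g) \<le> 1"
    by simp
qed

lemma half_circle_identity:
  fixes g :: complex
  assumes "norm (1 - 2 * g) = 1"
  shows "g + cnj g = 2 * g * cnj g"
proof -
  have "(1 - 2 * g) * cnj (1 - 2 * g) = complex_of_real (norm (1 - 2 * g) ^ 2)"
    by (rule complex_norm_square[symmetric])
  then have "2 * (g + cnj g) = 2 * (2 * g * cnj g)"
    unfolding assms by (simp add: algebra_simps)
  then show ?thesis
    by (rule mult_left_cancel[THEN iffD1, rotated]) simp
qed

text \<open>Both terms of \<open>mix\<close> are weighted composition operators with weights of
  modulus at most 1; this is the origin of the constant 2.\<close>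

lemma bounded_by_mix:
  assumes "\<And>c. norm (1 - 2 * g c) = 1" "inj \<tau>"
  shows "bounded_by 2 (mix g \<tau>)"
proof -
  have "bounded_by 1 (wcomp (\<lambda>c. 1 - g c) (\<lambda>c. c))" "bounded_by 1 (wcomp g \<tau>)"
    using assms norm_half_circle_le by (auto intro!: bounded_by_wcomp intro: inj_on_subset)
  from bounded_by_sum2[OF this] show ?thesis
    by (simp add: wcomp_def mix_def[abs_def])
qed

text \<open>On an orbit of \<open>\<tau>\<close> the operator fixes symmetric vectors and multiplies
  antisymmetric ones by \<open>1 - 2 * g c\<close>, a number of modulus 1. Conjugating
  \<open>g\<close> conjugates this factor and hence inverts it; in terms of \<open>g\<close> this is
  \<open>half_circle_identity\<close>.\<close>

lemma mix_inverse:
  assumes g: "\<And>c. norm (1 - 2 * g c) = 1" "\<And>c. g (\<tau> c) = g c" and \<tau>: "\<And>c. \<tau> (\<tau> c) = c"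
  shows "mix (\<lambda>c. cnj (g c)) \<tau> (mix g \<tau> x) = x" "mix g \<tau> (mix (\<lambda>c. cnj (g c)) \<tau> x) = x"
proof -
  have gg: "g c + cnj (g c) = 2 * g c * cnj (g c)" for c
    by (rule half_circle_identity[OF g(1)])
  have id: "(1 - cnj b) * ((1 - b) * u + b * w) + cnj b * ((1 - b) * w + b * u) = u"
    if "b + cnj b = 2 * b * cnj b" for b u w :: complex
  proof -
    have "(1 - cnj b) * ((1 - b) * u + b * w) + cnj b * ((1 - b) * w + b * u)
      = u - (b + cnj b - 2 * b * cnj b) * (u - w)"
      by (simp add: algebra_simps)
    then show ?thesis
      using that by simp
  qed
  show "mix (\<lambda>c. cnj (g c)) \<tau> (mix g \<tau> x) = x"
    unfolding mix_def g(2) \<tau> using id[OF gg] by (simp add: fun_eq_iff)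
  have gg': "cnj (g c) + cnj (cnj (g c)) = 2 * cnj (g c) * cnj (cnj (g c))" for c
    using gg[of c] by (simp add: algebra_simps)
  show "mix g \<tau> (mix (\<lambda>c. cnj (g c)) \<tau> x) = x"
    unfolding mix_def g(2) \<tau> using id[OF gg'] by (simp add: fun_eq_iff)
qed

text \<open>On each orbit the operator is unitary. Summing every coordinate together with its
  \<open>\<tau>\<close>-partner counts everything twice and avoids a choice of representatives of
  the orbits.\<close>

lemma mix_isometric:
  assumes p2: "p = 2" and g: "\<And>c. norm (1 - 2 * g c) = 1" "\<And>c. g (\<tau> c) = g c"
    and \<tau>: "\<And>c. \<tau> (\<tau> c) = c" and x: "x \<in> lp p"
  shows "lp_norm p (mix g \<tau> x) = lp_norm p x"
proof -
  have bij: "bij_betw \<tau> UNIV UNIV"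
    by (rule involuntory_imp_bij) (simp add: \<tau>)
  then have inj: "inj \<tau>"
    by (simp add: bij_betw_def)
  have half: "(2 * infsum (\<lambda>c. norm (y c) powr p) UNIV) =
      infsum (\<lambda>c. norm (y c) ^ 2 + norm (y (\<tau> c)) ^ 2) UNIV" if y: "y \<in> lp p" for y
  proof -
    have s: "(\<lambda>c. norm (y c) ^ 2) summable_on UNIV"
      using y by (simp add: lp_def p2)
    then have s': "(\<lambda>c. norm (y (\<tau> c)) ^ 2) summable_on UNIV"
      using summable_on_reindex_bij_betw[OF bij, of "\<lambda>c. norm (y c) ^ 2"] by simp
    have "infsum (\<lambda>c. norm (y (\<tau> c)) ^ 2) UNIV = infsum (\<lambda>c. norm (y c) ^ 2) UNIV"
      using infsum_reindex_bij_betw[OF bij, of "\<lambda>c. norm (y c) ^ 2"] by simp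
    then show ?thesis
      using infsum_add[OF s s'] by (simp add: p2)
  qed
  have pt: "norm (mix g \<tau> x c) ^ 2 + norm (mix g \<tau> x (\<tau> c)) ^ 2 = norm (x c) ^ 2 + norm (x (\<tau> c)) ^ 2" for c
  proof -
    let ?b = "g c" and ?u = "x c" and ?w = "x (\<tau> c)"
    have gg: "?b + cnj ?b - 2 * ?b * cnj ?b = 0"
      using half_circle_identity[OF g(1)] by simp
    have "((1 - ?b) * ?u + ?b * ?w) * cnj ((1 - ?b) * ?u + ?b * ?w)
        + ((1 - ?b) * ?w + ?b * ?u) * cnj ((1 - ?b) * ?w + ?b * ?u)
      = ?u * cnj ?u + ?w * cnj ?w - (?b + cnj ?b - 2 * ?b * cnj ?b) * (?u - ?w) * (cnj ?u - cnj ?w)"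
      by (simp add: algebra_simps)
    then have "complex_of_real (norm (mix g \<tau> x c) ^ 2 + norm (mix g \<tau> x (\<tau> c)) ^ 2)
        = complex_of_real (norm ?u ^ 2 + norm ?w ^ 2)"
      unfolding of_real_add complex_norm_square mix_def g(2) \<tau> gg by simp
    then show ?thesis
      by (simp only: of_real_eq_iff)
  qed
  have "2 * infsum (\<lambda>c. norm (mix g \<tau> x c) powr p) UNIV = 2 * infsum (\<lambda>c. norm (x c) powr p) UNIV"
    using half[OF bounded_byD(1)[OF bounded_by_mix[OF g(1) inj] x]] half[OF x] by (simp add: pt)
  then show ?thesis
    by (simp add: lp_norm_def)
qed

section \<open>Permutations of the summands\<close>

lemma bounded_byI_norm:
  assumes "bounded_op p T" "\<And>x. x \<in> lp p \<Longrightarrow> lp_norm p (T x) \<le> C * lp_norm p x"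
  shows "bounded_by C T"
  using assms by (auto simp: bounded_by_def bounded_op_def)

lemma bounded_by_zero_vec: "bounded_by C T \<Longrightarrow> T (\<lambda>_. 0) = (\<lambda>_. 0)"
  using bounded_by_scale[of C T "\<lambda>_. 0" 0] by simp

text \<open>The permutation acts on the first summand of each slot and leaves the second in place.
  The inverse appears because vectors are pulled back: what stood in slot \<open>k\<close> stands in
  slot \<open>\<sigma> k\<close> afterwards.\<close>

definition perm_idx :: "(nat \<Rightarrow> nat) \<Rightarrow> nat \<times> ('i + 'j) \<Rightarrow> nat \<times> ('i + 'j)" where
  "perm_idx \<sigma> c = (case snd c of Inl i \<Rightarrow> (inv \<sigma> (fst c), Inl i) | Inr j \<Rightarrow> c)"

definition perm_op :: "(nat \<Rightarrow> nat) \<Rightarrow> (nat \<times> ('i + 'j) \<Rightarrow> complex) \<Rightarrow> nat \<times> ('i + 'j) \<Rightarrow> complex" where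
  "perm_op \<sigma> x = (\<lambda>c. x (perm_idx \<sigma> c))"

lemma perm_op_simps [simp]:
  "perm_op \<sigma> x (k, Inl i) = x (inv \<sigma> k, Inl i)" "perm_op \<sigma> x (k, Inr j) = x (k, Inr j)"
  by (auto simp: perm_op_def perm_idx_def)

lemma bounded_by_perm_op:
  assumes "bij \<sigma>" shows "bounded_by 1 (perm_op \<sigma>)"
proof -
  have "inj (inv \<sigma>)"
    using assms bij_imp_bij_inv bij_is_inj by blast
  then have "inj (perm_idx \<sigma> :: nat \<times> ('a + 'b) \<Rightarrow> _)"
    by (auto simp: inj_on_def perm_idx_def split: sum.splits)
  from bounded_by_reindex[OF this] show ?thesis
    by (simp add: perm_op_def[abs_def])
qed

definition emb_l :: "('i \<Rightarrow> complex) \<Rightarrow> 'i + 'j \<Rightarrow> complex" where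
  "emb_l y = (\<lambda>j. case j of Inl i \<Rightarrow> y i | Inr _ \<Rightarrow> 0)"

lemma emb_l_simps [simp]: "emb_l y (Inl i) = y i" "emb_l y (Inr j) = 0"
  by (auto simp: emb_l_def)

lemma bounded_by_emb_l: "bounded_by 1 (emb_l :: ('i \<Rightarrow> complex) \<Rightarrow> 'i + 'j \<Rightarrow> complex)"
proof -
  have "(emb_l :: ('i \<Rightarrow> complex) \<Rightarrow> 'i + 'j \<Rightarrow> complex) = (\<lambda>y j. if j \<in> range Inl then y (projl j) else 0)"
    by (auto simp: emb_l_def fun_eq_iff split: sum.splits)
  then show ?thesis
    using bounded_by_section[of projl "range Inl :: ('i + 'j) set"] by (simp add: inj_on_def)
qed

lemma bounded_by_slice: "bounded_by 1 (\<lambda>x j. x (k, j))"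
  by (rule bounded_by_reindex) (auto simp: inj_on_def)

lemma bounded_by_left: "bounded_by 1 (\<lambda>y i. y (Inl i))"
  by (rule bounded_by_reindex) (auto simp: inj_on_def)

text \<open>Each row is a compact operator followed by the embedding of one slot, and finite sums of
  these are compact. In the application \<open>D\<close> is finite because the permutations move
  only finitely many slots.\<close>

lemma compact_op_rows:
  fixes C :: "nat \<Rightarrow> ('c \<Rightarrow> complex) \<Rightarrow> 'j \<Rightarrow> complex"
  assumes "finite D" "\<And>k. k \<in> D \<Longrightarrow> compact_op p (C k)"
  shows "compact_op p (\<lambda>x c. if fst c \<in> D then C (fst c) x (snd c) else 0)"
  using assms
proof induction
  case empty
  show ?case
    using compact_op_zero by simp
next
  case (insert k D)
  have "inj_on snd {c :: nat \<times> 'j. fst c = k}"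
    by (auto simp: inj_on_def)
  then have emb: "bounded_op p (\<lambda>y c. if c \<in> {c :: nat \<times> 'j. fst c = k} then y (snd c) else 0)"
    by (rule bounded_byI_op[OF bounded_by_section])
  have Ck: "compact_op p (C k)"
    using insert.prems by simp
  have "compact_op p (\<lambda>x c. if c \<in> {c :: nat \<times> 'j. fst c = k} then C k x (snd c) else 0)"
    by (rule compact_op_comp_left[OF emb Ck])
  moreover have "compact_op p (\<lambda>x c. if fst c \<in> D then C (fst c) x (snd c) else 0)"
  proof (rule insert.IH)
    show "compact_op p (C k)" if "k \<in> D" for k
      using insert.prems[of k] that by simp
  qed
  ultimately have "compact_op p (\<lambda>x c. (if c \<in> {c :: nat \<times> 'j. fst c = k} then C k x (snd c) else 0)
      + (if fst c \<in> D then C (fst c) x (snd c) else 0))"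
    by (rule compact_op_add)
  moreover have "(\<lambda>x c. (if c \<in> {c :: nat \<times> 'j. fst c = k} then C k x (snd c) else 0)
      + (if fst c \<in> D then C (fst c) x (snd c) else 0))
      = (\<lambda>x c. if fst c \<in> insert k D then C (fst c) x (snd c) else 0)"
    using insert.hyps by (auto simp: fun_eq_iff)
  ultimately show ?case
    by simp
qed

lemma op_bigdsum_apply: "op_bigdsum F x (k, j) = F k (\<lambda>j. x (k, j)) j"
  by (simp add: op_bigdsum_def)

text \<open>Off \<open>D\<close> the slot is fixed and both sides agree. On the finitely many other
  slots both operators are direct sums modulo compact ones with the same second summand
  \<open>F k\<close>, so only the first summands disagree. The small part of this disagreement maps
  different slots to different slots, hence it has norm at most \<open>e\<close> and the errors do
  not add up.\<close>

lemma essentially_intertwines: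
  fixes A B :: "nat \<Rightarrow> ('i + 'j \<Rightarrow> complex) \<Rightarrow> 'i + 'j \<Rightarrow> complex"
    and P Q :: "nat \<Rightarrow> ('i \<Rightarrow> complex) \<Rightarrow> 'i \<Rightarrow> complex" and F :: "nat \<Rightarrow> ('j \<Rightarrow> complex) \<Rightarrow> 'j \<Rightarrow> complex"
  assumes \<sigma>: "bij \<sigma>" and D: "finite D" "\<And>k. k \<notin> D \<Longrightarrow> \<sigma> k = k" "\<And>k x. k \<notin> D \<Longrightarrow> A k x = B k x"
    and KA: "\<And>k. k \<in> D \<Longrightarrow> compact_op p (\<lambda>x i. A k x i - op_dsum (P k) (F k) x i)"
    and KB: "\<And>k. k \<in> D \<Longrightarrow> compact_op p (\<lambda>x i. B k x i - op_dsum (Q k) (F k) x i)"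
    and L: "\<And>k. k \<in> D \<Longrightarrow> \<exists>K. compact_op p K \<and> bounded_by e (\<lambda>x i. (P (\<sigma> k) x i - Q k x i) - K x i)"
    and e: "0 \<le> e"
  shows "\<exists>K. compact_op p K \<and>
    bounded_by e (\<lambda>x c. (op_bigdsum A (perm_op \<sigma> x) c - perm_op \<sigma> (op_bigdsum B x) c) - K x c)"
proof -
  have inv: "\<sigma> (inv \<sigma> k) = k" "inv \<sigma> (\<sigma> k) = k" for k
    using \<sigma> by (simp_all add: bij_is_surj surj_f_inv_f bij_is_inj)
  have invD: "inv \<sigma> k \<in> D" if "k \<in> D" for k
    using D(2)[of "inv \<sigma> k"] inv(1)[of k] that by metis
  have inv_fix: "inv \<sigma> k = k" if "k \<notin> D" for k
    using D(2)[OF that] inv(2)[of k] by simp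
  have "\<forall>k\<in>D. \<exists>K. compact_op p K \<and> bounded_by e (\<lambda>x i. (P (\<sigma> k) x i - Q k x i) - K x i)"
    using L by (rule ballI)
  from bchoice[OF this] obtain K0 where K0: "\<And>k. k \<in> D \<Longrightarrow> compact_op p (K0 k)"
    "\<And>k. k \<in> D \<Longrightarrow> bounded_by e (\<lambda>x i. (P (\<sigma> k) x i - Q k x i) - K0 k x i)"
    by auto
  \<comment> \<open>The index \<open>k\<close> is the slot of arrival; \<open>L\<close> speaks about
    the slot of departure, which is \<open>inv \<sigma> k\<close>.\<close>
  define E where "E k = (if k \<in> D then (\<lambda>x i. (P k x i - Q (inv \<sigma> k) x i) - K0 (inv \<sigma> k) x i) else (\<lambda>x i. 0))" for k
  have Eb: "bounded_by e (E k)" for k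
  proof (cases "k \<in> D")
    case True
    then show ?thesis
      using K0(2)[OF invD[OF True]] inv by (simp add: E_def)
  next
    case False
    then have "E k = (\<lambda>x i. 0)"
      by (simp add: E_def)
    then show ?thesis
      by (simp only: bounded_by_mono[OF bounded_by_zero e])
  qed
  define EE where "EE x = (\<lambda>c :: nat \<times> ('i + 'j). case snd c of Inl i \<Rightarrow> E (fst c) (\<lambda>i. x (inv \<sigma> (fst c), Inl i)) i | Inr _ \<Rightarrow> 0)"
    for x :: "nat \<times> ('i + 'j) \<Rightarrow> complex"
  have EEb: "bounded_by e EE"
  proof -
    have i1: "inj (\<lambda>(k, i :: 'i). (inv \<sigma> k, Inl i :: 'i + 'j))"
      using inv by (auto simp: inj_on_def) metis
    have b1: "bounded_by 1 (\<lambda>x c. x ((\<lambda>(k, i :: 'i). (inv \<sigma> k, Inl i :: 'i + 'j)) c))"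
      by (rule bounded_by_reindex[OF i1])
    let ?f = "\<lambda>c :: nat \<times> ('i + 'j). (fst c, projl (snd c))"
    have i2: "inj_on ?f {c. snd c \<in> range Inl}"
      by (auto simp: inj_on_def)
    have "bounded_by (1 * (e * 1)) (\<lambda>x c. if c \<in> {c. snd c \<in> range Inl}
        then op_bigdsum E (\<lambda>c. x ((\<lambda>(k, i :: 'i). (inv \<sigma> k, Inl i :: 'i + 'j)) c)) (?f c) else 0)"
      using bounded_by_comp[OF bounded_by_section[OF i2] bounded_by_comp[OF bounded_by_bigdsum[OF Eb e] b1 e]] by simp
    moreover have "(\<lambda>x c. if c \<in> {c. snd c \<in> range Inl}
        then op_bigdsum E (\<lambda>c. x ((\<lambda>(k, i :: 'i). (inv \<sigma> k, Inl i :: 'i + 'j)) c)) (?f c) else 0) = EE"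
      by (auto simp: fun_eq_iff EE_def op_bigdsum_apply split: sum.splits)
    ultimately show ?thesis
      by simp
  qed
  define K where "K x c = (op_bigdsum A (perm_op \<sigma> x) c - perm_op \<sigma> (op_bigdsum B x) c) - EE x c" for x c
  define KA' where "KA' k x i = A k x i - op_dsum (P k) (F k) x i" for k x i
  define KB' where "KB' k x i = B k x i - op_dsum (Q k) (F k) x i" for k x i
  \<comment> \<open>Row \<open>k\<close> of the compact part. \<open>perm_op\<close> takes the first
    half of row \<open>k\<close> from row \<open>inv \<sigma> k\<close> and the second half from row
    \<open>k\<close> itself, so the correction of \<open>B\<close> enters in two pieces.\<close>
  define C where "C k x j = (KA' k (\<lambda>j. perm_op \<sigma> x (k, j)) j - restr (range Inl) (KB' (inv \<sigma> k) (\<lambda>j. x (inv \<sigma> k, j))) j)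
      - restr (range Inr) (KB' k (\<lambda>j. x (k, j))) j + emb_l (K0 (inv \<sigma> k) (\<lambda>i. x (inv \<sigma> k, Inl i))) j"
    for k and x :: "nat \<times> ('i + 'j) \<Rightarrow> complex" and j
  have Cc: "compact_op p (C k)" if k: "k \<in> D" for k
  proof -
    note sl = bounded_byI_op[OF bounded_by_slice]
    have 1: "compact_op p (\<lambda>x. KA' k (\<lambda>j. perm_op \<sigma> x (k, j)))"
      using KA[OF k] unfolding KA'_def[abs_def]
      by (rule compact_op_comp_right[OF _ bounded_op_comp[OF sl bounded_byI_op[OF bounded_by_perm_op[OF \<sigma>]]]])
    have 2: "compact_op p (\<lambda>x. restr S (KB' l (\<lambda>j. x (l, j))))" if "l \<in> D" for l S
      using KB[OF that] unfolding KB'_def[abs_def]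
      by (intro compact_op_comp_left[OF bounded_byI_op[OF bounded_by_restr]] compact_op_comp_right[OF _ sl])
    have 3: "compact_op p (\<lambda>x. emb_l (K0 (inv \<sigma> k) (\<lambda>i. x (inv \<sigma> k, Inl i))) :: 'i + 'j \<Rightarrow> complex)"
      by (intro compact_op_comp_left[OF bounded_byI_op[OF bounded_by_emb_l]]
          compact_op_comp_right[OF K0(1)[OF invD[OF k]] bounded_byI_op[OF bounded_by_reindex]]) (auto simp: inj_on_def)
    show ?thesis
      unfolding C_def[abs_def]
      by (rule compact_op_add[OF compact_op_diff[OF compact_op_diff[OF 1 2[OF invD[OF k]]] 2[OF k]] 3])
  qed
  have Kc: "compact_op p K"
  proof (rule compact_op_cong[OF compact_op_rows[OF D(1) Cc]])
    fix x :: "nat \<times> ('i + 'j) \<Rightarrow> complex" assume "x \<in> lp p"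
    show "(\<lambda>c. if fst c \<in> D then C (fst c) x (snd c) else 0) = K x"
    proof
      fix c :: "nat \<times> ('i + 'j)"
      obtain k j where c: "c = (k, j)"
        by (cases c)
      show "(if fst c \<in> D then C (fst c) x (snd c) else 0) = K x c"
      proof (cases "k \<in> D")
        case True
        then show ?thesis
          unfolding c by (cases j)
            (auto simp: C_def K_def KA'_def KB'_def EE_def E_def restr_def op_bigdsum_apply op_dsum_def)
      next
        case False
        have "(\<lambda>j. perm_op \<sigma> x (k, j)) = (\<lambda>j. x (k, j))"
        proof
          fix j show "perm_op \<sigma> x (k, j) = x (k, j)"
            using inv_fix[OF False] by (cases j) simp_all
        qed
        then show ?thesis
          using False D(3)[OF False] inv_fix[OF False]
          unfolding c by (cases j) (auto simp: K_def EE_def E_def op_bigdsum_apply)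
      qed
    qed
  qed auto
  have "bounded_by e (\<lambda>x c. (op_bigdsum A (perm_op \<sigma> x) c - perm_op \<sigma> (op_bigdsum B x) c) - K x c)"
    using EEb by (simp add: K_def)
  with Kc show ?thesis
    by blast
qed

section \<open>Commutators with diagonal operators on the first summands\<close>

definition fib_mult :: "('i \<Rightarrow> complex) \<Rightarrow> ('i + 'j \<Rightarrow> complex) \<Rightarrow> 'i + 'j \<Rightarrow> complex" where
  "fib_mult h y = (\<lambda>j. case j of Inl i \<Rightarrow> h i * y (Inl i) | Inr _ \<Rightarrow> 0)"

lemma fib_mult_simps [simp]: "fib_mult h y (Inl i) = h i * y (Inl i)" "fib_mult h y (Inr j) = 0"
  by (auto simp: fib_mult_def)

lemma bounded_by_fib_mult:
  fixes h :: "'i \<Rightarrow> complex"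
  assumes "\<And>i. norm (h i) \<le> 1"
  shows "bounded_by 1 (fib_mult h :: ('i + 'j \<Rightarrow> complex) \<Rightarrow> 'i + 'j \<Rightarrow> complex)"
proof -
  have "bounded_by 1 (wcomp (\<lambda>j :: 'i + 'j. case j of Inl i \<Rightarrow> h i | Inr _ \<Rightarrow> 0) (\<lambda>j. j))"
    using assms by (intro bounded_by_wcomp) (auto split: sum.splits)
  moreover have "wcomp (\<lambda>j :: 'i + 'j. case j of Inl i \<Rightarrow> h i | Inr _ \<Rightarrow> 0) (\<lambda>j. j) = fib_mult h"
    by (auto simp: wcomp_def fib_mult_def fun_eq_iff split: sum.splits)
  ultimately show ?thesis
    by simp
qed

text \<open>Up to the contribution of \<open>K\<close>, the commutator is that of \<open>P\<close>
  with \<open>h\<close>. The terms K h and h K are small because \<open>h\<close> vanishes below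
  \<open>N\<close> and so meets \<open>K\<close> only far out. Each of the three terms contributes
  one \<open>e\<close>.\<close>

lemma fibre_commutator_bound:
  fixes A :: "(nat + 'j \<Rightarrow> complex) \<Rightarrow> nat + 'j \<Rightarrow> complex"
  assumes A: "bounded_op p A" and P: "bounded_op p P" and F: "bounded_op p F"
    and K: "compact_op p K" and K_def: "K = (\<lambda>y j. A y j - op_dsum P F y j)"
    and h: "\<And>i. norm (h i) \<le> 1" "\<And>i. i < N \<Longrightarrow> h i = 0"
    and c1: "\<And>x. x \<in> lp p \<Longrightarrow> lp_norm p (\<lambda>i. P (\<lambda>j. h j * x j) i - h i * P x i) \<le> e * lp_norm p x"
    and c2: "\<And>y. y \<in> lp p \<Longrightarrow> lp_norm p (K (restr (Inl ` {N..}) y)) \<le> e * lp_norm p y"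
    and c3: "\<And>y. y \<in> lp p \<Longrightarrow> lp_norm p (restr (Inl ` {N..}) (K y)) \<le> e * lp_norm p y"
    and e: "0 \<le> e"
  shows "bounded_by (3 * e) (\<lambda>y j. A (fib_mult h y) j - fib_mult h (A y) j)"
proof (rule bounded_byI_norm)
  let ?S = "Inl ` {N..} :: (nat + 'j) set"
  have hb: "bounded_by 1 (fib_mult h :: (nat + 'j \<Rightarrow> complex) \<Rightarrow> _)"
    by (rule bounded_by_fib_mult[OF h(1)])
  note hop = bounded_byI_op[OF hb]
  show "bounded_op p (\<lambda>y j. A (fib_mult h y) j - fib_mult h (A y) j)"
    by (rule bounded_op_diff[OF bounded_op_comp[OF A hop] bounded_op_comp[OF hop A]])
  fix y :: "nat + 'j \<Rightarrow> complex" assume y: "y \<in> lp p"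
  have hy: "fib_mult h y \<in> lp p" "lp_norm p (fib_mult h y) \<le> lp_norm p y"
    using bounded_byD[OF hb y] by auto
  have yl: "(\<lambda>i. y (Inl i)) \<in> lp p" "lp_norm p (\<lambda>i. y (Inl i)) \<le> lp_norm p y"
    using bounded_byD[OF bounded_by_left y] by auto
  have F0: "F (\<lambda>_. 0) = (\<lambda>_. 0)"
    using F by (elim bounded_opD) (rule bounded_by_zero_vec)
  let ?u = "\<lambda>i. P (\<lambda>j. h j * y (Inl j)) i - h i * P (\<lambda>j. y (Inl j)) i"
  have hyl: "(\<lambda>j. h j * y (Inl j)) \<in> lp p"
    using lp_dominated(1)[OF yl(1), of "\<lambda>j. h j * y (Inl j)"] h(1) by (simp add: norm_mult mult_left_le_one_le)
  have hPl: "(\<lambda>i. h i * P (\<lambda>j. y (Inl j)) i) \<in> lp p"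
    using lp_dominated(1)[OF bounded_opD_lp[OF P yl(1)], of "\<lambda>i. h i * P (\<lambda>j. y (Inl j)) i"] h(1)
    by (simp add: norm_mult mult_left_le_one_le)
  have ul: "?u \<in> lp p"
    by (rule lp_diff(1)[OF bounded_opD_lp[OF P hyl] hPl])
  have u: "emb_l ?u \<in> lp p" "lp_norm p (emb_l ?u :: nat + 'j \<Rightarrow> complex) \<le> e * lp_norm p y"
  proof -
    have "emb_l ?u \<in> lp p" "lp_norm p (emb_l ?u :: nat + 'j \<Rightarrow> complex) \<le> lp_norm p ?u"
      using bounded_byD[OF bounded_by_emb_l ul] by auto
    moreover have "lp_norm p ?u \<le> e * lp_norm p y"
      by (rule order_trans[OF c1[OF yl(1)] mult_left_mono[OF yl(2) e]])
    ultimately show "emb_l ?u \<in> lp p" "lp_norm p (emb_l ?u :: nat + 'j \<Rightarrow> complex) \<le> e * lp_norm p y"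
      by (auto intro: order_trans)
  qed
  have "restr ?S (fib_mult h y) = fib_mult h y"
  proof
    fix j show "restr ?S (fib_mult h y) j = fib_mult h y j"
      using h(2) by (cases j) (auto simp: restr_def inj_image_mem_iff not_le)
  qed
  then have 2: "lp_norm p (K (fib_mult h y)) \<le> e * lp_norm p y"
    using c2[OF hy(1)] mult_left_mono[OF hy(2) e] by simp
  note Kl = bounded_opD_lp[OF compact_op_bounded[OF K]]
  have "fib_mult h (restr ?S (K y)) = fib_mult h (K y)"
  proof
    fix j show "fib_mult h (restr ?S (K y)) j = fib_mult h (K y) j"
      using h(2) by (cases j) (auto simp: restr_def inj_image_mem_iff not_le)
  qed
  then have 3: "lp_norm p (fib_mult h (K y)) \<le> e * lp_norm p y"
    using bounded_byD(2)[OF hb restr_lp[OF Kl[OF y]], of ?S] c3[OF y] by simp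
  have eq: "(\<lambda>j. A (fib_mult h y) j - fib_mult h (A y) j) =
      (\<lambda>j. emb_l ?u j + (K (fib_mult h y) j - fib_mult h (K y) j))"
  proof
    fix j :: "nat + 'j"
    show "A (fib_mult h y) j - fib_mult h (A y) j = emb_l ?u j + (K (fib_mult h y) j - fib_mult h (K y) j)"
      by (cases j) (simp_all add: K_def op_dsum_def F0 algebra_simps)
  qed
  have kl: "K (fib_mult h y) \<in> lp p" "fib_mult h (K y) \<in> lp p"
    using Kl hy y bounded_byD(1)[OF hb] by auto
  show "lp_norm p (\<lambda>j. A (fib_mult h y) j - fib_mult h (A y) j) \<le> 3 * e * lp_norm p y"
    unfolding eq using lp_minkowski(2)[OF u(1) lp_diff(1)[OF kl]] lp_diff(2)[OF kl] u(2) 2 3 by linarith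
qed

text \<open>It serves to multiply differences of two \<open>perm_op\<close>s, which vanish on the
  second summands.\<close>

definition slot_mult :: "('i \<Rightarrow> complex) \<Rightarrow> (nat \<times> ('i + 'j) \<Rightarrow> complex) \<Rightarrow> nat \<times> ('i + 'j) \<Rightarrow> complex" where
  "slot_mult h = op_bigdsum (\<lambda>_. fib_mult h)"

lemma slot_mult_simps [simp]: "slot_mult h x (k, Inl i) = h i * x (k, Inl i)" "slot_mult h x (k, Inr j) = 0"
  by (auto simp: slot_mult_def op_bigdsum_apply)

lemma bounded_by_slot_mult: "(\<And>i. norm (h i) \<le> 1) \<Longrightarrow> bounded_by 1 (slot_mult h)"
  unfolding slot_mult_def by (intro bounded_by_bigdsum bounded_by_fib_mult) auto

text \<open>Let H be the multiplication, w the difference of the permuted copies of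
  \<open>x\<close>, and z the same difference for the image of \<open>x\<close> under the sum of the
  \<open>B k\<close>. Then A H w - H z = [A, H] w + H (A w - z). The bracket costs
  \<open>2 * e1\<close> since w has norm at most twice that of \<open>x\<close>. In A w - z the two
  intertwining defects are subtracted: their small parts cost \<open>2 * e2\<close>, and H sees
  their compact parts only beyond \<open>N\<close>, at cost \<open>e3\<close>.\<close>

lemma increment_bound:
  fixes A B :: "nat \<Rightarrow> (nat + 'j \<Rightarrow> complex) \<Rightarrow> nat + 'j \<Rightarrow> complex"
  assumes A: "\<And>k. bounded_by CA (A k)" "0 \<le> CA" and B: "\<And>k. bounded_by CB (B k)" "0 \<le> CB"
    and \<sigma>: "bij \<sigma>" "bij \<sigma>'" and D: "\<And>k. k \<notin> D \<Longrightarrow> \<sigma> k = k" "\<And>k. k \<notin> D \<Longrightarrow> \<sigma>' k = k"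
    and comm: "\<And>k. k \<in> D \<Longrightarrow> bounded_by e1 (\<lambda>y j. A k (fib_mult h y) j - fib_mult h (A k y) j)" and e1: "0 \<le> e1"
    and K: "compact_op p K" "compact_op p K'"
    and Y: "bounded_by e2 (\<lambda>x c. (op_bigdsum A (perm_op \<sigma> x) c - perm_op \<sigma> (op_bigdsum B x) c) - K x c)"
      "bounded_by e2 (\<lambda>x c. (op_bigdsum A (perm_op \<sigma>' x) c - perm_op \<sigma>' (op_bigdsum B x) c) - K' x c)"
    and h: "\<And>i. norm (h i) \<le> 1" "\<And>i. i < N \<Longrightarrow> h i = 0"
    and KK: "\<And>x. x \<in> lp p \<Longrightarrow> lp_norm p (restr {c. snd c \<in> Inl ` {N..}} (\<lambda>c. K' x c - K x c)) \<le> e3 * lp_norm p x"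
    and x: "x \<in> lp p"
  shows "lp_norm p (\<lambda>c. op_bigdsum A (slot_mult h (\<lambda>c. perm_op \<sigma>' x c - perm_op \<sigma> x c)) c
      - slot_mult h (\<lambda>c. perm_op \<sigma>' (op_bigdsum B x) c - perm_op \<sigma> (op_bigdsum B x) c) c)
    \<le> (2 * e1 + 2 * e2 + e3) * lp_norm p x"
proof -
  define w where "w = (\<lambda>c. perm_op \<sigma>' x c - perm_op \<sigma> x c)"
  have bA: "bounded_by CA (op_bigdsum A)" and bB: "bounded_by CB (op_bigdsum B)"
    using bounded_by_bigdsum[of CA A, OF A] bounded_by_bigdsum[of CB B, OF B] .
  note bH = bounded_by_slot_mult[of h, OF h(1)]
  have px: "perm_op \<sigma>' x \<in> lp p" "perm_op \<sigma> x \<in> lp p"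
    using bounded_byD(1)[OF bounded_by_perm_op x] \<sigma> by auto
  have w: "w \<in> lp p" "lp_norm p w \<le> 2 * lp_norm p x"
    unfolding w_def using lp_diff[OF px] bounded_byD(2)[OF bounded_by_perm_op[OF \<sigma>(1)] x]
      bounded_byD(2)[OF bounded_by_perm_op[OF \<sigma>(2)] x] by auto
  \<comment> \<open>Slots outside \<open>D\<close> are fixed by both permutations, so only the
    commutators in \<open>D\<close> have to be small.\<close>
  have w0: "w (k, j) = 0" if "k \<notin> D" for k j
  proof -
    have "inv \<sigma> k = k" "inv \<sigma>' k = k"
      using D[OF that] \<sigma> by (metis bij_inv_eq_iff)+
    then show ?thesis
      by (cases j) (simp_all add: w_def)
  qed
  define G where "G k = (if k \<in> D then (\<lambda>y j. A k (fib_mult h y) j - fib_mult h (A k y) j) else (\<lambda>y j. 0))" for k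
  have G: "bounded_by e1 (G k)" for k
  proof (cases "k \<in> D")
    case True
    then show ?thesis
      using comm by (simp add: G_def)
  next
    case False
    then have "G k = (\<lambda>y j. 0)"
      by (simp add: G_def)
    then show ?thesis
      by (simp only: bounded_by_mono[OF bounded_by_zero e1])
  qed
  have bG: "bounded_by e1 (op_bigdsum G)"
    by (rule bounded_by_bigdsum[OF G e1])
  have Geq: "op_bigdsum A (slot_mult h w) c - slot_mult h (op_bigdsum A w) c = op_bigdsum G w c" for c
  proof -
    obtain k j where c: "c = (k, j)"
      by (cases c)
    have s: "(\<lambda>j. slot_mult h w (k, j)) = fib_mult h (\<lambda>j. w (k, j))"
      by (simp add: slot_mult_def op_bigdsum_apply)
    have f0: "fib_mult h (\<lambda>_. 0 :: complex) = (\<lambda>_ :: nat + 'j. 0)"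
      by (auto simp: fib_mult_def fun_eq_iff split: sum.splits)
    have "slot_mult h (op_bigdsum A w) (k, j) = fib_mult h (A k (\<lambda>j. w (k, j))) j"
      by (simp add: slot_mult_def op_bigdsum_apply)
    then show ?thesis
      unfolding c op_bigdsum_apply s
      by (cases "k \<in> D") (auto simp: G_def w0 f0 bounded_by_zero_vec[OF A(1)])
  qed
  define E where "E x c = (op_bigdsum A (perm_op \<sigma> x) c - perm_op \<sigma> (op_bigdsum B x) c) - K x c" for x c
  define E' where "E' x c = (op_bigdsum A (perm_op \<sigma>' x) c - perm_op \<sigma>' (op_bigdsum B x) c) - K' x c" for x c
  have EE: "bounded_by e2 E" "bounded_by e2 E'"
    using Y unfolding E_def[abs_def] E'_def[abs_def] .
  define z where "z = (\<lambda>c. perm_op \<sigma>' (op_bigdsum B x) c - perm_op \<sigma> (op_bigdsum B x) c)"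
  have zl: "z \<in> lp p"
    unfolding z_def using bounded_byD(1)[OF bounded_by_perm_op bounded_byD(1)[OF bB x]] \<sigma> by (intro lp_diff) auto
  have Aw: "op_bigdsum A w \<in> lp p"
    by (rule bounded_byD(1)[OF bA w(1)])
  let ?d = "\<lambda>c. op_bigdsum A w c - z c"
  have dl: "?d \<in> lp p"
    by (rule lp_diff(1)[OF Aw zl])
  have deq: "?d = (\<lambda>c. (K' x c - K x c) + (E' x c - E x c))"
    unfolding w_def z_def bounded_by_diff[OF bA px] E_def E'_def by (auto simp: fun_eq_iff)
  have Kl: "(\<lambda>c. K' x c - K x c) \<in> lp p"
    using bounded_opD_lp[OF compact_op_bounded[OF K(1)] x] bounded_opD_lp[OF compact_op_bounded[OF K(2)] x]
    by (intro lp_diff)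
  have El: "(\<lambda>c. E' x c - E x c) \<in> lp p" "lp_norm p (\<lambda>c. E' x c - E x c) \<le> 2 * e2 * lp_norm p x"
    using lp_diff[OF bounded_byD(1)[OF EE(2) x] bounded_byD(1)[OF EE(1) x]]
      bounded_byD(2)[OF EE(2) x] bounded_byD(2)[OF EE(1) x] by auto
  let ?S = "{c :: nat \<times> (nat + 'j). snd c \<in> Inl ` {N..}}"
  have Hd: "slot_mult h ?d = slot_mult h (\<lambda>c. restr ?S (\<lambda>c. K' x c - K x c) c + (E' x c - E x c))"
  proof
    fix c :: "nat \<times> (nat + 'j)"
    obtain k j where c: "c = (k, j)"
      by (cases c)
    show "slot_mult h ?d c = slot_mult h (\<lambda>c. restr ?S (\<lambda>c. K' x c - K x c) c + (E' x c - E x c)) c"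
      unfolding deq c using h(2) by (cases j) (auto simp: restr_def inj_image_mem_iff not_le)
  qed
  have "lp_norm p (slot_mult h ?d) \<le> lp_norm p (\<lambda>c. restr ?S (\<lambda>c. K' x c - K x c) c + (E' x c - E x c))"
    unfolding Hd using bounded_byD(2)[OF bH lp_minkowski(1)[OF restr_lp[OF Kl, of ?S] El(1)]] by simp
  also have "\<dots> \<le> e3 * lp_norm p x + 2 * e2 * lp_norm p x"
    using lp_minkowski(2)[OF restr_lp[OF Kl, of ?S] El(1)] KK[OF x] El(2) by linarith
  finally have 1: "lp_norm p (slot_mult h ?d) \<le> (2 * e2 + e3) * lp_norm p x"
    by (simp add: distrib_right)
  have "lp_norm p (op_bigdsum G w) \<le> e1 * lp_norm p w"
    by (rule bounded_byD(2)[OF bG w(1)])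
  also have "\<dots> \<le> e1 * (2 * lp_norm p x)"
    by (rule mult_left_mono[OF w(2) e1])
  finally have 2: "lp_norm p (op_bigdsum G w) \<le> 2 * e1 * lp_norm p x"
    by simp
  have "op_bigdsum A (slot_mult h w) c - slot_mult h z c = op_bigdsum G w c + slot_mult h ?d c" for c
    using Geq[of c] unfolding bounded_by_diff[OF bH Aw zl] by (simp add: algebra_simps)
  then have "(\<lambda>c. op_bigdsum A (slot_mult h w) c - slot_mult h z c) = (\<lambda>c. op_bigdsum G w c + slot_mult h ?d c)"
    by blast
  then have "lp_norm p (\<lambda>c. op_bigdsum A (slot_mult h w) c - slot_mult h z c)
      \<le> (2 * e1 + 2 * e2 + e3) * lp_norm p x"
    using lp_minkowski(2)[OF bounded_byD(1)[OF bG w(1)] bounded_byD(1)[OF bH dl]] 1 2 by (simp add: distrib_right)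
  then show ?thesis
    unfolding w_def z_def .
qed

end

section \<open>The operator that interpolates between the permutations\<close>

locale interpolation = lp_exponent +
  fixes \<sigma> \<tau> :: "nat \<Rightarrow> nat \<Rightarrow> nat" and h :: "nat \<Rightarrow> nat \<Rightarrow> complex" and N :: "nat \<Rightarrow> nat"
  assumes bij_sigma: "bij (\<sigma> m)" and finite_support: "finite {k. \<sigma> m k \<noteq> k}"
    and sigma_Suc: "\<sigma> (Suc m) k = \<tau> m (\<sigma> m k)" and tau_tau: "\<tau> m (\<tau> m k) = k"
    and strict_mono_N: "strict_mono N"
    and h_below: "i < N m \<Longrightarrow> h m i = 0" and h_above: "N (Suc m) \<le> i \<Longrightarrow> h m i = 1"
    and h_circle: "norm (1 - 2 * h m i) = 1"
begin

text \<open>Coordinates below \<open>N 0\<close> also get stage 0; there \<open>h 0\<close>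
  vanishes, so they are governed by \<open>\<sigma> 0\<close> alone.\<close>

definition stage :: "nat \<Rightarrow> nat" where
  "stage i = (LEAST m. i < N (Suc m))"

lemma less_N_stage: "i < N (Suc (stage i))"
  unfolding stage_def by (rule LeastI[of _ i]) (use seq_suble[OF strict_mono_N, of "Suc i"] in simp)

lemma stage_le: "i < N (Suc m) \<Longrightarrow> stage i \<le> m"
  unfolding stage_def by (rule Least_le)

lemma N_mono: "m \<le> n \<Longrightarrow> N m \<le> N n"
  using strict_mono_N by (simp add: strict_mono_less_eq)

lemma stage_eq:
  assumes "N m \<le> i" "i < N (Suc m)" shows "stage i = m"
proof (rule antisym[OF stage_le[OF assms(2)]])
  have "N m < N (Suc (stage i))"
    using less_N_stage[of i] assms(1) by simp
  then show "m \<le> stage i"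
    using strict_mono_N by (simp add: strict_mono_less)
qed

lemma inv_sigma: "\<sigma> m (inv (\<sigma> m) k) = k" "inv (\<sigma> m) (\<sigma> m k) = k"
  using bij_sigma[of m] by (simp_all add: bij_is_surj surj_f_inv_f bij_is_inj)

lemma inv_sigma_tau: "inv (\<sigma> m) (\<tau> m k) = inv (\<sigma> (Suc m)) k"
proof -
  have "\<sigma> (Suc m) (inv (\<sigma> m) (\<tau> m k)) = k"
    by (simp add: sigma_Suc inv_sigma tau_tau)
  then show ?thesis
    using inv_sigma(2)[of "Suc m" "inv (\<sigma> m) (\<tau> m k)"] by simp
qed

definition weight :: "nat \<times> (nat + 'j) \<Rightarrow> complex" where
  "weight c = (case snd c of Inl i \<Rightarrow> h (stage i) i | Inr _ \<Rightarrow> 0)"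

definition twist :: "nat \<times> (nat + 'j) \<Rightarrow> nat \<times> (nat + 'j)" where
  "twist c = (case snd c of Inl i \<Rightarrow> (\<tau> (stage i) (fst c), Inl i) | Inr _ \<Rightarrow> c)"

definition shift :: "nat \<times> (nat + 'j) \<Rightarrow> nat \<times> (nat + 'j)" where
  "shift c = (case snd c of Inl i \<Rightarrow> (\<sigma> (stage i) (fst c), Inl i) | Inr _ \<Rightarrow> c)"

definition unshift :: "nat \<times> (nat + 'j) \<Rightarrow> nat \<times> (nat + 'j)" where
  "unshift c = (case snd c of Inl i \<Rightarrow> (inv (\<sigma> (stage i)) (fst c), Inl i) | Inr _ \<Rightarrow> c)"

lemma twist_twist: "twist (twist c) = c" and weight_twist: "weight (twist c) = weight c"
  and shift_unshift: "shift (unshift c) = c" and unshift_shift: "unshift (shift c) = c"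
  and weight_circle: "norm (1 - 2 * weight c) = 1"
  by (cases c; auto simp: twist_def weight_def shift_def unshift_def tau_tau inv_sigma h_circle split: sum.splits)+

lemma inj_twist: "inj twist" and inj_shift: "inj shift" and inj_unshift: "inj unshift"
  by (metis injI twist_twist, metis injI unshift_shift, metis injI shift_unshift)

text \<open>The permutation of the current stage is followed by the path towards
  \<open>\<tau>\<close>, which leads to the next stage; \<open>V\<close> undoes the two steps in
  reverse order, with conjugate weights.\<close>

definition U :: "(nat \<times> (nat + 'j) \<Rightarrow> complex) \<Rightarrow> nat \<times> (nat + 'j) \<Rightarrow> complex" where
  "U x = mix weight twist (\<lambda>c. x (unshift c))"

definition V :: "(nat \<times> (nat + 'j) \<Rightarrow> complex) \<Rightarrow> nat \<times> (nat + 'j) \<Rightarrow> complex" where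
  "V y = (\<lambda>c. mix (\<lambda>c. cnj (weight c)) twist y (shift c))"

lemma bounded_by_U: "bounded_by 2 U"
  using bounded_by_comp[OF bounded_by_mix[OF weight_circle inj_twist] bounded_by_reindex[OF inj_unshift]]
  by (simp add: U_def[abs_def])

lemma bounded_by_V: "bounded_by 2 V"
proof -
  have "norm (1 - 2 * cnj (weight c)) = 1" for c :: "nat \<times> (nat + 'j)"
  proof -
    have "1 - 2 * cnj (weight c) = cnj (1 - 2 * weight c)"
      by simp
    then show ?thesis
      by (simp only: complex_mod_cnj weight_circle)
  qed
  from bounded_by_comp[OF bounded_by_reindex[OF inj_shift] bounded_by_mix[OF this inj_twist]] show ?thesis
    by (simp add: V_def[abs_def])
qed

lemma V_U: "V (U x) = x"
  unfolding V_def U_def by (simp add: mix_inverse[of weight twist, OF weight_circle weight_twist twist_twist] unshift_shift)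

lemma U_V: "U (V y) = y"
  unfolding V_def U_def by (simp add: mix_inverse[of weight twist, OF weight_circle weight_twist twist_twist] shift_unshift)

lemma U_isometric:
  fixes x :: "nat \<times> (nat + 'j) \<Rightarrow> complex"
  assumes "p = 2" "x \<in> lp p" shows "lp_norm p (U x) = lp_norm p x"
proof -
  have l: "(\<lambda>c. x (unshift c)) \<in> lp p" "lp_norm p (\<lambda>c. x (unshift c)) \<le> lp_norm p x"
    using bounded_byD[OF bounded_by_reindex[OF inj_unshift] assms(2)] by auto
  have "lp_norm p (\<lambda>c. x (unshift (shift c))) \<le> lp_norm p (\<lambda>c. x (unshift c))"
    using bounded_byD(2)[OF bounded_by_reindex[OF inj_shift] l(1)] by simp
  then show ?thesis
    using l mix_isometric[OF assms(1), of weight twist, OF weight_circle weight_twist twist_twist l(1)]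
    by (simp add: U_def unshift_shift)
qed

lemma U_apply:
  "U x (k, Inl i) = (1 - h (stage i) i) * perm_op (\<sigma> (stage i)) x (k, Inl i)
     + h (stage i) i * perm_op (\<sigma> (Suc (stage i))) x (k, Inl i)"
  "U x (k, Inr j) = x (k, Inr j)"
  by (simp_all add: U_def mix_def weight_def twist_def unshift_def inv_sigma_tau)

text \<open>\<open>U\<close> with the interpolation stopped at stage \<open>m\<close>. In this form
  it is a permutation up to a compact operator, and consecutive operators differ by a single
  increment.\<close>

definition U_upto :: "nat \<Rightarrow> (nat \<times> (nat + 'j) \<Rightarrow> complex) \<Rightarrow> nat \<times> (nat + 'j) \<Rightarrow> complex" where
  "U_upto m x = (\<lambda>c. if snd c \<in> Inl ` {..<N m} then U x c else perm_op (\<sigma> m) x c)"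

lemma U_upto_apply:
  "U_upto m x (k, Inl i) = (if i < N m then U x (k, Inl i) else perm_op (\<sigma> m) x (k, Inl i))"
  "U_upto m x (k, Inr j) = x (k, Inr j)"
  by (auto simp: U_upto_def inj_image_mem_iff)

text \<open>Below \<open>N m\<close> nothing changes, and from \<open>N (Suc m)\<close> on the
  weight \<open>h m\<close> is 1; in between the stage is \<open>m\<close>, and \<open>U\<close> is
  the mixture of the two permutations with weight \<open>h m\<close>.\<close>

lemma U_upto_Suc:
  "U_upto (Suc m) x c - U_upto m x c = slot_mult (h m) (\<lambda>c. perm_op (\<sigma> (Suc m)) x c - perm_op (\<sigma> m) x c) c"
proof -
  obtain k j where c: "c = (k, j)"
    by (cases c)
  show ?thesis
  proof (cases j)
    case (Inl i)
    have "N m < N (Suc m)"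
      using strict_mono_N by (simp add: strict_mono_less)
    then consider "i < N m" "i < N (Suc m)" | "N m \<le> i" "i < N (Suc m)" | "N (Suc m) \<le> i" "\<not> i < N m"
      by linarith
    then show ?thesis
    proof cases
      case 2
      then have "stage i = m"
        by (rule stage_eq)
      with 2 show ?thesis
        by (simp add: c Inl U_upto_apply U_apply algebra_simps)
    qed (auto simp: c Inl U_upto_apply h_below h_above)
  qed (simp add: c U_upto_apply)
qed

lemma inv_sigma_fix: "\<sigma> m k = k \<Longrightarrow> inv (\<sigma> m) k = k"
  using inv_sigma(2)[of m k] by simp

text \<open>The difference can be nonzero only at the finitely many coordinates below
  \<open>N m\<close> in slots moved by one of the permutations met so far.\<close>

lemma compact_op_U_upto_diff:
  "compact_op p (\<lambda>(x :: nat \<times> (nat + 'j) \<Rightarrow> complex) c. U_upto m x c - perm_op (\<sigma> m) x c)"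
proof -
  \<comment> \<open>Coordinates below \<open>N m\<close> have stage at most \<open>m\<close>, and
    \<open>U\<close> also involves the permutation of the next stage, hence
    \<open>Suc m\<close>.\<close>
  define D where "D = (\<Union>j\<le>Suc m. {k. \<sigma> j k \<noteq> k})"
  have finD: "finite D"
    unfolding D_def using finite_support by auto
  define F where "F = D \<times> (Inl ` {..<N m} :: (nat + 'j) set)"
  have "finite F"
    using finD by (simp add: F_def)
  have eq: "restr F (\<lambda>c. U x c - perm_op (\<sigma> m) x c) = (\<lambda>c. U_upto m x c - perm_op (\<sigma> m) x c)"
    for x :: "nat \<times> (nat + 'j) \<Rightarrow> complex"
  proof
    fix c :: "nat \<times> (nat + 'j)"
    obtain k j where c: "c = (k, j)"
      by (cases c)
    show "restr F (\<lambda>c. U x c - perm_op (\<sigma> m) x c) c = U_upto m x c - perm_op (\<sigma> m) x c"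
    proof (cases j)
      case (Inl i)
      show ?thesis
      proof (cases "k \<in> D \<or> \<not> i < N m")
        case True
        then show ?thesis
          by (auto simp: c Inl restr_def F_def U_upto_apply inj_image_mem_iff)
      next
        case False
        then have "i < N (Suc m)"
          using N_mono[of m "Suc m"] by simp
        then have "stage i \<le> m"
          by (rule stage_le)
        moreover have "inv (\<sigma> j) k = k" if "j \<le> Suc m" for j
          using False that by (intro inv_sigma_fix) (auto simp: D_def)
        ultimately show ?thesis
          using False by (simp add: c Inl restr_def F_def U_upto_apply U_apply algebra_simps)
      qed
    qed (auto simp: c restr_def U_upto_apply U_apply F_def)
  qed
  have "compact_op p (restr F)"
    unfolding restr_def using \<open>finite F\<close> by (rule compact_op_restrict_finite)
  moreover have "bounded_op p (\<lambda>(x :: nat \<times> (nat + 'j) \<Rightarrow> complex) c. U x c - perm_op (\<sigma> m) x c)"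
    by (rule bounded_op_diff[OF bounded_byI_op[OF bounded_by_U] bounded_byI_op[OF bounded_by_perm_op[OF bij_sigma]]])
  ultimately have "compact_op p (\<lambda>x. restr F (\<lambda>c. U x c - perm_op (\<sigma> m) x c))"
    by (rule compact_op_comp_right)
  then show ?thesis
    by (simp only: eq)
qed

text \<open>The difference reads and writes only coordinates from \<open>N m\<close> on, so it is
  governed by the tail of \<open>x\<close>. The threshold depends on \<open>x\<close>: this is
  convergence for each vector, not in norm.\<close>

lemma U_upto_converges:
  fixes x :: "nat \<times> (nat + 'j) \<Rightarrow> complex"
  assumes x: "x \<in> lp p" and e: "e > 0"
  shows "\<exists>m0. \<forall>m\<ge>m0. lp_norm p (\<lambda>c. U x c - U_upto m x c) < e"
proof -
  define T where "T m = {c :: nat \<times> (nat + 'j). snd c \<in> Inl ` {N m..}}" for m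
  have b: "bounded_by 3 (\<lambda>(x :: nat \<times> (nat + 'j) \<Rightarrow> complex) c. U x c - perm_op (\<sigma> m) x c)" for m
    using bounded_by_diff2[OF bounded_by_U bounded_by_perm_op[OF bij_sigma[of m]]] by simp
  have e3: "e / 3 > 0"
    using e by simp
  obtain F where F: "finite F" "\<And>A. A \<inter> F = {} \<Longrightarrow> lp_norm p (restr A x) < e / 3"
    using lp_tail[OF x e3] unfolding restr_def by blast
  have "finite {i. \<exists>k. (k, Inl i) \<in> F}"
    using F(1) by (rule finite_surj[where f = "\<lambda>c. projl (snd c)"]) force
  then obtain m0 where m0: "\<And>i k. (k, Inl i) \<in> F \<Longrightarrow> i < m0"
    using finite_nat_bounded[of "{i. \<exists>k. (k, Inl i) \<in> F}"] by blast
  have "lp_norm p (\<lambda>c. U x c - U_upto m x c) < e" if "m \<ge> m0" for m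
  proof -
    have "m0 \<le> N m"
      using that seq_suble[OF strict_mono_N, of m] by simp
    then have "T m \<inter> F = {}"
      using m0 by (fastforce simp: T_def)
    then have tail: "lp_norm p (restr (T m) x) < e / 3"
      by (rule F(2))
    have "(\<lambda>c. U x c - U_upto m x c) = restr (T m) (\<lambda>c. U (restr (T m) x) c - perm_op (\<sigma> m) (restr (T m) x) c)"
    proof
      fix c :: "nat \<times> (nat + 'j)"
      obtain k j where c: "c = (k, j)"
        by (cases c)
      show "U x c - U_upto m x c = restr (T m) (\<lambda>c. U (restr (T m) x) c - perm_op (\<sigma> m) (restr (T m) x) c) c"
        by (cases j) (auto simp: c U_upto_apply U_apply restr_def T_def inj_image_mem_iff)
    qed
    moreover have l: "(\<lambda>c. U (restr (T m) x) c - perm_op (\<sigma> m) (restr (T m) x) c) \<in> lp p"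
      by (rule bounded_byD(1)[OF b restr_lp[OF x]])
    ultimately have "lp_norm p (\<lambda>c. U x c - U_upto m x c)
        \<le> lp_norm p (\<lambda>c. U (restr (T m) x) c - perm_op (\<sigma> m) (restr (T m) x) c)"
      using lp_norm_restr_le[OF l, of "T m"] by simp
    also have "\<dots> \<le> 3 * lp_norm p (restr (T m) x)"
      by (rule bounded_byD(2)[OF b restr_lp[OF x]])
    finally show ?thesis
      using tail by simp
  qed
  then show ?thesis
    by blast
qed

text \<open>The intertwining defect of \<open>U_upto m\<close> is within \<open>(1/2) ^ m\<close> of
  a compact operator, and consecutive defects differ by at most \<open>C * (1/2) ^ m\<close>.
  Summing the geometric tail puts the defect of \<open>U\<close> within
  \<open>(2 * C + 1) * (1/2) ^ m\<close> of a compact operator. What happens before stage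
  \<open>m0\<close> is absorbed by the compact difference between \<open>U_upto m\<close> and the
  permutation.\<close>

lemma compact_intertwiner:
  fixes RA RB :: "(nat \<times> (nat + 'j) \<Rightarrow> complex) \<Rightarrow> nat \<times> (nat + 'j) \<Rightarrow> complex"
  assumes RA: "bounded_op p RA" and RB: "bounded_op p RB" and C: "0 \<le> C"
    and Y: "\<And>m. m \<ge> m0 \<Longrightarrow> \<exists>K. compact_op p K \<and>
      bounded_by ((1/2) ^ m) (\<lambda>x c. (RA (perm_op (\<sigma> m) x) c - perm_op (\<sigma> m) (RB x) c) - K x c)"
    and incr: "\<And>m x. m \<ge> m0 \<Longrightarrow> x \<in> lp p \<Longrightarrow>
      lp_norm p (\<lambda>c. RA (slot_mult (h m) (\<lambda>c. perm_op (\<sigma> (Suc m)) x c - perm_op (\<sigma> m) x c)) c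
        - slot_mult (h m) (\<lambda>c. perm_op (\<sigma> (Suc m)) (RB x) c - perm_op (\<sigma> m) (RB x) c) c)
      \<le> C * (1/2) ^ m * lp_norm p x"
  shows "compact_op p (\<lambda>x c. RA (U x) c - U (RB x) c)"
proof (rule compact_op_closed)
  obtain CA where CA: "0 \<le> CA" "bounded_by CA RA"
    using RA by (rule bounded_opD)
  note Uop = bounded_byI_op[OF bounded_by_U]
  note perm_bop = bounded_byI_op[OF bounded_by_perm_op[OF bij_sigma]]
  show bX: "bounded_op p (\<lambda>x c. RA (U x) c - U (RB x) c)"
    by (rule bounded_op_diff[OF bounded_op_comp[OF RA Uop] bounded_op_comp[OF Uop RB]])
  have bUm: "bounded_op p (U_upto m :: (nat \<times> (nat + 'j) \<Rightarrow> complex) \<Rightarrow> _)" for m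
  proof -
    have "bounded_op p (\<lambda>(x :: nat \<times> (nat + 'j) \<Rightarrow> complex) c. (U_upto m x c - perm_op (\<sigma> m) x c) + perm_op (\<sigma> m) x c)"
      by (rule bounded_op_add[OF compact_op_bounded[OF compact_op_U_upto_diff] perm_bop])
    then show ?thesis
      by simp
  qed
  define X where "X m x c = RA (U_upto m x) c - U_upto m (RB x) c" for m x c
  have bXm: "bounded_op p (X m)" for m
    unfolding X_def[abs_def] by (rule bounded_op_diff[OF bounded_op_comp[OF RA bUm] bounded_op_comp[OF bUm RB]])
  have step: "lp_norm p (\<lambda>c. X (Suc m) x c - X m x c) \<le> C * (1/2) ^ m * lp_norm p x"
    if m: "m \<ge> m0" and x: "x \<in> lp p" for m x
  proof -
    have "slot_mult (h m) (\<lambda>c. perm_op (\<sigma> (Suc m)) x c - perm_op (\<sigma> m) x c) = (\<lambda>c. U_upto (Suc m) x c - U_upto m x c)"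
      by (simp add: U_upto_Suc)
    then have "RA (slot_mult (h m) (\<lambda>c. perm_op (\<sigma> (Suc m)) x c - perm_op (\<sigma> m) x c)) =
        (\<lambda>c. RA (U_upto (Suc m) x) c - RA (U_upto m x) c)"
      using bounded_by_diff[OF CA(2) bounded_opD_lp[OF bUm x] bounded_opD_lp[OF bUm x]] by simp
    then have "(\<lambda>c. X (Suc m) x c - X m x c) =
       (\<lambda>c. RA (slot_mult (h m) (\<lambda>c. perm_op (\<sigma> (Suc m)) x c - perm_op (\<sigma> m) x c)) c
        - slot_mult (h m) (\<lambda>c. perm_op (\<sigma> (Suc m)) (RB x) c - perm_op (\<sigma> m) (RB x) c) c)"
      by (simp add: X_def fun_eq_iff U_upto_Suc[symmetric])
    with incr[OF m x] show ?thesis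
      by simp
  qed
  \<comment> \<open>The bound keeps the exact partial sum of the geometric series, so that the
    induction closes.\<close>
  have tele: "lp_norm p (\<lambda>c. X (m + n) x c - X m x c) \<le> 2 * C * ((1/2) ^ m - (1/2) ^ (m + n)) * lp_norm p x"
    if m: "m \<ge> m0" and x: "x \<in> lp p" for m n x
  proof (induction n)
    case (Suc n)
    have "lp_norm p (\<lambda>c. X (m + Suc n) x c - X m x c) \<le>
        lp_norm p (\<lambda>c. X (Suc (m + n)) x c - X (m + n) x c) + lp_norm p (\<lambda>c. X (m + n) x c - X m x c)"
      using lp_norm_diff_triangle[OF bounded_opD_lp[OF bXm x] bounded_opD_lp[OF bXm x] bounded_opD_lp[OF bXm x]] by simp
    also have "\<dots> \<le> C * (1/2) ^ (m + n) * lp_norm p x + 2 * C * ((1/2) ^ m - (1/2) ^ (m + n)) * lp_norm p x"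
      using step[of "m + n", OF _ x] m Suc by simp
    also have "\<dots> = 2 * C * ((1/2) ^ m - (1/2) ^ (m + Suc n)) * lp_norm p x"
      by (simp add: algebra_simps)
    finally show ?case .
  qed (simp add: lp_norm_def)
  fix e :: real assume e: "e > 0"
  have "0 < e / (2 * C + 1)"
    using e C by simp
  then obtain m1 where m1: "(1/2) ^ m1 < e / (2 * C + 1)"
    using real_arch_pow_inv[of "e / (2 * C + 1)" "1/2"] by auto
  define m where "m = max m0 m1"
  have "(1/2 :: real) ^ m \<le> (1/2) ^ m1"
    by (intro power_decreasing) (auto simp: m_def)
  then have "(2 * C + 1) * (1/2) ^ m \<le> (2 * C + 1) * (1/2) ^ m1"
    using C by (intro mult_left_mono) auto
  also have "\<dots> \<le> e"
    using m1 C by (simp add: pos_less_divide_eq mult.commute)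
  finally have m: "m \<ge> m0" "(2 * C + 1) * (1/2) ^ m \<le> e"
    by (auto simp: m_def)
  obtain K where K: "compact_op p K"
    "bounded_by ((1/2) ^ m) (\<lambda>x c. (RA (perm_op (\<sigma> m) x) c - perm_op (\<sigma> m) (RB x) c) - K x c)"
    using Y[OF m(1)] by blast
  define F where "F x c = U_upto m x c - perm_op (\<sigma> m) x c" for x :: "nat \<times> (nat + 'j) \<Rightarrow> complex" and c
  have F: "compact_op p F"
    unfolding F_def[abs_def] by (rule compact_op_U_upto_diff)
  define K' where "K' x c = K x c + (RA (F x) c - F (RB x) c)" for x c
  have K': "compact_op p K'"
    unfolding K'_def[abs_def]
    by (rule compact_op_add[OF K(1) compact_op_diff[OF compact_op_comp_left[OF RA F] compact_op_comp_right[OF F RB]]])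
  have XK: "lp_norm p (\<lambda>c. X m x c - K' x c) \<le> (1/2) ^ m * lp_norm p x" if x: "x \<in> lp p" for x
  proof -
    have "RA (F x) = (\<lambda>c. RA (U_upto m x) c - RA (perm_op (\<sigma> m) x) c)"
      unfolding F_def by (rule bounded_by_diff[OF CA(2) bounded_opD_lp[OF bUm x] bounded_opD_lp[OF perm_bop x]])
    then have "(\<lambda>c. X m x c - K' x c) = (\<lambda>c. (RA (perm_op (\<sigma> m) x) c - perm_op (\<sigma> m) (RB x) c) - K x c)"
      by (simp add: X_def K'_def F_def fun_eq_iff)
    with bounded_byD(2)[OF K(2) x] show ?thesis
      by simp
  qed
  have "lp_norm p (\<lambda>c. (RA (U x) c - U (RB x) c) - K' x c) \<le> e * lp_norm p x" if x: "x \<in> lp p" for x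
  proof (rule field_le_epsilon)
    \<comment> \<open>\<open>U_upto n\<close> converges to \<open>U\<close> only vector by vector,
      so the index at which to compare depends on \<open>x\<close>; the additional \<open>d\<close>
      absorbs this.\<close>
    fix d :: real assume d: "d > 0"
    have d1: "d / (2 * (CA + 1)) > 0" and d2: "d / 2 > 0"
      using d CA(1) by auto
    have RBx: "RB x \<in> lp p"
      by (rule bounded_opD_lp[OF RB x])
    obtain n1 where n1: "\<And>n. n \<ge> n1 \<Longrightarrow> lp_norm p (\<lambda>c. U x c - U_upto n x c) < d / (2 * (CA + 1))"
      using U_upto_converges[OF x d1] by blast
    obtain n2 where n2: "\<And>n. n \<ge> n2 \<Longrightarrow> lp_norm p (\<lambda>c. U (RB x) c - U_upto n (RB x) c) < d / 2"
      using U_upto_converges[OF RBx d2] by blast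
    define M where "M = m + (n1 + n2)"
    have l: "U x \<in> lp p" "U_upto M x \<in> lp p" "U (RB x) \<in> lp p" "U_upto M (RB x) \<in> lp p"
      using bounded_opD_lp[OF Uop] bounded_opD_lp[OF bUm] x RBx by auto
    have Rl: "(\<lambda>c. RA (U x) c - RA (U_upto M x) c) \<in> lp p" "(\<lambda>c. U (RB x) c - U_upto M (RB x) c) \<in> lp p"
      using l bounded_opD_lp[OF RA] by (auto intro: lp_diff)
    have "lp_norm p (\<lambda>c. RA (U x) c - RA (U_upto M x) c) \<le> CA * lp_norm p (\<lambda>c. U x c - U_upto M x c)"
      using bounded_byD(2)[OF CA(2) lp_diff(1)[OF l(1,2)]] bounded_by_diff[OF CA(2) l(1,2)] by simp
    also have "\<dots> \<le> (CA + 1) * (d / (2 * (CA + 1)))"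
      using CA(1) n1[of M] by (intro mult_mono) (auto simp: M_def less_imp_le)
    also have "\<dots> = d / 2"
      using CA(1) by (simp add: field_simps)
    finally have a1: "lp_norm p (\<lambda>c. RA (U x) c - RA (U_upto M x) c) \<le> d / 2" .
    have a2: "lp_norm p (\<lambda>c. U (RB x) c - U_upto M (RB x) c) \<le> d / 2"
      using n2[of M] by (simp add: M_def)
    have "(\<lambda>c. (RA (U x) c - U (RB x) c) - X M x c)
        = (\<lambda>c. (RA (U x) c - RA (U_upto M x) c) - (U (RB x) c - U_upto M (RB x) c))"
      by (simp add: X_def fun_eq_iff)
    then have a: "lp_norm p (\<lambda>c. (RA (U x) c - U (RB x) c) - X M x c) \<le> d"
      using lp_diff(2)[OF Rl] a1 a2 by simp
    have "2 * C * ((1/2) ^ m - (1/2) ^ M) * lp_norm p x \<le> 2 * C * (1/2) ^ m * lp_norm p x"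
      using C by (intro mult_right_mono mult_left_mono) auto
    then have b: "lp_norm p (\<lambda>c. X M x c - X m x c) \<le> 2 * C * (1/2) ^ m * lp_norm p x"
      using tele[OF m(1) x, of "n1 + n2"] unfolding M_def by linarith
    have XX: "(\<lambda>c. RA (U x) c - U (RB x) c) \<in> lp p" "X M x \<in> lp p" "X m x \<in> lp p" "K' x \<in> lp p"
      using bounded_opD_lp[OF bX x] bounded_opD_lp[OF bXm x] bounded_opD_lp[OF compact_op_bounded[OF K'] x] by auto
    have "lp_norm p (\<lambda>c. (RA (U x) c - U (RB x) c) - K' x c)
        \<le> d + (2 * C * (1/2) ^ m * lp_norm p x + (1/2) ^ m * lp_norm p x)"
      using lp_norm_diff_triangle[OF XX(1,2,4)] lp_norm_diff_triangle[OF XX(2,3,4)] a b XK[OF x] by linarith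
    also have "2 * C * (1/2) ^ m * lp_norm p x + (1/2) ^ m * lp_norm p x = (2 * C + 1) * (1/2) ^ m * lp_norm p x"
      by (simp add: algebra_simps)
    also have "\<dots> \<le> e * lp_norm p x"
      by (rule mult_right_mono[OF m(2)]) simp
    finally show "lp_norm p (\<lambda>c. (RA (U x) c - U (RB x) c) - K' x c) \<le> e * lp_norm p x + d"
      by simp
  qed
  with K' show "\<exists>K. compact_op p K \<and> (\<forall>x\<in>lp p. lp_norm p (\<lambda>c. (RA (U x) c - U (RB x) c) - K x c) \<le> e * lp_norm p x)"
    by blast
qed

end

section \<open>Refining dyadic chains\<close>

text \<open>The point \<open>u\<close> stands for the parameter \<open>u / n\<close>. One step down
  from 0 leads to \<open>n - 1\<close>, that is, close to the parameter 1, which is what slot 0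
  carries once \<open>\<psi> 1\<close> has been put there.\<close>

definition cyc_pred :: "nat \<Rightarrow> nat \<Rightarrow> nat" where
  "cyc_pred n u = (if u = 0 then n - 1 else u - 1)"

text \<open>The cyclic predecessor of the coarse grid with \<open>n\<close> points, seen on the grid
  refined by the factor \<open>R\<close>, whose coarse points are the multiples of
  \<open>R\<close>.\<close>

definition cyc_step :: "nat \<Rightarrow> nat \<Rightarrow> nat \<Rightarrow> nat" where
  "cyc_step n R u = (if u mod R = 0 then cyc_pred n (u div R) * R else u)"

text \<open>Within each block of length \<open>R\<close> this is the reflection r -> -r modulo
  \<open>R\<close>, and \<open>block_rev\<close> is r -> -1 - r. Their composite is r -> r - 1, a
  cycle written as a product of two reflections as in a dihedral group.\<close>

definition block_neg :: "nat \<Rightarrow> nat \<Rightarrow> nat" where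
  "block_neg R u = u div R * R + (if u mod R = 0 then 0 else R - u mod R)"

definition block_rev :: "nat \<Rightarrow> nat \<Rightarrow> nat" where
  "block_rev R u = u div R * R + (R - 1 - u mod R)"

lemma block_div_mod:
  fixes R :: nat
  assumes "r < R" shows "(q * R + r) div R = q" "(q * R + r) mod R = r"
  using assms by auto

lemma block_neg_block_neg: "0 < R \<Longrightarrow> block_neg R (block_neg R u) = u"
proof -
  assume R: "0 < R"
  show ?thesis
  proof (cases "u mod R = 0")
    case True
    then show ?thesis
      using R by (auto simp: block_neg_def)
  next
    case False
    define r where "r = R - u mod R"
    have r: "r < R" "r \<noteq> 0" "R - r = u mod R"
      using R False mod_less_divisor[OF R, of u] by (auto simp: r_def)
    have "block_neg R u = u div R * R + r"
      using False by (simp add: block_neg_def r_def)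
    then have "block_neg R (block_neg R u) = u div R * R + u mod R"
      using r by (simp add: block_neg_def[of R "_ + _"] block_div_mod)
    then show ?thesis
      by simp
  qed
qed

lemma block_rev_block_rev: "0 < R \<Longrightarrow> block_rev R (block_rev R u) = u"
proof -
  assume R: "0 < R"
  let ?s = "R - 1 - u mod R"
  have "?s < R" "R - 1 - ?s = u mod R"
    using R mod_less_divisor[OF R, of u] by auto
  then show ?thesis
    using block_div_mod[of ?s R "u div R"] by (simp add: block_rev_def)
qed

lemma block_less:
  fixes R :: nat
  assumes "u < n * R" "r < R" shows "u div R * R + r < n * R"
proof -
  have "u div R < n"
    using assms by (simp add: less_mult_imp_div_less)
  then have "(u div R + 1) * R \<le> n * R"
    by (intro mult_le_mono1) simp
  then show ?thesis
    using assms by simp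
qed

lemma block_neg_less: "u < n * R \<Longrightarrow> block_neg R u < n * R"
  using block_less[of u n R "if u mod R = 0 then 0 else R - u mod R"] by (cases "R = 0") (auto simp: block_neg_def)

lemma block_rev_less: "u < n * R \<Longrightarrow> block_rev R u < n * R"
  using block_less[of u n R "R - 1 - u mod R"] by (cases "R = 0") (auto simp: block_rev_def)

lemma cyc_pred_less: "0 < n \<Longrightarrow> u < n \<Longrightarrow> cyc_pred n u < n"
  by (auto simp: cyc_pred_def)

lemma cyc_step_less:
  assumes "u < n * R" shows "cyc_step n R u < n * R"
proof -
  have "u div R < n"
    using assms by (simp add: less_mult_imp_div_less)
  then have "cyc_pred n (u div R) < n"
    by (intro cyc_pred_less) auto
  moreover have "0 < R"
    using assms by (cases R) auto
  ultimately show ?thesis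
    using assms by (auto simp: cyc_step_def)
qed

lemma block_neg_cyc_step:
  assumes "0 < R"
  shows "block_neg R (cyc_step n R u) =
    (if u mod R = 0 then cyc_pred n (u div R) * R else u div R * R + (R - u mod R))"
  using assms by (auto simp: cyc_step_def block_neg_def)

text \<open>The coarse step takes the start of a block to the start of the preceding one, and the
  two reflections take a start to the last point of its block; every other point is moved down by
  one within its block. Together this is the predecessor on the fine grid.\<close>

lemma block_rev_block_neg_cyc_step:
  assumes R: "0 < R" and u: "u < n * R"
  shows "block_rev R (block_neg R (cyc_step n R u)) = cyc_pred (n * R) u"
proof (cases "u mod R = 0")
  case True
  then obtain q where q: "u = q * R"
    by (metis mod_0_imp_dvd dvd_def mult.commute)
  have "block_rev R (block_neg R (cyc_step n R u)) = cyc_pred n q * R + (R - 1)"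
    using R by (simp add: block_neg_cyc_step q block_rev_def)
  also have "\<dots> = cyc_pred (n * R) u"
  proof (cases "q = 0")
    case True
    have "n > 0"
      using u by (cases n) auto
    then have "(n - 1) * R + (R - 1) = n * R - 1"
      using R by (cases n) auto
    then show ?thesis
      using True q by (simp add: cyc_pred_def)
  next
    case False
    then have "(q - 1) * R + (R - 1) = q * R - 1"
      using R by (cases q) auto
    then show ?thesis
      using False q R by (simp add: cyc_pred_def)
  qed
  finally show ?thesis .
next
  case False
  define r where "r = R - u mod R"
  have r: "r < R" "R - 1 - r = u mod R - 1"
    using R False mod_less_divisor[OF R, of u] by (auto simp: r_def)
  have "block_neg R (cyc_step n R u) = u div R * R + r"
    using R False by (simp add: block_neg_cyc_step r_def)
  then have "block_rev R (block_neg R (cyc_step n R u)) = u div R * R + (u mod R - 1)"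
    using r by (simp add: block_rev_def[of R "_ + _"] block_div_mod)
  also have "\<dots> = u - 1"
    using False div_mult_mod_eq[of u R] by linarith
  finally show ?thesis
    using False by (auto simp: cyc_pred_def)
qed

section \<open>Permutations of the slots of dyadic parameters\<close>

locale dyadic_slots =
  fixes v :: "nat \<Rightarrow> real" and enc :: "real \<Rightarrow> nat"
  assumes v_enc: "dyadic t \<Longrightarrow> 0 \<le> t \<Longrightarrow> t \<le> 1 \<Longrightarrow> v (enc t) = t"
    and enc_0: "enc 0 = 0"
begin

definition slot :: "nat \<Rightarrow> nat \<Rightarrow> nat" where
  "slot L u = enc (real u / 2 ^ L)"

text \<open>Transport of a map of grid points to the slots that represent them. The grid stops short
  of the point \<open>2 ^ L\<close>, so the slot that encodes the parameter 1 is never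
  moved.\<close>

definition lift :: "nat \<Rightarrow> (nat \<Rightarrow> nat) \<Rightarrow> nat \<Rightarrow> nat" where
  "lift L g k = (if k \<in> slot L ` {..<2 ^ L} then slot L (g (the_inv_into {..<2 ^ L} (slot L) k)) else k)"

lemma v_0: "v 0 = 0"
  using v_enc[of 0] enc_0 by (auto simp: dyadic_def)

lemma v_slot: "u < 2 ^ L \<Longrightarrow> v (slot L u) = real u / 2 ^ L"
  unfolding slot_def by (rule v_enc) (auto simp: dyadic_def intro!: less_imp_le)

lemma inj_slot: "inj_on (slot L) {..<2 ^ L}"
  using v_slot by (intro inj_onI) (metis divide_cancel_right lessThan_iff of_nat_eq_iff power_not_zero zero_neq_numeral)

lemma lift_slot: "u < 2 ^ L \<Longrightarrow> lift L g (slot L u) = slot L (g u)"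
  by (simp add: lift_def the_inv_into_f_f[OF inj_slot])

lemma lift_other: "k \<notin> slot L ` {..<2 ^ L} \<Longrightarrow> lift L g k = k"
  by (simp add: lift_def)

lemma slot_0 [simp]: "slot L 0 = 0"
  by (simp add: slot_def enc_0)

lemma slot_eq_0_iff: "u < 2 ^ L \<Longrightarrow> slot L u = 0 \<longleftrightarrow> u = 0"
  using v_slot[of u L] v_0 by auto

lemma lift_comp:
  assumes "\<And>u. u < 2 ^ L \<Longrightarrow> g u < 2 ^ L"
  shows "lift L f (lift L g k) = lift L (\<lambda>u. f (g u)) k"
  by (cases "k \<in> slot L ` {..<2 ^ L}") (auto simp: lift_slot lift_other assms)

lemma lift_id: "(\<And>u. u < 2 ^ L \<Longrightarrow> g u = u) \<Longrightarrow> lift L g k = k"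
  by (cases "k \<in> slot L ` {..<2 ^ L}") (auto simp: lift_slot lift_other)

lemma lift_cong: "(\<And>u. u < 2 ^ L \<Longrightarrow> f u = g u) \<Longrightarrow> lift L f k = lift L g k"
  by (cases "k \<in> slot L ` {..<2 ^ L}") (auto simp: lift_slot lift_other)

lemma finite_lift_support: "finite {k. lift L g k \<noteq> k}"
  by (rule finite_subset[of _ "slot L ` {..<2 ^ L}"]) (auto intro: ccontr dest: lift_other)

lemma slot_refine:
  assumes "l \<le> L" shows "slot L (q * 2 ^ (L - l)) = slot l q"
proof -
  have "(2::real) ^ L = 2 ^ l * 2 ^ (L - l)"
    using assms by (simp add: power_add[symmetric])
  then show ?thesis
    by (simp add: slot_def)
qed

text \<open>A parameter has the same slot on every grid that contains it, so a coarse permutation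
  can be read on a finer grid.\<close>

lemma lift_refine:
  assumes "l \<le> L"
  shows "lift l (cyc_pred (2 ^ l)) k = lift L (cyc_step (2 ^ l) (2 ^ (L - l))) k"
proof -
  let ?R = "2 ^ (L - l) :: nat"
  have M: "2 ^ L = 2 ^ l * ?R"
    using assms by (simp add: power_add[symmetric])
  consider q where "q < 2 ^ l" "k = slot l q" | "k \<notin> slot l ` {..<2 ^ l}"
    by blast
  then show ?thesis
  proof cases
    case 1
    then have "q * ?R < 2 ^ L"
      unfolding M by simp
    then have "lift L (cyc_step (2 ^ l) ?R) k = slot L (cyc_pred (2 ^ l) q * ?R)"
      using 1 slot_refine[OF assms, of q] lift_slot[of "q * ?R" L] by (simp add: cyc_step_def)
    then show ?thesis
      using 1 by (simp add: slot_refine[OF assms] lift_slot)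
  next
    case 2
    have "lift L (cyc_step (2 ^ l) ?R) k = k"
    proof (cases "k \<in> slot L ` {..<2 ^ L}")
      case True
      then obtain u where u: "u < 2 ^ L" "k = slot L u"
        by blast
      have "u mod ?R \<noteq> 0"
      proof
        assume "u mod ?R = 0"
        then have "u = u div ?R * ?R"
          using div_mult_mod_eq[of u ?R] by simp
        moreover have "u div ?R < 2 ^ l"
          using u(1) unfolding M by (simp add: less_mult_imp_div_less)
        ultimately show False
          using 2 u(2) slot_refine[OF assms, of "u div ?R"] by force
      qed
      then show ?thesis
        using u by (simp add: lift_slot cyc_step_def)
    qed (simp add: lift_other)
    with 2 show ?thesis
      by (simp add: lift_other)
  qed
qed

text \<open>Parameter of the first summand in slot \<open>k\<close> once \<open>\<psi> 1\<close> has
  replaced \<open>\<psi> 0\<close> in slot 0.\<close>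

abbreviation source :: "nat \<Rightarrow> real" where
  "source k \<equiv> (if k = 0 then 1 else v k)"

text \<open>With 0 counted as 1, the cyclic predecessor is a shift by one mesh width even at the
  wrap-around.\<close>

lemma lift_cyc_pred_close: "\<bar>source k - v (lift l (cyc_pred (2 ^ l)) k)\<bar> \<le> 1 / 2 ^ l"
proof (cases "k \<in> slot l ` {..<2 ^ l}")
  case True
  then obtain q where q: "q < 2 ^ l" "k = slot l q"
    by blast
  have "cyc_pred (2 ^ l) q < 2 ^ l"
    using q by (intro cyc_pred_less) auto
  then have "v (lift l (cyc_pred (2 ^ l)) k) = real (cyc_pred (2 ^ l) q) / 2 ^ l"
    using q by (simp add: lift_slot v_slot)
  moreover have "source k = (if q = 0 then 1 else real q / 2 ^ l)"
    using q by (simp add: slot_eq_0_iff v_slot)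
  ultimately show ?thesis
    by (auto simp: cyc_pred_def of_nat_diff diff_divide_distrib)
next
  case False
  moreover have "0 \<in> slot l ` {..<2 ^ l}"
    by (rule image_eqI[of _ _ 0]) auto
  ultimately show ?thesis
    by (auto simp: lift_other)
qed

text \<open>This concerns the permutation halfway through a refinement. The start of a block moves
  by exactly one block, with 0 again counted as 1; any other point stays inside its block, and
  blocks have length \<open>1 / 2 ^ l\<close>.\<close>

lemma lift_block_neg_close:
  assumes "l \<le> L"
  shows "\<bar>source k - v (lift L (block_neg (2 ^ (L - l))) (lift l (cyc_pred (2 ^ l)) k))\<bar> \<le> 1 / 2 ^ l"
proof -
  let ?R = "2 ^ (L - l) :: nat"
  have M: "2 ^ L = 2 ^ l * ?R"
    using assms by (simp add: power_add[symmetric])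
  have MR: "(2::real) ^ L = 2 ^ l * real ?R"
    using assms by (simp add: power_add[symmetric])
  have eq: "lift L (block_neg ?R) (lift l (cyc_pred (2 ^ l)) k) =
      lift L (\<lambda>u. block_neg ?R (cyc_step (2 ^ l) ?R u)) k"
    unfolding lift_refine[OF assms] M by (rule lift_comp) (metis M cyc_step_less)
  show ?thesis
  proof (cases "k \<in> slot L ` {..<2 ^ L}")
    case True
    then obtain u where u: "u < 2 ^ L" "k = slot L u"
      by blast
    let ?w = "block_neg ?R (cyc_step (2 ^ l) ?R u)"
    have w: "?w < 2 ^ L"
      using u(1) unfolding M by (intro block_neg_less cyc_step_less)
    have v: "v (lift L (\<lambda>u. block_neg ?R (cyc_step (2 ^ l) ?R u)) k) = real ?w / 2 ^ L"
      using u w by (simp add: lift_slot v_slot)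
    have s: "source k = (if u = 0 then 1 else real u / 2 ^ L)"
      using u by (simp add: slot_eq_0_iff v_slot)
    have "\<bar>source k - real ?w / 2 ^ L\<bar> \<le> real ?R / 2 ^ L"
    proof (cases "u mod ?R = 0")
      case True
      then obtain q where q: "u = q * ?R"
        by (metis mod_0_imp_dvd dvd_def mult.commute)
      have "?w = cyc_pred (2 ^ l) q * ?R"
        by (simp add: block_neg_cyc_step q)
      moreover have "source k = (if q = 0 then 1 else real q * real ?R / 2 ^ L)"
        using s q by simp
      moreover have "real (2 ^ l - 1) * real ?R / 2 ^ L = 1 - real ?R / 2 ^ L"
        unfolding MR by (simp add: of_nat_diff field_simps)
      moreover have "real (q - 1) * real ?R / 2 ^ L = real q * real ?R / 2 ^ L - real ?R / 2 ^ L" if "q \<noteq> 0"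
        using that by (simp add: of_nat_diff field_simps)
      ultimately show ?thesis
        by (auto simp: cyc_pred_def)
    next
      case False
      then have w: "?w = u div ?R * ?R + (?R - u mod ?R)"
        by (simp add: block_neg_cyc_step)
      have "u = u div ?R * ?R + u mod ?R" "u mod ?R < ?R"
        by (rule div_mult_mod_eq[symmetric]) simp
      with w have "u \<le> ?w + ?R" "?w \<le> u + ?R"
        by linarith+
      then have "\<bar>real u - real ?w\<bar> \<le> real ?R"
        by linarith
      then have "\<bar>real u / 2 ^ L - real ?w / 2 ^ L\<bar> \<le> real ?R / 2 ^ L"
        by (simp add: diff_divide_distrib[symmetric] divide_right_mono)
      moreover have "u \<noteq> 0"
        using False by (cases "u = 0") simp_all
      ultimately show ?thesis
        using s by simp
    qed
    also have "real ?R / 2 ^ L = 1 / 2 ^ l"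
      unfolding MR by simp
    finally show ?thesis
      unfolding eq v .
  next
    case False
    moreover have "0 \<in> slot L ` {..<2 ^ L}"
      by (rule image_eqI[of _ _ 0]) auto
    ultimately show ?thesis
      unfolding eq by (auto simp: lift_other)
  qed
qed

text \<open>Each refinement takes two steps: the even members are the cyclic predecessors on the
  successive grids, the odd ones are the permutations between the two reflections. All members arise
  from the first by involutions, so bijectivity has to be checked by hand for the first
  only.\<close>

lemma permutation_sequence:
  assumes \<eta>: "\<And>m. 0 < \<eta> m"
  shows "\<exists>\<sigma> \<tau>. \<forall>m::nat. bij (\<sigma> m) \<and> finite {k. \<sigma> m k \<noteq> k} \<and> (\<forall>k. \<sigma> (Suc m) k = \<tau> m (\<sigma> m k)) \<and>
     (\<forall>k. \<tau> m (\<tau> m k) = k) \<and> (\<forall>k. \<bar>source k - v (\<sigma> m k)\<bar> \<le> \<eta> m)"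
proof -
  have "\<exists>b. 1 / 2 ^ b \<le> min (\<eta> (2 * m)) (\<eta> (Suc (2 * m)))" for m
  proof -
    have "0 < min (\<eta> (2 * m)) (\<eta> (Suc (2 * m)))"
      using \<eta> by simp
    then obtain b where "(1/2) ^ b < min (\<eta> (2 * m)) (\<eta> (Suc (2 * m)))"
      using real_arch_pow_inv[of "min (\<eta> (2 * m)) (\<eta> (Suc (2 * m)))" "1/2"] by auto
    then show ?thesis
      by (auto simp: power_divide intro!: exI[of _ b])
  qed
  then obtain b where b: "\<And>m. 1 / 2 ^ b m \<le> min (\<eta> (2 * m)) (\<eta> (Suc (2 * m)))"
    by metis
  \<comment> \<open>Summing the exponents makes the grids nested, while each is as fine as
    \<open>b\<close> demands.\<close>
  define l where "l m = (\<Sum>j\<le>m. b j)" for m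
  have lm: "l m \<le> l (Suc m)" for m
    by (simp add: l_def)
  have l\<eta>: "1 / 2 ^ l m \<le> \<eta> (2 * m)" "1 / 2 ^ l m \<le> \<eta> (Suc (2 * m))" for m
  proof -
    have "b m \<le> l m"
      unfolding l_def by (rule member_le_sum) auto
    then have "(1::real) / 2 ^ l m \<le> 1 / 2 ^ b m"
      by (simp add: divide_left_mono power_increasing)
    then show "1 / 2 ^ l m \<le> \<eta> (2 * m)" "1 / 2 ^ l m \<le> \<eta> (Suc (2 * m))"
      using b[of m] by auto
  qed
  define R where "R m = (2::nat) ^ (l (Suc m) - l m)" for m
  have R0: "0 < R m" and M: "(2::nat) ^ l (Suc m) = 2 ^ l m * R m" for m
    using lm[of m] by (auto simp: R_def power_add[symmetric])
  define \<sigma>0 where "\<sigma>0 m = lift (l m) (cyc_pred (2 ^ l m))" for m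
  define \<beta> where "\<beta> m = lift (l (Suc m)) (block_neg (R m))" for m
  define \<alpha> where "\<alpha> m = lift (l (Suc m)) (block_rev (R m))" for m
  define \<sigma> where "\<sigma> n = (if even n then \<sigma>0 (n div 2) else \<beta> (n div 2) \<circ> \<sigma>0 (n div 2))" for n
  define \<tau> where "\<tau> n = (if even n then \<beta> (n div 2) else \<alpha> (n div 2))" for n
  have \<beta>\<beta>: "\<beta> m (\<beta> m k) = k" for m k
    unfolding \<beta>_def
    by (subst lift_comp) (auto intro!: lift_id block_neg_block_neg R0 simp: M block_neg_less)
  have \<alpha>\<alpha>: "\<alpha> m (\<alpha> m k) = k" for m k
    unfolding \<alpha>_def
    by (subst lift_comp) (auto intro!: lift_id block_rev_block_rev R0 simp: M block_rev_less)
  have invol: "\<tau> n (\<tau> n k) = k" for n k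
    by (simp add: \<tau>_def \<alpha>\<alpha> \<beta>\<beta>)
  have step: "\<sigma> (Suc n) k = \<tau> n (\<sigma> n k)" for n k
  proof (cases "even n")
    case True
    then show ?thesis
      by (simp add: \<sigma>_def \<tau>_def)
  next
    case False
    let ?m = "n div 2"
    have "\<alpha> ?m (\<beta> ?m (\<sigma>0 ?m k)) = \<sigma>0 (Suc ?m) k"
      unfolding \<alpha>_def \<beta>_def \<sigma>0_def lift_refine[OF lm[of ?m]] R_def[symmetric]
      by (subst lift_comp, simp add: M cyc_step_less, subst lift_comp, simp add: M cyc_step_less block_neg_less)
        (auto intro!: lift_cong simp: M block_rev_block_neg_cyc_step R0)
    moreover have "Suc n div 2 = Suc ?m"
      using False by presburger
    ultimately show ?thesis
      using False by (simp add: \<sigma>_def \<tau>_def)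
  qed
  have bij0: "bij (\<sigma> 0)"
  proof -
    let ?M = "2 ^ l 0 :: nat"
    let ?succ = "\<lambda>u. if Suc u = ?M then 0 else Suc u"
    have "lift (l 0) ?succ (lift (l 0) (cyc_pred ?M) k) = k" for k
      by (subst lift_comp) (auto intro!: lift_id simp: cyc_pred_def)
    moreover have "lift (l 0) (cyc_pred ?M) (lift (l 0) ?succ k) = k" for k
      by (subst lift_comp) (auto intro!: lift_id simp: cyc_pred_def)
    ultimately show ?thesis
      by (intro o_bij[of "lift (l 0) ?succ"]) (auto simp: \<sigma>_def \<sigma>0_def)
  qed
  have bij: "bij (\<sigma> n)" for n
  proof (induction n)
    case (Suc n)
    have "bij (\<tau> n)"
      by (rule involuntory_imp_bij) (simp add: invol)
    then have "bij (\<tau> n \<circ> \<sigma> n)"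
      using Suc by (intro bij_comp)
    then show ?case
      using step by (simp add: comp_def)
  qed (rule bij0)
  have fin: "finite {k. \<sigma> n k \<noteq> k}" for n
  proof (induction n)
    case 0
    show ?case
      by (simp add: \<sigma>_def \<sigma>0_def finite_lift_support)
  next
    case (Suc n)
    have "finite {k. \<tau> n k \<noteq> k}"
      by (simp add: \<tau>_def \<alpha>_def \<beta>_def finite_lift_support)
    moreover have "{k. \<sigma> (Suc n) k \<noteq> k} \<subseteq> {k. \<sigma> n k \<noteq> k} \<union> {k. \<tau> n k \<noteq> k}"
      by (auto simp: step)
    ultimately show ?case
      using Suc by (meson finite_UnI finite_subset)
  qed
  have close: "\<bar>source k - v (\<sigma> n k)\<bar> \<le> \<eta> n" for n k
  proof (cases "even n")
    case True
    then have "\<sigma> n = \<sigma>0 (n div 2)" "2 * (n div 2) = n"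
      by (auto simp: \<sigma>_def)
    then show ?thesis
      using order_trans[OF lift_cyc_pred_close[of k "l (n div 2)"] l\<eta>(1)[of "n div 2"]]
      unfolding \<sigma>0_def by simp
  next
    case False
    then have "\<sigma> n k = \<beta> (n div 2) (\<sigma>0 (n div 2) k)" "Suc (2 * (n div 2)) = n"
      by (auto simp: \<sigma>_def)
    then show ?thesis
      using order_trans[OF lift_block_neg_close[OF lm[of "n div 2"], of k] l\<eta>(2)[of "n div 2"]]
      unfolding \<sigma>0_def \<beta>_def R_def by simp
  qed
  show ?thesis
    using bij fin step invol close by blast
qed

end

text \<open>All even slots carry the parameter 0, which provides an infinite supply of exact direct
  sums; the odd slots enumerate the dyadic numbers of the unit interval.\<close>

lemma dyadic_slots_exist:
  "\<exists>v enc. dyadic_slots v enc \<and> (\<forall>k. dyadic (v k) \<and> v k \<in> {0..1}) \<and> (\<forall>k. v (2 * k) = 0)"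
proof -
  define D where "D = {t. dyadic t \<and> t \<in> {0..1}}"
  have "D \<subseteq> range (\<lambda>(m :: nat, n :: nat). real m / 2 ^ n)"
    by (auto simp: D_def dyadic_def)
  then have cD: "countable D"
    by (rule countable_subset) simp
  have D0: "0 \<in> D"
    by (auto simp: D_def dyadic_def)
  then have ne: "D \<noteq> {}"
    by blast
  define v where "v k = (if even k then 0 else from_nat_into D (k div 2))" for k
  define enc where "enc t = (if t = 0 then 0 else Suc (2 * to_nat_on D t))" for t :: real
  have "v (enc t) = t" if "dyadic t" "0 \<le> t" "t \<le> 1" for t
    using that cD by (auto simp: v_def enc_def D_def from_nat_into_to_nat_on)
  then have "dyadic_slots v enc"
    by unfold_locales (auto simp: enc_def)
  moreover have "v k \<in> D" for k
    using D0 from_nat_into[OF ne] by (simp add: v_def)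
  moreover have "v (2 * k) = 0" for k
    by (simp add: v_def)
  ultimately show ?thesis
    unfolding D_def by blast
qed

section \<open>The homotopy argument\<close>

context lp_exponent begin

lemma compact_op_small_off_finite:
  assumes K: "compact_op p K" and e: "e > 0"
  shows "\<exists>F G. finite F \<and> finite G \<and>
    (\<forall>A x. A \<inter> F = {} \<longrightarrow> x \<in> lp p \<longrightarrow> lp_norm p (restr A (K x)) \<le> e * lp_norm p x) \<and>
    (\<forall>A x. A \<inter> G = {} \<longrightarrow> x \<in> lp p \<longrightarrow> lp_norm p (K (restr A x)) \<le> e * lp_norm p x)"
proof -
  obtain F where F: "finite F" "\<forall>A. A \<inter> F = {} \<longrightarrow> (\<forall>x\<in>lp p. lp_norm p (restr A (K x)) \<le> e * lp_norm p x)"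
    using compact_op_small_range[OF K e] unfolding restr_def by (elim exE conjE)
  obtain G where G: "finite G" "\<forall>A. A \<inter> G = {} \<longrightarrow> (\<forall>x\<in>lp p. lp_norm p (K (restr A x)) \<le> e * lp_norm p x)"
    using compact_op_small_domain[OF K e] by (elim exE conjE)
  show ?thesis
    using F G by (intro exI[of _ F] exI[of _ G]) simp
qed

lemma bounded_op_dsum:
  fixes A :: "('i \<Rightarrow> complex) \<Rightarrow> 'i \<Rightarrow> complex" and B :: "('j \<Rightarrow> complex) \<Rightarrow> 'j \<Rightarrow> complex"
  assumes A: "bounded_op p A" and B: "bounded_op p B"
  shows "bounded_op p (op_dsum A B)"
proof -
  have er: "bounded_op p (\<lambda>(y :: 'j \<Rightarrow> complex) (j :: 'i + 'j). if j \<in> range Inr then y (projr j) else 0)"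
    by (rule bounded_byI_op[OF bounded_by_section]) (auto simp: inj_on_def)
  have pr: "bounded_op p (\<lambda>(y :: 'i + 'j \<Rightarrow> complex) i. y (Inr i))"
    by (rule bounded_byI_op[OF bounded_by_reindex]) (auto simp: inj_on_def)
  have "bounded_op p (\<lambda>(y :: 'i + 'j \<Rightarrow> complex) j. emb_l (A (\<lambda>i. y (Inl i))) j
      + (if j \<in> range Inr then B (\<lambda>i. y (Inr i)) (projr j) else 0))"
    by (rule bounded_op_add[OF bounded_op_comp[OF bounded_byI_op[OF bounded_by_emb_l]
            bounded_op_comp[OF A bounded_byI_op[OF bounded_by_left]]]
          bounded_op_comp[OF er bounded_op_comp[OF B pr]]])
  moreover have "(\<lambda>(y :: 'i + 'j \<Rightarrow> complex) j. emb_l (A (\<lambda>i. y (Inl i))) j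
      + (if j \<in> range Inr then B (\<lambda>i. y (Inr i)) (projr j) else 0)) = op_dsum A B"
    by (auto simp: fun_eq_iff op_dsum_def emb_l_def split: sum.splits)
  ultimately show ?thesis
    by simp
qed

lemma reindex_isometric:
  assumes "\<And>d. f (g d) = d" "\<And>c. g (f c) = c" "x \<in> lp p"
  shows "(\<lambda>c. x (f c)) \<in> lp p" "lp_norm p (\<lambda>c. x (f c)) = lp_norm p x"
proof -
  have inj: "inj f" "inj g"
    using assms(1,2) by (metis injI)+
  show l: "(\<lambda>c. x (f c)) \<in> lp p"
    using bounded_byD(1)[OF bounded_by_reindex[OF inj(1)] assms(3)] .
  show "lp_norm p (\<lambda>c. x (f c)) = lp_norm p x"
    using bounded_byD(2)[OF bounded_by_reindex[OF inj(1)] assms(3)]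
      bounded_byD(2)[OF bounded_by_reindex[OF inj(2)] l] assms(1) by simp
qed

end

section \<open>Uniform continuity modulo compact operators\<close>

locale homotopy = lp_exponent +
  fixes \<Lambda> :: "'a set"
    and \<psi> \<phi> :: "real \<Rightarrow> 'a \<Rightarrow> (nat \<Rightarrow> complex) \<Rightarrow> (nat \<Rightarrow> complex)"
    and \<rho> :: "real \<Rightarrow> 'a \<Rightarrow> ((nat + nat) \<Rightarrow> complex) \<Rightarrow> ((nat + nat) \<Rightarrow> complex)"
  assumes countable_index: "countable \<Lambda>"
    and bounded_psi: "t \<in> {0..1} \<Longrightarrow> a \<in> \<Lambda> \<Longrightarrow> bounded_op p (\<psi> t a)"
    and bounded_phi: "t \<in> {0..1} \<Longrightarrow> a \<in> \<Lambda> \<Longrightarrow> bounded_op p (\<phi> t a)"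
    and bounded_rho: "t \<in> {0..1} \<Longrightarrow> a \<in> \<Lambda> \<Longrightarrow> bounded_op p (\<rho> t a)"
    and rho_0: "a \<in> \<Lambda> \<Longrightarrow> x \<in> lp p \<Longrightarrow> \<rho> 0 a x = op_dsum (\<psi> 0 a) (\<phi> 0 a) x"
    and rho_compact: "t \<in> {0..1} \<Longrightarrow> a \<in> \<Lambda> \<Longrightarrow>
       compact_op p (\<lambda>x i. \<rho> t a x i - op_dsum (\<psi> t a) (\<phi> t a) x i)"
    and psi_continuous: "a \<in> \<Lambda> \<Longrightarrow> t0 \<in> {0..1} \<Longrightarrow> e > 0 \<Longrightarrow> \<exists>d>0. \<forall>t\<in>{0..1}.
       \<bar>t - t0\<bar> < d \<longrightarrow> ess_norm p (\<lambda>x i. \<psi> t a x i - \<psi> t0 a x i) < e"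
    and rho_bound: "a \<in> \<Lambda> \<Longrightarrow> \<exists>C. \<forall>t\<in>{0..1}. op_norm p (\<rho> t a) \<le> C"
begin

text \<open>Closeness in the quotient by the compact operators, expressed by a witness, because
  witnesses can be subtracted and handed on to \<open>essentially_intertwines\<close>.\<close>

definition ess_close :: "'a \<Rightarrow> real \<Rightarrow> real \<Rightarrow> real \<Rightarrow> bool" where
  "ess_close a e s t \<longleftrightarrow> (\<exists>K. compact_op p K \<and> bounded_by e (\<lambda>x i. (\<psi> s a x i - \<psi> t a x i) - K x i))"

lemma ess_close_triangle:
  assumes "ess_close a e s u" "ess_close a e t u"
  shows "ess_close a (e + e) s t"
proof -
  obtain K L where K: "compact_op p K" "bounded_by e (\<lambda>x i. (\<psi> s a x i - \<psi> u a x i) - K x i)"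
    and L: "compact_op p L" "bounded_by e (\<lambda>x i. (\<psi> t a x i - \<psi> u a x i) - L x i)"
    using assms unfolding ess_close_def by (elim exE conjE)
  have "bounded_by (e + e) (\<lambda>x i. ((\<psi> s a x i - \<psi> u a x i) - K x i) - ((\<psi> t a x i - \<psi> u a x i) - L x i))"
    by (rule bounded_by_diff2[OF K(2) L(2)])
  then have "bounded_by (e + e) (\<lambda>x i. (\<psi> s a x i - \<psi> t a x i) - (K x i - L x i))"
    by (simp add: algebra_simps)
  with compact_op_diff[OF K(1) L(1)] show ?thesis
    unfolding ess_close_def by (intro exI conjI)
qed

text \<open>The Heine-Cantor argument: pairs violating the claim accumulate at some \<open>u\<close>
  in the compact interval, and near \<open>u\<close> both members of a pair are e/2-close to the
  value at \<open>u\<close>.\<close>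

lemma psi_uniformly_continuous:
  assumes a: "a \<in> \<Lambda>" and e: "e > 0"
  shows "\<exists>d>0. \<forall>s\<in>{0..1}. \<forall>t\<in>{0..1}. \<bar>s - t\<bar> \<le> d \<longrightarrow> ess_close a e s t"
proof (rule ccontr)
  assume neg: "\<not> ?thesis"
  have "\<exists>s t. s \<in> {0..1} \<and> t \<in> {0..1} \<and> \<bar>s - t\<bar> \<le> 1 / real (Suc n) \<and> \<not> ess_close a e s t" for n
  proof -
    have "\<not> (\<forall>s\<in>{0..1}. \<forall>t\<in>{0..1}. \<bar>s - t\<bar> \<le> 1 / real (Suc n) \<longrightarrow> ess_close a e s t)"
    proof
      assume *: "\<forall>s\<in>{0..1}. \<forall>t\<in>{0..1}. \<bar>s - t\<bar> \<le> 1 / real (Suc n) \<longrightarrow> ess_close a e s t"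
      show False
        by (rule notE[OF neg], rule exI[of _ "1 / real (Suc n)"], rule conjI[OF _ *]) simp
    qed
    then show ?thesis
      by (simp only: ball_simps bex_simps not_all not_imp Ball_def) blast
  qed
  then obtain s t where st: "\<And>n. s n \<in> {0..1}" "\<And>n. t n \<in> {0..1}" "\<And>n. \<bar>s n - t n\<bar> \<le> 1 / real (Suc n)"
    "\<And>n. \<not> ess_close a e (s n) (t n)"
    by metis
  obtain u r where u: "u \<in> {0..1::real}" "strict_mono (r :: nat \<Rightarrow> nat)" "(s \<circ> r) \<longlonglongrightarrow> u"
    using compact_Icc[of 0 "1::real"] st(1) unfolding compact_eq_seq_compact_metric seq_compact_def by metis
  obtain d where d: "d > 0" "\<And>t. t \<in> {0..1} \<Longrightarrow> \<bar>t - u\<bar> < d \<Longrightarrow> ess_norm p (\<lambda>x i. \<psi> t a x i - \<psi> u a x i) < e / 2"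
    using psi_continuous[OF a u(1), of "e / 2"] e by auto
  have close: "ess_close a (e / 2) t u" if "t \<in> {0..1}" "\<bar>t - u\<bar> < d" for t
    unfolding ess_close_def
    by (rule ess_norm_lessD[OF bounded_op_diff[OF bounded_psi[OF that(1) a] bounded_psi[OF u(1) a]] d(2)[OF that]])
  have "eventually (\<lambda>n. \<bar>(s \<circ> r) n - u\<bar> < d / 2) sequentially"
    using tendstoD[OF u(3), of "d / 2"] d(1) by (simp add: dist_real_def)
  moreover have "eventually (\<lambda>n. 1 / real (Suc n) < d / 2) sequentially"
    using d(1) by (intro order_tendstoD(2)[OF LIMSEQ_inverse_real_of_nat[unfolded inverse_eq_divide]]) simp
  ultimately have "eventually (\<lambda>n. \<bar>(s \<circ> r) n - u\<bar> < d / 2 \<and> 1 / real (Suc n) < d / 2) sequentially"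
    by (rule eventually_conj)
  then obtain n where n: "\<bar>s (r n) - u\<bar> < d / 2" "1 / real (Suc n) < d / 2"
    by (auto simp: eventually_sequentially)
  have "1 / real (Suc (r n)) \<le> 1 / real (Suc n)"
    using seq_suble[OF u(2), of n] by (intro divide_left_mono) auto
  then have "\<bar>s (r n) - t (r n)\<bar> < d / 2"
    using st(3)[of "r n"] n(2) by linarith
  with n(1) have "\<bar>s (r n) - u\<bar> < d" "\<bar>t (r n) - u\<bar> < d"
    using d(1) by linarith+
  then have "ess_close a (e / 2 + e / 2) (s (r n)) (t (r n))"
    by (intro ess_close_triangle[of _ _ _ u] close st)
  with st(4)[of "r n"] show False
    by simp
qed

text \<open>The finite part of the index set that is treated at stage \<open>m\<close>. Each element
  belongs to it from some stage on, which is enough for \<open>compact_intertwiner\<close>.\<close>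

definition indices :: "nat \<Rightarrow> 'a set" where
  "indices m = {a \<in> \<Lambda>. to_nat_on \<Lambda> a < m}"

lemma finite_indices: "finite (indices m)"
proof (rule inj_on_finite[of "to_nat_on \<Lambda>" _ "{..<m}"])
  show "inj_on (to_nat_on \<Lambda>) (indices m)"
    using inj_on_to_nat_on[OF countable_index] by (rule inj_on_subset) (auto simp: indices_def)
qed (auto simp: indices_def)

lemma indices_mono: "m \<le> n \<Longrightarrow> indices m \<subseteq> indices n"
  by (auto simp: indices_def)

lemma indices_subset: "indices m \<subseteq> \<Lambda>"
  by (auto simp: indices_def)

lemma modulus_exists:
  "\<exists>\<eta>>0. \<forall>a\<in>indices m. \<forall>s\<in>{0..1}. \<forall>t\<in>{0..1}. \<bar>s - t\<bar> \<le> \<eta> \<longrightarrow> ess_close a ((1/2) ^ m) s t"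
proof -
  have "\<forall>a\<in>indices m. \<exists>d>0. \<forall>s\<in>{0..1}. \<forall>t\<in>{0..1}. \<bar>s - t\<bar> \<le> d \<longrightarrow> ess_close a ((1/2) ^ m) s t"
    using indices_subset by (intro ballI psi_uniformly_continuous) auto
  then obtain d where d: "\<forall>a\<in>indices m. d a > 0 \<and> (\<forall>s\<in>{0..1}. \<forall>t\<in>{0..1}. \<bar>s - t\<bar> \<le> d a \<longrightarrow> ess_close a ((1/2) ^ m) s t)"
    by (rule bchoice[THEN exE])
  \<comment> \<open>The 1 makes the minimum meaningful when \<open>indices m\<close> is
    empty.\<close>
  define \<eta> where "\<eta> = Min (insert 1 (d ` indices m))"
  have "\<eta> > 0"
    unfolding \<eta>_def using finite_indices d by (subst Min_gr_iff) auto
  moreover have "\<eta> \<le> d a" if "a \<in> indices m" for a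
    unfolding \<eta>_def using finite_indices that by (intro Min_le) auto
  ultimately show ?thesis
    using d by (intro exI[of _ \<eta>]) force
qed

end

section \<open>The stages of the interpolation\<close>

locale homotopy_slots = homotopy + dyadic_slots v enc for v enc +
  fixes \<eta> :: "nat \<Rightarrow> real" and \<sigma> \<tau> :: "nat \<Rightarrow> nat \<Rightarrow> nat"
  assumes v_range: "v k \<in> {0..1}" and v_even: "v (2 * k) = 0"
    and modulus: "a \<in> indices m \<Longrightarrow> s \<in> {0..1} \<Longrightarrow> t \<in> {0..1} \<Longrightarrow> \<bar>s - t\<bar> \<le> \<eta> m \<Longrightarrow> ess_close a ((1/2) ^ m) s t"
    and bij_perm: "bij (\<sigma> m)" and finite_perm: "finite {k. \<sigma> m k \<noteq> k}"
    and perm_Suc: "\<sigma> (Suc m) k = \<tau> m (\<sigma> m k)" and perm_invol: "\<tau> m (\<tau> m k) = k"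
    and perm_close: "\<bar>source k - v (\<sigma> m k)\<bar> \<le> \<eta> m"
begin

definition target_op :: "'a \<Rightarrow> nat \<Rightarrow> (nat + nat \<Rightarrow> complex) \<Rightarrow> nat + nat \<Rightarrow> complex" where
  "target_op a k = \<rho> (v k) a"

text \<open>Up to a relabelling of coordinates, the direct sum of these operators is that of
  \<open>\<psi> 1 a\<close> and all the \<open>target_op a k\<close>; this is
  \<open>source_op_fold\<close>.\<close>

definition source_op :: "'a \<Rightarrow> nat \<Rightarrow> (nat + nat \<Rightarrow> complex) \<Rightarrow> nat + nat \<Rightarrow> complex" where
  "source_op a k = (if k = 0 then op_dsum (\<psi> 1 a) (\<phi> 0 a) else \<rho> (v k) a)"

lemma source_range: "source k \<in> {0..1}"
  using v_range[of k] by simp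

lemma target_bounded:
  assumes "a \<in> \<Lambda>"
  obtains C where "0 \<le> C" "\<And>k. bounded_by C (target_op a k)"
proof -
  obtain C where C: "\<And>t. t \<in> {0..1} \<Longrightarrow> op_norm p (\<rho> t a) \<le> C"
    using rho_bound[OF assms] by blast
  have "0 \<le> C"
    using op_norm_nonneg[OF bounded_rho[OF v_range[of 0] assms]] C[OF v_range[of 0]] by linarith
  moreover have "bounded_by C (target_op a k)" for k
    unfolding target_op_def
    by (rule bounded_by_mono[OF bounded_by_op_norm[OF bounded_rho[OF v_range assms]] C[OF v_range]])
  ultimately show ?thesis
    using that by blast
qed

lemma source_bounded:
  assumes "a \<in> \<Lambda>"
  obtains C where "0 \<le> C" "\<And>k. bounded_by C (source_op a k)"
proof -
  obtain C where C: "0 \<le> C" "\<And>k. bounded_by C (target_op a k)"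
    using target_bounded[OF assms] by blast
  have "bounded_op p (op_dsum (\<psi> 1 a) (\<phi> 0 a))"
    using assms by (intro bounded_op_dsum bounded_psi bounded_phi) auto
  then obtain D where D: "0 \<le> D" "bounded_by D (op_dsum (\<psi> 1 a) (\<phi> 0 a))"
    by (rule bounded_opD)
  have "bounded_by (max C D) (source_op a k)" for k
    using bounded_by_mono[OF C(2)[of k], of "max C D"] bounded_by_mono[OF D(2), of "max C D"]
    by (simp add: source_op_def target_op_def)
  then show ?thesis
    using that[of "max C D"] C(1) by auto
qed

lemma target_compact:
  "a \<in> \<Lambda> \<Longrightarrow> compact_op p (\<lambda>x i. target_op a k x i - op_dsum (\<psi> (v k) a) (\<phi> (v k) a) x i)"
  unfolding target_op_def by (rule rho_compact[OF v_range])

lemma source_compact: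
  assumes "a \<in> \<Lambda>"
  shows "compact_op p (\<lambda>x i. source_op a k x i - op_dsum (\<psi> (source k) a) (\<phi> (v k) a) x i)"
proof (cases "k = 0")
  case True
  then show ?thesis
    using compact_op_zero by (simp add: source_op_def v_0)
next
  case False
  then show ?thesis
    using target_compact[OF assms, of k] by (simp add: source_op_def target_op_def)
qed

text \<open>The first summand of parameter \<open>source k\<close> arrives in a slot whose parameter
  \<open>v (\<sigma> m k)\<close> is \<open>\<eta> m\<close>-close to it. Slot 0 is put into the
  exceptional set because source and target differ there whether or not it is moved.\<close>

lemma stage_intertwines:
  assumes a: "a \<in> indices m"
  shows "\<exists>K. compact_op p K \<and> bounded_by ((1/2) ^ m) (\<lambda>x c. (op_bigdsum (target_op a) (perm_op (\<sigma> m) x) c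
      - perm_op (\<sigma> m) (op_bigdsum (source_op a) x) c) - K x c)"
proof (rule essentially_intertwines[where D = "insert 0 {k. \<sigma> m k \<noteq> k}" and P = "\<lambda>k. \<psi> (v k) a"
      and Q = "\<lambda>k. \<psi> (source k) a" and F = "\<lambda>k. \<phi> (v k) a"])
  have a': "a \<in> \<Lambda>"
    using a indices_subset by blast
  show "compact_op p (\<lambda>x i. target_op a k x i - op_dsum (\<psi> (v k) a) (\<phi> (v k) a) x i)" for k
    by (rule target_compact[OF a'])
  show "compact_op p (\<lambda>x i. source_op a k x i - op_dsum (\<psi> (source k) a) (\<phi> (v k) a) x i)" for k
    by (rule source_compact[OF a'])
  show "\<exists>K. compact_op p K \<and> bounded_by ((1/2) ^ m) (\<lambda>x i. (\<psi> (v (\<sigma> m k)) a x i - \<psi> (source k) a x i) - K x i)" for k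
    using modulus[OF a v_range[of "\<sigma> m k"] source_range[of k]] perm_close[of k m]
    unfolding ess_close_def by (simp only: abs_minus_commute)
qed (use bij_perm finite_perm in \<open>auto simp: source_op_def target_op_def\<close>)

text \<open>The 9 is 2 * 3 + 2 + 1: in \<open>increment_bound\<close> the commutator bound is
  \<open>3 * (1/2) ^ m\<close> by \<open>fibre_commutator_bound\<close>, and the other two bounds
  are \<open>(1/2) ^ m\<close>.\<close>

definition good_stage :: "nat \<Rightarrow> nat \<Rightarrow> (nat \<Rightarrow> complex) \<Rightarrow> nat \<Rightarrow> bool" where
  "good_stage m N h N' \<longleftrightarrow> N \<le> N' \<and> (\<forall>i<N. h i = 0) \<and> (\<forall>i\<ge>N'. h i = 1) \<and> (\<forall>i. norm (1 - 2 * h i) = 1) \<and>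
     (\<forall>a\<in>indices m. \<forall>x\<in>lp p. lp_norm p (\<lambda>c.
        op_bigdsum (target_op a) (slot_mult h (\<lambda>c. perm_op (\<sigma> (Suc m)) x c - perm_op (\<sigma> m) x c)) c
        - slot_mult h (\<lambda>c. perm_op (\<sigma> (Suc m)) (op_bigdsum (source_op a) x) c
            - perm_op (\<sigma> m) (op_bigdsum (source_op a) x) c) c)
      \<le> 9 * (1/2) ^ m * lp_norm p x)"

text \<open>The compact operators of the stage are determined before \<open>N\<close> and
  \<open>h\<close>. Hence a threshold \<open>M\<close> beyond which they are small comes first, and
  \<open>h\<close> can then be started at any \<open>N\<close> above it; this freedom lets
  consecutive stages be joined.\<close>

lemma good_stage_exists: "\<exists>M. \<forall>N\<ge>M. \<exists>h N'. good_stage m N h N'"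
proof -
  define D where "D = {k. \<sigma> m k \<noteq> k} \<union> {k. \<sigma> (Suc m) k \<noteq> k}"
  have finD: "finite D"
    unfolding D_def using finite_perm by simp
  have e: "(0::real) < (1/2) ^ m"
    by simp
  define R where "R n a = (\<lambda>x c. op_bigdsum (target_op a) (perm_op (\<sigma> n) x) c
      - perm_op (\<sigma> n) (op_bigdsum (source_op a) x) c)" for n a
  have "\<forall>a\<in>indices m. \<exists>K. compact_op p K \<and> bounded_by ((1/2) ^ m) (\<lambda>x c. R m a x c - K x c)"
    unfolding R_def by (intro ballI stage_intertwines)
  from bchoice[OF this] obtain K where K: "\<And>a. a \<in> indices m \<Longrightarrow> compact_op p (K a)"
    "\<And>a. a \<in> indices m \<Longrightarrow> bounded_by ((1/2) ^ m) (\<lambda>x c. R m a x c - K a x c)"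
    by auto
  have "\<forall>a\<in>indices m. \<exists>K. compact_op p K \<and> bounded_by ((1/2) ^ Suc m) (\<lambda>x c. R (Suc m) a x c - K x c)"
  proof
    fix a assume "a \<in> indices m"
    then have "a \<in> indices (Suc m)"
      using indices_mono[of m "Suc m"] by auto
    then show "\<exists>K. compact_op p K \<and> bounded_by ((1/2) ^ Suc m) (\<lambda>x c. R (Suc m) a x c - K x c)"
      unfolding R_def by (rule stage_intertwines)
  qed
  from bchoice[OF this] obtain K' where K': "\<And>a. a \<in> indices m \<Longrightarrow> compact_op p (K' a)"
    "\<And>a. a \<in> indices m \<Longrightarrow> bounded_by ((1/2) ^ Suc m) (\<lambda>x c. R (Suc m) a x c - K' a x c)"
    by auto
  \<comment> \<open>Stage \<open>Suc m\<close> intertwines even better; the weaker bound lets both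
    stages share one constant.\<close>
  have K'': "bounded_by ((1/2) ^ m) (\<lambda>x c. R (Suc m) a x c - K' a x c)" if "a \<in> indices m" for a
    by (rule bounded_by_mono[OF K'(2)[OF that]]) simp
  have "\<exists>F. finite F \<and> (\<forall>A x. A \<inter> F = {} \<longrightarrow> x \<in> lp p \<longrightarrow>
      lp_norm p (restr A (\<lambda>c. K' a x c - K a x c)) \<le> (1/2) ^ m * lp_norm p x)" if "a \<in> indices m" for a
    using compact_op_small_off_finite[OF compact_op_diff[OF K'(1)[OF that] K(1)[OF that]] e]
    by (elim exE conjE) (intro exI conjI)
  then have "\<forall>a\<in>indices m. \<exists>F. finite F \<and> (\<forall>A x. A \<inter> F = {} \<longrightarrow> x \<in> lp p \<longrightarrow>
      lp_norm p (restr A (\<lambda>c. K' a x c - K a x c)) \<le> (1/2) ^ m * lp_norm p x)"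
    by (rule ballI)
  from bchoice[OF this] obtain F where F0: "\<forall>a\<in>indices m. finite (F a) \<and> (\<forall>A x. A \<inter> F a = {} \<longrightarrow> x \<in> lp p \<longrightarrow>
      lp_norm p (restr A (\<lambda>c. K' a x c - K a x c)) \<le> (1/2) ^ m * lp_norm p x)"
    by (rule exE)
  have F: "finite (F a)" "A \<inter> F a = {} \<Longrightarrow> x \<in> lp p \<Longrightarrow>
      lp_norm p (restr A (\<lambda>c. K' a x c - K a x c)) \<le> (1/2) ^ m * lp_norm p x" if "a \<in> indices m" for a A x
    using F0[THEN bspec, OF that] by auto
  define L where "L a k = (\<lambda>x i. target_op a k x i - op_dsum (\<psi> (v k) a) (\<phi> (v k) a) x i)" for a k
  have Lc: "compact_op p (L a k)" if "a \<in> indices m" for a k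
    unfolding L_def using target_compact[of a k] that indices_subset by blast
  define GG where "GG a k G G' \<longleftrightarrow> finite G \<and> finite G' \<and>
      (\<forall>A x. A \<inter> G = {} \<longrightarrow> x \<in> lp p \<longrightarrow> lp_norm p (restr A (L a k x)) \<le> (1/2) ^ m * lp_norm p x) \<and>
      (\<forall>A x. A \<inter> G' = {} \<longrightarrow> x \<in> lp p \<longrightarrow> lp_norm p (L a k (restr A x)) \<le> (1/2) ^ m * lp_norm p x)" for a k G G'
  have "\<exists>G G'. GG a k G G'" if "a \<in> indices m" for a k
    unfolding GG_def by (rule compact_op_small_off_finite[OF Lc[OF that] e])
  then obtain G G' where "\<And>a k. a \<in> indices m \<Longrightarrow> GG a k (G a k) (G' a k)"
    by metis
  then have G: "finite (G a k)" "finite (G' a k)"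
    "\<And>A x. A \<inter> G a k = {} \<Longrightarrow> x \<in> lp p \<Longrightarrow> lp_norm p (restr A (L a k x)) \<le> (1/2) ^ m * lp_norm p x"
    "\<And>A x. A \<inter> G' a k = {} \<Longrightarrow> x \<in> lp p \<Longrightarrow> lp_norm p (L a k (restr A x)) \<le> (1/2) ^ m * lp_norm p x"
    if "a \<in> indices m" for a k
    using that unfolding GG_def by simp_all
  \<comment> \<open>The coordinates within a slot at which some compact operator of the stage may be
    large: those of the differences \<open>K' - K\<close>, with the slot forgotten, and the range
    and domain sets of the corrections in the moved slots.\<close>
  define FF where "FF = (\<Union>a\<in>indices m. snd ` F a) \<union> (\<Union>a\<in>indices m. \<Union>k\<in>D. G a k \<union> G' a k)"
  have "finite FF"
    unfolding FF_def using finite_indices finD F(1) G(1,2) by auto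
  then have "finite (Inl -` FF)"
    by (rule finite_vimageI) (simp add: inj_on_def)
  then obtain M where M: "Inl -` FF \<subseteq> {..<M}"
    using finite_nat_bounded by blast
  have "\<exists>h N'. good_stage m N h N'" if N: "N \<ge> M" for N
  proof -
    have disj: "(Inl ` {N..}) \<inter> FF = {}"
      using M N by fastforce
    \<comment> \<open>Only moved slots and current indices count, so \<open>h\<close> has to almost
      commute with finitely many operators.\<close>
    define \<T> where "\<T> = (\<lambda>(k, a). \<psi> (v k) a) ` (D \<times> indices m)"
    have fin\<T>: "finite \<T>"
      unfolding \<T>_def using finD finite_indices by simp
    have bdd\<T>: "bounded_op p T" if T: "T \<in> \<T>" for T
    proof -
      obtain k a where "a \<in> indices m" "T = \<psi> (v k) a"
        using T unfolding \<T>_def by auto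
      then show ?thesis
        using bounded_psi[OF v_range[of k], of a] indices_subset[of m] by auto
    qed
    have "\<exists>h N'. N \<le> N' \<and> (\<forall>i<N. h i = 0) \<and> (\<forall>i\<ge>N'. h i = 1) \<and> (\<forall>i. norm (1 - 2 * h i) = 1) \<and>
        (\<forall>T\<in>\<T>. \<forall>x\<in>lp p. lp_norm p (\<lambda>i. T (\<lambda>j. h j * x j) i - h i * T x i) \<le> (1/2) ^ m * lp_norm p x)"
      using bdd\<T> by (rule quasicentral_diagonal[OF fin\<T> _ e])
    then obtain h N' where h: "N \<le> N'" "\<forall>i<N. h i = 0" "\<forall>i\<ge>N'. h i = 1" "\<forall>i. norm (1 - 2 * h i) = 1"
      "\<forall>T\<in>\<T>. \<forall>x\<in>lp p. lp_norm p (\<lambda>i. T (\<lambda>j. h j * x j) i - h i * T x i) \<le> (1/2) ^ m * lp_norm p x"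
      by (elim exE conjE)
    have h1: "norm (h i) \<le> 1" and h0: "i < N \<Longrightarrow> h i = 0" for i
      using h(2,4) norm_half_circle_le(1) by auto
    have "lp_norm p (\<lambda>c. op_bigdsum (target_op a) (slot_mult h (\<lambda>c. perm_op (\<sigma> (Suc m)) x c - perm_op (\<sigma> m) x c)) c
        - slot_mult h (\<lambda>c. perm_op (\<sigma> (Suc m)) (op_bigdsum (source_op a) x) c
            - perm_op (\<sigma> m) (op_bigdsum (source_op a) x) c) c)
      \<le> 9 * (1/2) ^ m * lp_norm p x" if a: "a \<in> indices m" and x: "x \<in> lp p" for a x
    proof -
      have a': "a \<in> \<Lambda>"
        using a indices_subset by blast
      obtain CA where CA: "0 \<le> CA" "\<And>k. bounded_by CA (target_op a k)"
        using target_bounded[OF a'] by blast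
      obtain CB where CB: "0 \<le> CB" "\<And>k. bounded_by CB (source_op a k)"
        using source_bounded[OF a'] by blast
      have comm: "bounded_by (3 * (1/2) ^ m) (\<lambda>y j. target_op a k (fib_mult h y) j - fib_mult h (target_op a k y) j)"
        if k: "k \<in> D" for k
      proof (rule fibre_commutator_bound[where P = "\<psi> (v k) a" and F = "\<phi> (v k) a" and K = "L a k" and N = N])
        show "bounded_op p (target_op a k)"
          by (rule bounded_byI_op[OF CA(2)])
        show "bounded_op p (\<psi> (v k) a)" "bounded_op p (\<phi> (v k) a)"
          using bounded_psi[OF v_range a'] bounded_phi[OF v_range a'] .
        show "compact_op p (L a k)"
          by (rule Lc[OF a])
        show "L a k = (\<lambda>y j. target_op a k y j - op_dsum (\<psi> (v k) a) (\<phi> (v k) a) y j)"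
          by (simp add: L_def)
        have "\<psi> (v k) a \<in> \<T>"
          using k a unfolding \<T>_def by auto
        then show "lp_norm p (\<lambda>i. \<psi> (v k) a (\<lambda>j. h j * x j) i - h i * \<psi> (v k) a x i) \<le> (1/2) ^ m * lp_norm p x"
          if "x \<in> lp p" for x
          using h(5) that by blast
        have "Inl ` {N..} \<inter> G a k = {}" "Inl ` {N..} \<inter> G' a k = {}"
          using disj k a unfolding FF_def by blast+
        then show "lp_norm p (L a k (restr (Inl ` {N..}) y)) \<le> (1/2) ^ m * lp_norm p y"
          "lp_norm p (restr (Inl ` {N..}) (L a k y)) \<le> (1/2) ^ m * lp_norm p y" if "y \<in> lp p" for y
          using G(3,4)[OF a] that by blast+
      qed (use h1 h0 in auto)
      have "lp_norm p (\<lambda>c. op_bigdsum (target_op a) (slot_mult h (\<lambda>c. perm_op (\<sigma> (Suc m)) x c - perm_op (\<sigma> m) x c)) c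
        - slot_mult h (\<lambda>c. perm_op (\<sigma> (Suc m)) (op_bigdsum (source_op a) x) c
            - perm_op (\<sigma> m) (op_bigdsum (source_op a) x) c) c)
        \<le> (2 * (3 * (1/2) ^ m) + 2 * (1/2) ^ m + (1/2) ^ m) * lp_norm p x"
      proof (rule increment_bound[where D = D and K = "K a" and K' = "K' a" and N = N, OF CA(2,1) CB(2,1)])
        show "bounded_by ((1/2) ^ m) (\<lambda>x c. (op_bigdsum (target_op a) (perm_op (\<sigma> m) x) c
            - perm_op (\<sigma> m) (op_bigdsum (source_op a) x) c) - K a x c)"
          using K(2)[OF a] unfolding R_def .
        show "bounded_by ((1/2) ^ m) (\<lambda>x c. (op_bigdsum (target_op a) (perm_op (\<sigma> (Suc m)) x) c
            - perm_op (\<sigma> (Suc m)) (op_bigdsum (source_op a) x) c) - K' a x c)"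
          using K''[OF a] unfolding R_def .
        have "{c. snd c \<in> Inl ` {N..}} \<inter> F a = {}"
          using disj a unfolding FF_def by blast
        then show "lp_norm p (restr {c. snd c \<in> Inl ` {N..}} (\<lambda>c. K' a x c - K a x c)) \<le> (1/2) ^ m * lp_norm p x"
          if "x \<in> lp p" for x
          using F(2)[OF a] that by blast
        show "compact_op p (K a)" "compact_op p (K' a)"
          using K(1)[OF a] K'(1)[OF a] .
      qed (use bij_perm comm h1 h0 x in \<open>auto simp: D_def\<close>)
      then show ?thesis
        by simp
    qed
    then have "good_stage m N h N'"
      unfolding good_stage_def using h(1-4) by blast
    then show ?thesis
      by blast
  qed
  then show ?thesis
    by blast
qed

lemma interpolation_exists:
  "\<exists>h N. interpolation p \<sigma> \<tau> h N \<and> (\<forall>m. good_stage m (N m) (h m) (N (Suc m)))"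
proof -
  obtain M where M: "\<And>m N. N \<ge> M m \<Longrightarrow> \<exists>h N'. good_stage m N h N'"
    using good_stage_exists by metis
  then obtain H N' where H: "\<And>m N. N \<ge> M m \<Longrightarrow> good_stage m N (H m N) (N' m N)"
    by metis
  \<comment> \<open>The next stage starts where the current \<open>h\<close> has already reached 1
    and above its own threshold; \<open>Suc\<close> makes the sequence strictly increasing.\<close>
  define N where "N = rec_nat (M 0) (\<lambda>m n. Suc (max (N' m n) (M (Suc m))))"
  have N: "N 0 = M 0" "N (Suc m) = Suc (max (N' m (N m)) (M (Suc m)))" for m
    by (simp_all add: N_def)
  have NM: "N m \<ge> M m" for m
    by (cases m) (simp_all add: N)
  define h where "h m = H m (N m)" for m
  have g: "good_stage m (N m) (h m) (N' m (N m))" for m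
    unfolding h_def by (rule H[OF NM])
  have le: "N' m (N m) \<le> N (Suc m)" "N m < N (Suc m)" for m
    using g[of m] by (auto simp: N good_stage_def)
  have "good_stage m (N m) (h m) (N (Suc m))" for m
    using g[of m] le[of m] unfolding good_stage_def by auto
  moreover have "interpolation p \<sigma> \<tau> h N"
  proof
    show "strict_mono N"
      using le(2) by (rule strict_mono_Suc_iff[THEN iffD2, OF allI])
    show "bij (\<sigma> m)" "finite {k. \<sigma> m k \<noteq> k}" for m
      by (fact bij_perm finite_perm)+
    show "\<sigma> (Suc m) k = \<tau> m (\<sigma> m k)" "\<tau> m (\<tau> m k) = k" for m k
      by (fact perm_Suc perm_invol)+
    show "h m i = 0" if "i < N m" for m i
      using g[of m] that by (auto simp: good_stage_def)
    show "h m i = 1" if "N (Suc m) \<le> i" for m i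
      using g[of m] le(1)[of m] that by (auto simp: good_stage_def)
    show "norm (1 - 2 * h m i) = 1" for m i
      using g[of m] by (auto simp: good_stage_def)
  qed
  ultimately show ?thesis
    by blast
qed

lemma intertwining_operator:
  "\<exists>U V :: (nat \<times> (nat + nat) \<Rightarrow> complex) \<Rightarrow> nat \<times> (nat + nat) \<Rightarrow> complex.
     bounded_by 2 U \<and> bounded_by 2 V \<and> (\<forall>x. V (U x) = x) \<and> (\<forall>y. U (V y) = y) \<and>
     (p = 2 \<longrightarrow> (\<forall>x\<in>lp p. lp_norm p (U x) = lp_norm p x)) \<and>
     (\<forall>a\<in>\<Lambda>. compact_op p (\<lambda>x c. op_bigdsum (target_op a) (U x) c - U (op_bigdsum (source_op a) x) c))"
proof -
  obtain h N where int: "interpolation p \<sigma> \<tau> h N" and good: "\<And>m. good_stage m (N m) (h m) (N (Suc m))"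
    using interpolation_exists by blast
  interpret I: interpolation p \<sigma> \<tau> h N
    by (rule int)
  have "compact_op p (\<lambda>x c. op_bigdsum (target_op a) (I.U x) c - I.U (op_bigdsum (source_op a) x) c)" if a: "a \<in> \<Lambda>" for a
  proof (rule I.compact_intertwiner[where C = 9 and ?m0.0 = "Suc (to_nat_on \<Lambda> a)"])
    obtain CA where CA: "0 \<le> CA" "\<And>k. bounded_by CA (target_op a k)"
      using target_bounded[OF a] by blast
    obtain CB where CB: "0 \<le> CB" "\<And>k. bounded_by CB (source_op a k)"
      using source_bounded[OF a] by blast
    show "bounded_op p (op_bigdsum (target_op a))" "bounded_op p (op_bigdsum (source_op a))"
      using bounded_byI_op[OF bounded_by_bigdsum[of CA "target_op a", OF CA(2,1)]]
        bounded_byI_op[OF bounded_by_bigdsum[of CB "source_op a", OF CB(2,1)]] .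
    fix m assume "Suc (to_nat_on \<Lambda> a) \<le> m"
    then have am: "a \<in> indices m"
      using a by (simp add: indices_def)
    show "\<exists>K. compact_op p K \<and> bounded_by ((1/2) ^ m) (\<lambda>x c. (op_bigdsum (target_op a) (perm_op (\<sigma> m) x) c
        - perm_op (\<sigma> m) (op_bigdsum (source_op a) x) c) - K x c)"
      by (rule stage_intertwines[OF am])
    fix x :: "nat \<times> (nat + nat) \<Rightarrow> complex" assume "x \<in> lp p"
    then show "lp_norm p (\<lambda>c. op_bigdsum (target_op a) (slot_mult (h m) (\<lambda>c. perm_op (\<sigma> (Suc m)) x c - perm_op (\<sigma> m) x c)) c
        - slot_mult (h m) (\<lambda>c. perm_op (\<sigma> (Suc m)) (op_bigdsum (source_op a) x) c
            - perm_op (\<sigma> m) (op_bigdsum (source_op a) x) c) c) \<le> 9 * (1/2) ^ m * lp_norm p x"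
      using good[of m] am unfolding good_stage_def by blast
  qed simp
  then show ?thesis
    using I.bounded_by_U I.bounded_by_V I.V_U I.U_V I.U_isometric
    by (intro exI[of _ "I.U"] exI[of _ "I.V"] conjI allI impI ballI)
qed

text \<open>A Hilbert hotel on the first summands of the even slots: slot 0 empties into the extra
  summand and slot \<open>k + 2\<close> moves to slot \<open>k\<close>. The step is 2 because the
  even slots are the ones known to carry the parameter 0.\<close>

definition fold_slot :: "nat \<times> (nat + nat) \<Rightarrow> nat + nat \<times> (nat + nat)" where
  "fold_slot c = (case snd c of
     Inl i \<Rightarrow> if fst c = 0 then Inl i else Inr (if even (fst c) then fst c - 2 else fst c, Inl i)
   | Inr j \<Rightarrow> Inr c)"

definition unfold_slot :: "nat + nat \<times> (nat + nat) \<Rightarrow> nat \<times> (nat + nat)" where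
  "unfold_slot d = (case d of Inl i \<Rightarrow> (0, Inl i)
   | Inr c \<Rightarrow> (case snd c of Inl i \<Rightarrow> (if even (fst c) then fst c + 2 else fst c, Inl i) | Inr j \<Rightarrow> c))"

lemma unfold_fold_slot: "unfold_slot (fold_slot c) = c"
proof (cases c)
  case (Pair k j)
  have "even k \<Longrightarrow> k \<noteq> 0 \<Longrightarrow> k - 2 + 2 = k"
    by presburger
  then show ?thesis
    by (cases j) (auto simp: Pair fold_slot_def unfold_slot_def)
qed

lemma fold_unfold_slot: "fold_slot (unfold_slot d) = d"
  by (cases d) (auto simp: fold_slot_def unfold_slot_def split: sum.splits)

text \<open>The extra summand \<open>\<psi>\<^sub>1\<close> takes the place of \<open>\<psi>\<^sub>0\<close> in slot \<open>0\<close>; the displaced copies of \<open>\<psi>\<^sub>0\<close>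
  move on along the even slots, where \<open>\<rho>\<^sub>0\<close> splits exactly.\<close>

lemma source_op_fold:
  assumes a: "a \<in> \<Lambda>" and y: "y \<in> lp p"
  shows "op_bigdsum (source_op a) (\<lambda>c. y (fold_slot c)) =
    (\<lambda>c. op_dsum (\<psi> 1 a) (op_bigdsum (\<lambda>k. \<rho> (v k) a)) y (fold_slot c))"
proof
  fix c :: "nat \<times> (nat + nat)"
  obtain k j where c: "c = (k, j)"
    by (cases c)
  have sl: "(\<lambda>j. y (fold_slot (k, j))) \<in> lp p" for k
  proof -
    have "inj (\<lambda>j. fold_slot (k, j))"
    proof (rule injI)
      fix i j assume "fold_slot (k, i) = fold_slot (k, j)"
      then have "unfold_slot (fold_slot (k, i)) = unfold_slot (fold_slot (k, j))"
        by simp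
      then show "i = j"
        by (simp add: unfold_fold_slot)
    qed
    from bounded_byD(1)[OF bounded_by_reindex[OF this] y] show ?thesis .
  qed
  have sl': "(\<lambda>j. y (Inr (k, j))) \<in> lp p" for k
  proof -
    have "inj (\<lambda>j. Inr (k, j) :: nat + nat \<times> (nat + nat))"
      by (auto simp: inj_on_def)
    from bounded_byD(1)[OF bounded_by_reindex[OF this] y] show ?thesis .
  qed
  have v_even': "v k = 0" if "even k" for k
    using v_even[of "k div 2"] that by simp
  have ev: "\<rho> (v k) a x = op_dsum (\<psi> 0 a) (\<phi> 0 a) x" if "even k" "x \<in> lp p" for k x
    using rho_0[OF a that(2)] v_even'[OF that(1)] by simp
  show "op_bigdsum (source_op a) (\<lambda>c. y (fold_slot c)) c =
      op_dsum (\<psi> 1 a) (op_bigdsum (\<lambda>k. \<rho> (v k) a)) y (fold_slot c)"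
  proof (cases "even k")
    case False
    then have "(\<lambda>j. y (fold_slot (k, j))) = (\<lambda>j. y (Inr (k, j)))" "fold_slot (k, j) = Inr (k, j)"
      by (auto simp: fun_eq_iff fold_slot_def split: sum.splits)
    with False show ?thesis
      by (cases "k = 0") (simp_all add: c op_bigdsum_apply op_dsum_def source_op_def)
  next
    case True
    have B: "source_op a k x = op_dsum (\<psi> (if k = 0 then 1 else 0) a) (\<phi> 0 a) x" if "x \<in> lp p" for x
      using ev[OF True that] by (simp add: source_op_def)
    show ?thesis
    proof (cases j)
      case (Inl i)
      then show ?thesis
        using True B[OF sl] ev[OF _ sl', of "k - 2" "k - 2"]
        by (cases "k = 0") (simp_all add: c op_bigdsum_apply op_dsum_def fold_slot_def)
    next
      case (Inr j')
      then show ?thesis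
        using True B[OF sl] ev[OF _ sl', of k k]
        by (simp add: c op_bigdsum_apply op_dsum_def fold_slot_def)
    qed
  qed
qed

text \<open>\<open>U\<close> maps from the source sum to the target sum while \<open>S\<close> must
  lead the other way, so \<open>S\<close> is the inverse \<open>V\<close> followed by the
  relabelling. Its defect is minus \<open>S\<close> applied to the relabelled defect of
  \<open>U\<close>, hence compact.\<close>

lemma similarity:
  "\<exists>S Sinv. bounded_by 2 S \<and> bounded_by 2 Sinv \<and> (\<forall>x\<in>lp p. Sinv (S x) = x) \<and> (\<forall>y\<in>lp p. S (Sinv y) = y) \<and>
     (p = 2 \<longrightarrow> (\<forall>x\<in>lp p. lp_norm p (S x) = lp_norm p x)) \<and>
     (\<forall>a\<in>\<Lambda>. compact_op p (\<lambda>y j. op_dsum (\<psi> 1 a) (op_bigdsum (\<lambda>k. \<rho> (v k) a)) y j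
        - S (op_bigdsum (\<lambda>k. \<rho> (v k) a) (Sinv y)) j))"
proof -
  obtain U V :: "(nat \<times> (nat + nat) \<Rightarrow> complex) \<Rightarrow> nat \<times> (nat + nat) \<Rightarrow> complex"
    where UV: "bounded_by 2 U" "bounded_by 2 V" "\<And>x. V (U x) = x" "\<And>y. U (V y) = y"
      "p = 2 \<Longrightarrow> x \<in> lp p \<Longrightarrow> lp_norm p (U x) = lp_norm p x"
      "\<And>a. a \<in> \<Lambda> \<Longrightarrow> compact_op p (\<lambda>x c. op_bigdsum (target_op a) (U x) c - U (op_bigdsum (source_op a) x) c)" for x
    using intertwining_operator by blast
  have inj: "inj fold_slot" "inj unfold_slot"
    by (metis injI unfold_fold_slot, metis injI fold_unfold_slot)
  note bf = bounded_by_reindex[OF inj(1)] and bu = bounded_by_reindex[OF inj(2)]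
  define S where "S x = (\<lambda>d. V x (unfold_slot d))" for x
  define Sinv where "Sinv y = U (\<lambda>c. y (fold_slot c))" for y
  have bS: "bounded_by 2 S" and bSinv: "bounded_by 2 Sinv"
    using bounded_by_comp[OF bu UV(2)] bounded_by_comp[OF UV(1) bf] by (simp_all add: S_def[abs_def] Sinv_def[abs_def])
  have SS: "Sinv (S x) = x" "S (Sinv y) = y" for x y
    by (simp_all add: S_def Sinv_def UV unfold_fold_slot fold_unfold_slot)
  have iso: "lp_norm p (S x) = lp_norm p x" if "p = 2" "x \<in> lp p" for x
  proof -
    have Vx: "V x \<in> lp p"
      by (rule bounded_byD(1)[OF UV(2) that(2)])
    then show ?thesis
      unfolding S_def reindex_isometric(2)[OF unfold_fold_slot fold_unfold_slot Vx]
      using UV(5)[OF that(1) Vx] UV(4) by simp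
  qed
  have comp: "compact_op p (\<lambda>y j. op_dsum (\<psi> 1 a) (op_bigdsum (\<lambda>k. \<rho> (v k) a)) y j
      - S (op_bigdsum (\<lambda>k. \<rho> (v k) a) (Sinv y)) j)" if a: "a \<in> \<Lambda>" for a
  proof -
    let ?X = "\<lambda>x c. op_bigdsum (target_op a) (U x) c - U (op_bigdsum (source_op a) x) c"
    obtain CA where CA: "0 \<le> CA" "\<And>k. bounded_by CA (target_op a k)"
      using target_bounded[OF a] by blast
    obtain CB where CB: "0 \<le> CB" "\<And>k. bounded_by CB (source_op a k)"
      using source_bounded[OF a] by blast
    have bA: "bounded_by CA (op_bigdsum (target_op a))" and bB: "bounded_by CB (op_bigdsum (source_op a))"
      using bounded_by_bigdsum[of CA "target_op a", OF CA(2,1)] bounded_by_bigdsum[of CB "source_op a", OF CB(2,1)] .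
    have "compact_op p (\<lambda>y. S (?X (\<lambda>c. y (fold_slot c))))"
      by (rule compact_op_comp_left[OF bounded_byI_op[OF bS]
            compact_op_comp_right[OF UV(6)[OF a] bounded_byI_op[OF bf]]])
    then have "compact_op p (\<lambda>y d. (-1) * S (?X (\<lambda>c. y (fold_slot c))) d)"
      by (rule compact_op_scale)
    then show ?thesis
    proof (rule compact_op_cong)
      fix y :: "nat + nat \<times> (nat + nat) \<Rightarrow> complex" assume y: "y \<in> lp p"
      let ?x = "\<lambda>c. y (fold_slot c)"
      have x: "?x \<in> lp p"
        using bounded_byD(1)[OF bf y] .
      have l: "op_bigdsum (target_op a) (U ?x) \<in> lp p" "U (op_bigdsum (source_op a) ?x) \<in> lp p"
        using bounded_byD(1)[OF bA bounded_byD(1)[OF UV(1) x]] bounded_byD(1)[OF UV(1) bounded_byD(1)[OF bB x]] .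
      have 1: "S (U (op_bigdsum (source_op a) ?x)) = op_dsum (\<psi> 1 a) (op_bigdsum (\<lambda>k. \<rho> (v k) a)) y"
        unfolding source_op_fold[OF a y] by (simp add: S_def UV fold_unfold_slot)
      have 2: "op_bigdsum (target_op a) (U ?x) = op_bigdsum (\<lambda>k. \<rho> (v k) a) (Sinv y)"
        by (simp add: Sinv_def target_op_def[abs_def])
      have "S (?X ?x) = (\<lambda>d. S (op_bigdsum (\<lambda>k. \<rho> (v k) a) (Sinv y)) d
          - op_dsum (\<psi> 1 a) (op_bigdsum (\<lambda>k. \<rho> (v k) a)) y d)"
        using bounded_by_diff[OF bS l] unfolding 1 unfolding 2 .
      then show "(\<lambda>d. (-1) * S (?X ?x) d) = (\<lambda>j. op_dsum (\<psi> 1 a) (op_bigdsum (\<lambda>k. \<rho> (v k) a)) y j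
          - S (op_bigdsum (\<lambda>k. \<rho> (v k) a) (Sinv y)) j)"
        by (simp only:) simp
    qed
  qed
  show ?thesis
    using bS bSinv SS iso comp by (intro exI[of _ S] exI[of _ Sinv] conjI ballI impI)
qed

end

theorem theorem7p17:
  fixes p :: real and \<Lambda> :: "'a set"
    and \<psi> \<phi> :: "real \<Rightarrow> 'a \<Rightarrow> (nat \<Rightarrow> complex) \<Rightarrow> (nat \<Rightarrow> complex)"
    and \<rho> :: "real \<Rightarrow> 'a \<Rightarrow> ((nat + nat) \<Rightarrow> complex) \<Rightarrow> ((nat + nat) \<Rightarrow> complex)"
  assumes p: "1 < p"
    and cnt: "countable \<Lambda>"
    and bdd_psi: "\<forall>t\<in>{0..1}. \<forall>a\<in>\<Lambda>. bounded_op p (\<psi> t a)"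
    and bdd_phi: "\<forall>t\<in>{0..1}. \<forall>a\<in>\<Lambda>. bounded_op p (\<phi> t a)"
    and bdd_rho: "\<forall>t\<in>{0..1}. \<forall>a\<in>\<Lambda>. bounded_op p (\<rho> t a)"
    and h1: "\<forall>a\<in>\<Lambda>. \<forall>x\<in>lp p. \<rho> 0 a x = op_dsum (\<psi> 0 a) (\<phi> 0 a) x"
    and h2: "\<forall>t\<in>{0..1}. \<forall>a\<in>\<Lambda>.
               compact_op p (\<lambda>x i. \<rho> t a x i - op_dsum (\<psi> t a) (\<phi> t a) x i)"
    and h3: "\<forall>a\<in>\<Lambda>. \<forall>t0\<in>{0..1}. \<forall>e>0. \<exists>d>0. \<forall>t\<in>{0..1}.
               \<bar>t - t0\<bar> < d \<longrightarrow> ess_norm p (\<lambda>x i. \<psi> t a x i - \<psi> t0 a x i) < e"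
    and h4: "\<forall>a\<in>\<Lambda>. \<exists>C. \<forall>t\<in>{0..1}. op_norm p (\<rho> t a) \<le> C"
  shows "\<exists>v :: nat \<Rightarrow> real. (\<forall>k. dyadic (v k) \<and> v k \<in> {0..1}) \<and>
           similar_mod_compact p 16 \<Lambda>
             (\<lambda>a. op_bigdsum (\<lambda>k. \<rho> (v k) a))
             (\<lambda>a. op_dsum (\<psi> 1 a) (op_bigdsum (\<lambda>k. \<rho> (v k) a))) \<and>
           (p = 2 \<longrightarrow> unitarily_equiv_mod_compact p \<Lambda>
             (\<lambda>a. op_bigdsum (\<lambda>k. \<rho> (v k) a))
             (\<lambda>a. op_dsum (\<psi> 1 a) (op_bigdsum (\<lambda>k. \<rho> (v k) a))))"
proof -
  interpret homotopy p \<Lambda> \<psi> \<phi> \<rho>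
    by unfold_locales (use assms in \<open>simp_all\<close>)
  obtain v enc where "dyadic_slots v enc" and v: "\<And>k. dyadic (v k)" "\<And>k. v k \<in> {0..1}" "\<And>k. v (2 * k) = 0"
    using dyadic_slots_exist by blast
  interpret dyadic_slots v enc
    by fact
  have "\<exists>\<eta>. \<forall>m. \<eta> m > 0 \<and> (\<forall>a\<in>indices m. \<forall>s\<in>{0..1}. \<forall>t\<in>{0..1}. \<bar>s - t\<bar> \<le> \<eta> m \<longrightarrow> ess_close a ((1/2) ^ m) s t)"
    using modulus_exists by (intro choice allI) simp
  then obtain \<eta> :: "nat \<Rightarrow> real" where *: "\<forall>m. \<eta> m > 0 \<and>
      (\<forall>a\<in>indices m. \<forall>s\<in>{0..1}. \<forall>t\<in>{0..1}. \<bar>s - t\<bar> \<le> \<eta> m \<longrightarrow> ess_close a ((1/2) ^ m) s t)"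
    by (rule exE)
  have \<eta>: "\<eta> m > 0"
    "a \<in> indices m \<Longrightarrow> s \<in> {0..1} \<Longrightarrow> t \<in> {0..1} \<Longrightarrow> \<bar>s - t\<bar> \<le> \<eta> m \<Longrightarrow> ess_close a ((1/2) ^ m) s t" for m a s t
    using *[THEN spec, of m] by blast+
  obtain \<sigma> \<tau> where \<sigma>\<tau>: "\<forall>m. bij (\<sigma> m) \<and> finite {k. \<sigma> m k \<noteq> k} \<and> (\<forall>k. \<sigma> (Suc m) k = \<tau> m (\<sigma> m k)) \<and>
     (\<forall>k. \<tau> m (\<tau> m k) = k) \<and> (\<forall>k. \<bar>source k - v (\<sigma> m k)\<bar> \<le> \<eta> m)"
    using permutation_sequence[of \<eta>] \<eta>(1) by blast
  interpret homotopy_slots p \<Lambda> \<psi> \<phi> \<rho> v enc \<eta> \<sigma> \<tau>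
    by unfold_locales (use v \<eta>(2) \<sigma>\<tau> in \<open>simp_all\<close>)
  obtain S Sinv where S: "bounded_by 2 S" "bounded_by 2 Sinv" "\<forall>x\<in>lp p. Sinv (S x) = x" "\<forall>y\<in>lp p. S (Sinv y) = y"
    "p = 2 \<longrightarrow> (\<forall>x\<in>lp p. lp_norm p (S x) = lp_norm p x)"
    "\<forall>a\<in>\<Lambda>. compact_op p (\<lambda>y j. op_dsum (\<psi> 1 a) (op_bigdsum (\<lambda>k. \<rho> (v k) a)) y j
        - S (op_bigdsum (\<lambda>k. \<rho> (v k) a) (Sinv y)) j)"
    using similarity by (elim exE conjE)
  note b = bounded_byI_op[OF S(1)] bounded_byI_op[OF S(2)]
  \<comment> \<open>Relabelling and permuting are isometric, and \<open>mix\<close> contributes a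
    factor 2 to \<open>S\<close> and another to its inverse, so the constant obtained is 4.\<close>
  have "op_norm p S * op_norm p Sinv \<le> 2 * 2"
    by (intro mult_mono op_norm_le S op_norm_nonneg b) auto
  then have "op_norm p S * op_norm p Sinv \<le> 16"
    by simp
  then have "similar_mod_compact p 16 \<Lambda> (\<lambda>a. op_bigdsum (\<lambda>k. \<rho> (v k) a))
      (\<lambda>a. op_dsum (\<psi> 1 a) (op_bigdsum (\<lambda>k. \<rho> (v k) a)))"
    unfolding similar_mod_compact_def using S(3,4,6) b by (intro exI[of _ S] exI[of _ Sinv] conjI)
  moreover have "unitarily_equiv_mod_compact p \<Lambda> (\<lambda>a. op_bigdsum (\<lambda>k. \<rho> (v k) a))
      (\<lambda>a. op_dsum (\<psi> 1 a) (op_bigdsum (\<lambda>k. \<rho> (v k) a)))" if "p = 2"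
    unfolding unitarily_equiv_mod_compact_def
    using S(3-6) b that by (intro exI[of _ S] exI[of _ Sinv] conjI) simp_all
  ultimately show ?thesis
    using v by blast
qed

end
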